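(* Suppose that $M$ is RDDZ, $b,t\ge0$ entrywise, we can sample from $t/\|t\|_1$ in $O(1)$ time, $\|t\|_1$, $\mathrm{nnz}(M)$, $f_{\mathrm{row}}(M)$ are known, $b=e_w$ for a given $w\in[n]$, and $t^{\top}x^{\ast}\ge\eta$ for a given $\eta>0$. Then there exists a randomized algorithm that computes $\hat x$ with $\Pr\{|\hat x-t^{\top}x^{\ast}|\le\varepsilon\|D_M^{-1}b\|_\infty^{1/2}\,t^{\top}x^{\ast}\}\ge\frac34$ with average time complexity $$O\big(f_{\mathrm{row}}(M)^{1/2}(\mathrm{nnz}(M)/n)^{1/2}\|t\|_1^{1/2}L^2\varepsilon^{-1}\eta^{-1/2}\big),$$ where the average is over all choices of $w\in[n]$.
   Context: Setting: $M\in\mathbb{R}^{n\times n}$, $b\in\operatorname{range}(M)$, $t\in\mathbb{R}^n$, $t\ne0$, nonzero entries of absolute value in $[1/\mathrm{poly}(n),\mathrm{poly}(n)]$. RDDZ: positive diagonal, $M(j,j)\ge\sum_{k\ne j}|M(j,k)|$, and nonpositive off-diagonal entries. Write $M=D_M-A_M^{\top}$ ($D_M$ diagonal part, $A_M^{\top}$ zero diagonal); $x^{\ast}:=\frac12\sum_{\ell\ge0}(\frac12(I+D_M^{-1}A_M^{\top}))^{\ell}D_M^{-1}b$. Access: diagonal of $M$ in $O(1)$; nonzero entries of rows/columns of $M$ in time linear in their number; entries of $b,t$ in $O(1)$. The algorithm is given $\varepsilon>0$ and $0<\gamma\le\gamma_{\max}(M)$ with $\gamma_{\max}(M)=\max_{p\in[1,\infty]}\big(1-\|\frac12(I+D_M^{-1/q}A_M^{\top}D_M^{-1/p})|_{\operatorname{range}(I-D_M^{-1/q}A_M^{\top}D_M^{-1/p})}\|_p\big)$,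 $q$ conjugate to $p$; $L=\Theta\big(\frac1\gamma\log(\frac{1}{\gamma E}d_{\max}(M)\|t\|_0\|D_M^{-1}t\|_\infty\|b\|_0\|D_M^{-1}b\|_\infty)\big)$, $E$ the target accuracy, with suitable bounds on quantities in the log known. $f_{\mathrm{row}}(M)$: maximum time to simulate one step of the (possibly terminating) random walk with transition matrix $\frac12(I+D_M^{-1}|A_M^{\top}|)$; $\mathrm{nnz}(M)$ = number of nonzero entries. *)

theory Defs
  imports "HOL-Probability.Probability" "HOL-Probability.SPMF" "Jordan_Normal_Form.Matrix"
begin

unbundle no vec_syntax
no_notation inner (infix "\<bullet>" 70)
hide_type (open) Finite_Cartesian_Product.vec
hide_const (open) Finite_Cartesian_Product.vec Finite_Cartesian_Product.mat
  Finite_Cartesian_Product.row Finite_Cartesian_Product.column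

section \<open>Matrices and vectors\<close>

definition diag_part :: "real mat \<Rightarrow> real mat" where
  "diag_part M = mat_diag (dim_row M) (\<lambda>i. M $$ (i, i))"

text \<open>The matrix \<open>A\<^sub>M\<^sup>T\<close> of the splitting \<open>M = D\<^sub>M - A\<^sub>M\<^sup>T\<close>.\<close>
definition adj_T :: "real mat \<Rightarrow> real mat" where
  "adj_T M = diag_part M - M"

definition diag_powr :: "real mat \<Rightarrow> real \<Rightarrow> real mat" where
  "diag_powr M a = mat_diag (dim_row M) (\<lambda>i. M $$ (i, i) powr a)"

definition diag_inv :: "real mat \<Rightarrow> real mat" where
  "diag_inv M = mat_diag (dim_row M) (\<lambda>i. inverse (M $$ (i, i)))"

definition rddz :: "real mat \<Rightarrow> bool" where
  "rddz M \<longleftrightarrow> square_mat M \<and>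
     (\<forall>j<dim_row M. M $$ (j, j) > 0 \<and>
        M $$ (j, j) \<ge> (\<Sum>k\<in>{..<dim_row M} - {j}. \<bar>M $$ (j, k)\<bar>) \<and>
        (\<forall>k<dim_row M. k \<noteq> j \<longrightarrow> M $$ (j, k) \<le> 0))"

definition mat_range :: "real mat \<Rightarrow> real vec set" where
  "mat_range M = {M *\<^sub>v x | x. x \<in> carrier_vec (dim_col M)}"

definition poly_entry :: "nat \<Rightarrow> nat \<Rightarrow> real \<Rightarrow> bool" where
  "poly_entry c n x \<longleftrightarrow> x \<noteq> 0 \<longrightarrow> 1 / (real c * real n ^ c) \<le> \<bar>x\<bar> \<and> \<bar>x\<bar> \<le> real c * real n ^ c"

definition poly_entries :: "nat \<Rightarrow> real mat \<Rightarrow> real vec \<Rightarrow> real vec \<Rightarrow> bool" where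
  "poly_entries c M b t \<longleftrightarrow>
     (\<forall>i<dim_row M. \<forall>j<dim_col M. poly_entry c (dim_row M) (M $$ (i, j))) \<and>
     (\<forall>i<dim_vec b. poly_entry c (dim_row M) (b $ i)) \<and>
     (\<forall>i<dim_vec t. poly_entry c (dim_row M) (t $ i))"

definition lazy_mat :: "real mat \<Rightarrow> real mat" where
  "lazy_mat M = (1/2) \<cdot>\<^sub>m (1\<^sub>m (dim_row M) + diag_inv M * adj_T M)"

definition xstar :: "real mat \<Rightarrow> real vec \<Rightarrow> real vec" where
  "xstar M b = vec (dim_row M)
     (\<lambda>i. 1/2 * (\<Sum>l. (lazy_mat M ^\<^sub>m l *\<^sub>v (diag_inv M *\<^sub>v b)) $ i))"

definition norm_p :: "ereal \<Rightarrow> real vec \<Rightarrow> real" where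
  "norm_p p x =
     (if p = \<infinity> then Max (insert 0 ((\<lambda>i. \<bar>x $ i\<bar>) ` {..<dim_vec x}))
      else (\<Sum>i<dim_vec x. \<bar>x $ i\<bar> powr real_of_ereal p) powr (1 / real_of_ereal p))"

definition norm_0 :: "real vec \<Rightarrow> nat" where
  "norm_0 x = card {i. i < dim_vec x \<and> x $ i \<noteq> 0}"

definition nnz :: "real mat \<Rightarrow> nat" where
  "nnz M = card {(i, j). i < dim_row M \<and> j < dim_col M \<and> M $$ (i, j) \<noteq> 0}"

definition d_max :: "real mat \<Rightarrow> real" where
  "d_max M = Max ((\<lambda>i. M $$ (i, i)) ` {..<dim_row M})"

text \<open>Operator norm, with respect to \<open>norm_p p\<close>, of the restriction of \<open>H\<close> to the subspace \<open>V\<close>.\<close>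
definition restr_op_norm :: "ereal \<Rightarrow> real mat \<Rightarrow> real vec set \<Rightarrow> real" where
  "restr_op_norm p H V = Sup {norm_p p (H *\<^sub>v x) | x. x \<in> V \<and> norm_p p x \<le> 1}"

definition scaled_adj_T :: "real mat \<Rightarrow> ereal \<Rightarrow> ereal \<Rightarrow> real mat" where
  "scaled_adj_T M p q =
     diag_powr M (- real_of_ereal (1 / q)) * adj_T M * diag_powr M (- real_of_ereal (1 / p))"

definition gamma_p :: "real mat \<Rightarrow> ereal \<Rightarrow> ereal \<Rightarrow> real" where
  "gamma_p M p q = 1 - restr_op_norm p
     ((1/2) \<cdot>\<^sub>m (1\<^sub>m (dim_row M) + scaled_adj_T M p q))
     (mat_range (1\<^sub>m (dim_row M) - scaled_adj_T M p q))"

text \<open>The exponents range over all conjugate pairs in \<open>[1, \<infinity>]\<close>; \<open>1 / \<infinity> = 0\<close> in \<^typ>\<open>ereal\<close>.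
  The set is bounded above by 1, so its supremum is the maximum whenever the latter is attained.\<close>
definition gamma_max :: "real mat \<Rightarrow> real" where
  "gamma_max M = Sup {gamma_p M p q | p q. 1 \<le> p \<and> 1 \<le> q \<and> 1 / p + 1 / q = 1}"

section \<open>The computational model\<close>

text \<open>
  A real RAM with registers and (zero-initialised, unbounded) arrays for natural numbers and for
  reals; every basic instruction takes unit time. Naturals only have addition and truncated subtraction, and there is
  no rounding of reals to naturals, so neither sort can be used to pack several words into one.
  Instructions may contain nested expressions; as a program is a fixed finite object,
  this affects running times by a constant factor only.
\<close>

datatype nexp =
    NConst nat
  | NReg nat
  | NArr nat nexp
  | NAdd nexp nexp
  | NSub nexp nexp

datatype rexp =
    OfNat nexp
  | RReg nat
  | RArr nat nexp
  | RAdd rexp rexp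
  | RSub rexp rexp
  | RMul rexp rexp
  | RDiv rexp rexp

datatype bexp =
    NLess nexp nexp
  | RLess rexp rexp
  | BNot bexp
  | BAnd bexp bexp

text \<open>
  In \<open>GetRow c ia ra v\<close> and \<open>GetCol c ia ra v\<close>, register \<open>c\<close> receives the number of
  nonzero entries, and the arrays \<open>ia\<close> and \<open>ra\<close> receive their positions and values.
\<close>
datatype com =
    Skip
  | SetN nat nexp
  | SetR nat rexp
  | PutN nat nexp nexp
  | PutR nat nexp rexp
  | Seq com com
  | Cond bexp com com
  | While bexp com
  | GetDiag nat nexp
  | GetB nat nexp
  | GetT nat nexp
  | GetRow nat nat nat nexp
  | GetCol nat nat nat nexp
  | Coin nat
  | SampleT nat
  | WalkStep nat nexp

record state =
  nreg :: "nat \<Rightarrow> nat"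
  rreg :: "nat \<Rightarrow> real"
  narr :: "nat \<Rightarrow> nat \<Rightarrow> nat"
  rarr :: "nat \<Rightarrow> nat \<Rightarrow> real"
  clock :: nat

text \<open>
  The data behind the access instructions. The nonzero entries of row (column) \<open>v\<close> are
  enumerated in the order of \<open>row_list v\<close> (\<open>col_list v\<close>), and \<open>step_time v\<close> is the time
  for simulating one step of the random walk from \<open>v\<close>.
\<close>
record problem =
  Mat :: "real mat"
  Bvec :: "real vec"
  Tvec :: "real vec"
  row_list :: "nat \<Rightarrow> nat list"
  col_list :: "nat \<Rightarrow> nat list"
  step_time :: "nat \<Rightarrow> nat"

definition valid_access :: "real mat \<Rightarrow> (nat \<Rightarrow> nat list) \<Rightarrow> (nat \<Rightarrow> nat list) \<Rightarrow> (nat \<Rightarrow> nat) \<Rightarrow> bool" where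
  "valid_access M rl cl st \<longleftrightarrow> (\<forall>v<dim_row M.
     distinct (rl v) \<and> set (rl v) = {u. u < dim_col M \<and> M $$ (v, u) \<noteq> 0} \<and>
     distinct (cl v) \<and> set (cl v) = {u. u < dim_row M \<and> M $$ (u, v) \<noteq> 0} \<and>
     1 \<le> st v)"

definition f_row :: "real mat \<Rightarrow> (nat \<Rightarrow> nat) \<Rightarrow> nat" where
  "f_row M st = Max (st ` {..<dim_row M})"

definition unit_problem :: "real mat \<Rightarrow> real vec \<Rightarrow> (nat \<Rightarrow> nat list) \<Rightarrow> (nat \<Rightarrow> nat list) \<Rightarrow>
    (nat \<Rightarrow> nat) \<Rightarrow> nat \<Rightarrow> problem" where
  "unit_problem M t rl cl st w = \<lparr>Mat = M, Bvec = unit_vec (dim_row M) w, Tvec = t,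
     row_list = rl, col_list = cl, step_time = st\<rparr>"

primrec nval :: "state \<Rightarrow> nexp \<Rightarrow> nat" where
  "nval s (NConst k) = k"
| "nval s (NReg x) = nreg s x"
| "nval s (NArr a e) = narr s a (nval s e)"
| "nval s (NAdd e1 e2) = nval s e1 + nval s e2"
| "nval s (NSub e1 e2) = nval s e1 - nval s e2"

primrec rval :: "state \<Rightarrow> rexp \<Rightarrow> real" where
  "rval s (OfNat e) = real (nval s e)"
| "rval s (RReg x) = rreg s x"
| "rval s (RArr a e) = rarr s a (nval s e)"
| "rval s (RAdd e1 e2) = rval s e1 + rval s e2"
| "rval s (RSub e1 e2) = rval s e1 - rval s e2"
| "rval s (RMul e1 e2) = rval s e1 * rval s e2"
| "rval s (RDiv e1 e2) = rval s e1 / rval s e2"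

primrec bval :: "state \<Rightarrow> bexp \<Rightarrow> bool" where
  "bval s (NLess e1 e2) \<longleftrightarrow> nval s e1 < nval s e2"
| "bval s (RLess e1 e2) \<longleftrightarrow> rval s e1 < rval s e2"
| "bval s (BNot b) \<longleftrightarrow> \<not> bval s b"
| "bval s (BAnd b1 b2) \<longleftrightarrow> bval s b1 \<and> bval s b2"

definition tick :: "nat \<Rightarrow> state \<Rightarrow> state" where
  "tick k s = s\<lparr>clock := clock s + k\<rparr>"

definition set_nreg :: "nat \<Rightarrow> nat \<Rightarrow> state \<Rightarrow> state" where
  "set_nreg x k s = s\<lparr>nreg := (nreg s)(x := k)\<rparr>"

definition set_rreg :: "nat \<Rightarrow> real \<Rightarrow> state \<Rightarrow> state" where
  "set_rreg x r s = s\<lparr>rreg := (rreg s)(x := r)\<rparr>"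

definition put_narr :: "nat \<Rightarrow> nat \<Rightarrow> nat \<Rightarrow> state \<Rightarrow> state" where
  "put_narr a i k s = s\<lparr>narr := (narr s)(a := (narr s a)(i := k))\<rparr>"

definition put_rarr :: "nat \<Rightarrow> nat \<Rightarrow> real \<Rightarrow> state \<Rightarrow> state" where
  "put_rarr a i r s = s\<lparr>rarr := (rarr s)(a := (rarr s a)(i := r))\<rparr>"

definition load_list :: "'a list \<Rightarrow> (nat \<Rightarrow> 'a) \<Rightarrow> nat \<Rightarrow> 'a" where
  "load_list xs f i = (if i < length xs then xs ! i else f i)"

definition load_entries :: "nat \<Rightarrow> nat \<Rightarrow> nat \<Rightarrow> nat list \<Rightarrow> (nat \<Rightarrow> real) \<Rightarrow> state \<Rightarrow> state" where
  "load_entries c ia ra us f s = tick (1 + length us) (s\<lparr>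
     nreg := (nreg s)(c := length us),
     narr := (narr s)(ia := load_list us (narr s ia)),
     rarr := (rarr s)(ra := load_list (map f us) (rarr s ra))\<rparr>)"

text \<open>
  One step, from \<open>v\<close>, of the random walk with the substochastic transition matrix
  \<open>1/2 (I + D\<^sub>M\<^sup>-\<^sup>1 |A\<^sub>M\<^sup>T|)\<close>; the value \<open>dim_row M\<close>, which is not a valid index,
  stands for termination of the walk.
\<close>
definition walk_prob :: "real mat \<Rightarrow> nat \<Rightarrow> nat \<Rightarrow> real" where
  "walk_prob M v u = 1/2 * ((if u = v then 1 else 0) + \<bar>adj_T M $$ (v, u)\<bar> / M $$ (v, v))"

definition walk_pmf :: "real mat \<Rightarrow> nat \<Rightarrow> nat pmf" where
  "walk_pmf M v = embed_pmf (\<lambda>u.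
     if u < dim_row M then walk_prob M v u
     else if u = dim_row M then 1 - (\<Sum>u'<dim_row M. walk_prob M v u')
     else 0)"

text \<open>For nonnegative \<open>t \<noteq> 0\<close>, the distribution \<open>t / \<parallel>t\<parallel>\<^sub>1\<close>.\<close>
definition t_pmf :: "real vec \<Rightarrow> nat pmf" where
  "t_pmf t = embed_pmf (\<lambda>i. if i < dim_vec t then t $ i / norm_p 1 t else 0)"

lemma pmf_walk_pmf:
  assumes M: "rddz M" and v: "v < dim_row M"
  shows "pmf (walk_pmf M v) u =
    (if u < dim_row M then walk_prob M v u
     else if u = dim_row M then 1 - (\<Sum>u'<dim_row M. walk_prob M v u')
     else 0)" (is "_ = ?f u")
proof -
  let ?n = "dim_row M"
  have sq: "dim_col M = ?n" and d: "M $$ (v, v) > 0"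
    and dd: "M $$ (v, v) \<ge> (\<Sum>k\<in>{..<?n} - {v}. \<bar>M $$ (v, k)\<bar>)"
    using M v by (auto simp: rddz_def)
  have diag: "adj_T M $$ (v, v) = 0" and off: "\<And>k. k < ?n \<Longrightarrow> k \<noteq> v \<Longrightarrow> adj_T M $$ (v, k) = - M $$ (v, k)"
    using v sq by (auto simp: adj_T_def diag_part_def mat_diag_def)
  have nn: "walk_prob M v k \<ge> 0" for k
    using d by (auto simp: walk_prob_def)
  have "(\<Sum>k<?n. \<bar>adj_T M $$ (v, k)\<bar>) = (\<Sum>k\<in>{..<?n} - {v}. \<bar>M $$ (v, k)\<bar>)"
    using v by (subst sum.remove[of _ v]) (auto simp: diag off intro!: sum.cong)
  then have le: "(\<Sum>k<?n. \<bar>adj_T M $$ (v, k)\<bar>) \<le> M $$ (v, v)" using dd by simp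
  have "(\<Sum>k<?n. walk_prob M v k) = 1/2 * (1 + (\<Sum>k<?n. \<bar>adj_T M $$ (v, k)\<bar>) / M $$ (v, v))"
    unfolding walk_prob_def sum_distrib_left[symmetric] sum.distrib sum_divide_distrib[symmetric]
    using v by simp
  also have "\<dots> \<le> 1" using le d by (simp add: field_simps)
  finally have le1: "(\<Sum>k<?n. walk_prob M v k) \<le> 1" .
  have f0: "?f k \<ge> 0" for k using nn le1 by auto
  have "(\<integral>\<^sup>+k. ennreal (?f k) \<partial>count_space UNIV) = (\<Sum>k\<le>?n. ennreal (?f k))"
    by (rule nn_integral_count_space'[of "{..?n}"]) auto
  also have "\<dots> = ennreal (\<Sum>k\<le>?n. ?f k)"
    by (rule sum_ennreal) (rule f0)
  also have "(\<Sum>k\<le>?n. ?f k) = 1"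
    by (simp flip: lessThan_Suc_atMost)
  finally have "(\<integral>\<^sup>+k. ennreal (?f k) \<partial>count_space UNIV) = 1" by simp
  with f0 show ?thesis unfolding walk_pmf_def by (subst pmf_embed_pmf) auto
qed

lemma pmf_t_pmf:
  assumes t: "t \<in> carrier_vec n" "t \<noteq> 0\<^sub>v n" and nn: "\<And>i. i < n \<Longrightarrow> 0 \<le> t $ i"
  shows "pmf (t_pmf t) i = (if i < n then t $ i / norm_p 1 t else 0)" (is "_ = ?f i")
proof -
  have dim: "dim_vec t = n" using t by simp
  have N: "norm_p 1 t = (\<Sum>i<n. t $ i)"
  proof -
    have "(\<Sum>i<n. t $ i) \<ge> 0" using nn by (intro sum_nonneg) auto
    then show ?thesis using nn by (simp add: norm_p_def dim)
  qed
  obtain j where j: "j < n" "t $ j \<noteq> 0"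
    using t by (metis carrier_vecD dim eq_vecI index_zero_vec(1,2))
  have pos: "norm_p 1 t > 0"
    unfolding N using nn j by (intro sum_pos2[of _ j]) (auto simp: less_le)
  have f0: "?f k \<ge> 0" for k using nn pos by auto
  have "(\<integral>\<^sup>+k. ennreal (?f k) \<partial>count_space UNIV) = (\<Sum>k<n. ennreal (?f k))"
    by (rule nn_integral_count_space'[of "{..<n}"]) auto
  also have "\<dots> = ennreal (\<Sum>k<n. ?f k)"
    by (rule sum_ennreal) (rule f0)
  also have "(\<Sum>k<n. ?f k) = 1"
    using pos by (simp add: sum_divide_distrib[symmetric] N)
  finally have "(\<integral>\<^sup>+k. ennreal (?f k) \<partial>count_space UNIV) = 1" by simp
  with f0 show ?thesis unfolding t_pmf_def dim by (subst pmf_embed_pmf) auto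
qed

partial_function (spmf) while_loop ::
  "(state \<Rightarrow> bool) \<Rightarrow> (state \<Rightarrow> state spmf) \<Rightarrow> state \<Rightarrow> state spmf" where
  "while_loop b c s =
     (if b s then bind_spmf (c (tick 1 s)) (while_loop b c) else return_spmf (tick 1 s))"

text \<open>Accesses outside the index range return 0 (or no entries, or a terminated walk).\<close>
primrec exec :: "problem \<Rightarrow> com \<Rightarrow> state \<Rightarrow> state spmf" where
  "exec I Skip s = return_spmf (tick 1 s)"
| "exec I (SetN x e) s = return_spmf (tick 1 (set_nreg x (nval s e) s))"
| "exec I (SetR x e) s = return_spmf (tick 1 (set_rreg x (rval s e) s))"
| "exec I (PutN a i e) s = return_spmf (tick 1 (put_narr a (nval s i) (nval s e) s))"
| "exec I (PutR a i e) s = return_spmf (tick 1 (put_rarr a (nval s i) (rval s e) s))"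
| "exec I (Seq c1 c2) s = bind_spmf (exec I c1 s) (exec I c2)"
| "exec I (Cond b c1 c2) s = (if bval s b then exec I c1 (tick 1 s) else exec I c2 (tick 1 s))"
| "exec I (While b c) s = while_loop (\<lambda>s. bval s b) (exec I c) s"
| "exec I (GetDiag x e) s = (let v = nval s e in return_spmf (tick 1
     (set_rreg x (if v < dim_row (Mat I) then Mat I $$ (v, v) else 0) s)))"
| "exec I (GetB x e) s = (let v = nval s e in return_spmf (tick 1
     (set_rreg x (if v < dim_row (Mat I) then Bvec I $ v else 0) s)))"
| "exec I (GetT x e) s = (let v = nval s e in return_spmf (tick 1
     (set_rreg x (if v < dim_row (Mat I) then Tvec I $ v else 0) s)))"
| "exec I (GetRow c ia ra e) s = (let v = nval s e in return_spmf
     (load_entries c ia ra (if v < dim_row (Mat I) then row_list I v else [])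
        (\<lambda>u. Mat I $$ (v, u)) s))"
| "exec I (GetCol c ia ra e) s = (let v = nval s e in return_spmf
     (load_entries c ia ra (if v < dim_row (Mat I) then col_list I v else [])
        (\<lambda>u. Mat I $$ (u, v)) s))"
| "exec I (Coin x) s = map_spmf (\<lambda>k. tick 1 (set_nreg x k s)) (spmf_of_set {0, 1})"
| "exec I (SampleT x) s = map_spmf (\<lambda>k. tick 1 (set_nreg x k s)) (spmf_of_pmf (t_pmf (Tvec I)))"
| "exec I (WalkStep x e) s = (let v = nval s e in
     if v < dim_row (Mat I)
     then map_spmf (\<lambda>u. tick (step_time I v) (set_nreg x u s)) (spmf_of_pmf (walk_pmf (Mat I) v))
     else return_spmf (tick 1 (set_nreg x (dim_row (Mat I)) s)))"

text \<open>
  Initially the registers hold the known quantities: \<open>n\<close>, \<open>w\<close>, the known value \<open>L'\<close> of the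
  truncation parameter, \<open>nnz(M)\<close>, \<open>f_row(M)\<close>, respectively
  \<open>\<epsilon>\<close>, \<open>\<gamma>\<close>, \<open>\<eta>\<close>, \<open>\<parallel>t\<parallel>\<^sub>1\<close>. The result is real register 0 of the final state.
\<close>
definition init_state :: "problem \<Rightarrow> nat \<Rightarrow> nat \<Rightarrow> real \<Rightarrow> real \<Rightarrow> real \<Rightarrow> state" where
  "init_state I w L' \<epsilon> \<gamma> \<eta> = \<lparr>
     nreg = (\<lambda>_. 0)(0 := dim_row (Mat I), 1 := w, 2 := L', 3 := nnz (Mat I), 4 := f_row (Mat I) (step_time I)),
     rreg = (\<lambda>_. 0)(0 := \<epsilon>, 1 := \<gamma>, 2 := \<eta>, 3 := norm_p 1 (Tvec I)),
     narr = (\<lambda>_ _. 0), rarr = (\<lambda>_ _. 0), clock = 0\<rparr>"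

definition result :: "state \<Rightarrow> real" where
  "result s = rreg s 0"

definition halts_within :: "nat \<Rightarrow> state spmf \<Rightarrow> bool" where
  "halts_within T run \<longleftrightarrow> lossless_spmf run \<and> (\<forall>s\<in>set_spmf run. clock s \<le> T)"

section \<open>The truncation parameter\<close>

definition target_accuracy :: "real mat \<Rightarrow> real vec \<Rightarrow> real vec \<Rightarrow> real \<Rightarrow> real" where
  "target_accuracy M b t \<epsilon> = \<epsilon> * sqrt (norm_p \<infinity> (diag_inv M *\<^sub>v b)) * (t \<bullet> xstar M b)"

definition log_length :: "real mat \<Rightarrow> real vec \<Rightarrow> real vec \<Rightarrow> real \<Rightarrow> real \<Rightarrow> real" where
  "log_length M b t \<gamma> E = 1 / \<gamma> * ln (1 / (\<gamma> * E) * d_max M *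
     norm_0 t * norm_p \<infinity> (diag_inv M *\<^sub>v t) * norm_0 b * norm_p \<infinity> (diag_inv M *\<^sub>v b))"

text \<open>The indices \<open>w\<close> for which \<open>b = e\<^sub>w\<close> satisfies the requirements on the right-hand side.\<close>
definition admissible :: "real mat \<Rightarrow> real vec \<Rightarrow> real \<Rightarrow> nat set" where
  "admissible M t \<eta> = {w. w < dim_row M \<and> unit_vec (dim_row M) w \<in> mat_range M \<and>
     \<eta> \<le> t \<bullet> xstar M (unit_vec (dim_row M) w)}"

text \<open>
  As running times are averaged over \<open>w\<close>, a single \<open>L\<close> has to serve all right-hand sides \<open>e\<^sub>w\<close>.
  It is at least 1 since the logarithm may be small or negative.
\<close>
definition L_trunc :: "real mat \<Rightarrow> real vec \<Rightarrow> real \<Rightarrow> real \<Rightarrow> real \<Rightarrow> real" where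
  "L_trunc M t \<epsilon> \<gamma> \<eta> = Max (insert 1
     ((\<lambda>w. let b = unit_vec (dim_row M) w in log_length M b t \<gamma> (target_accuracy M b t \<epsilon>))
        ` admissible M t \<eta>))"

end

theory Submission
  imports Defs
begin

text \<open>
  Write \<open>P = 1/2 (I + D\<^sup>-\<^sup>1 A\<^sup>T)\<close> and \<open>y = D\<^sup>-\<^sup>1 e\<^sub>w\<close>, so that \<open>2 t\<^sup>T x\<^sup>* = \<Sum>\<^sub>l t\<^sup>T P\<^sup>l y\<close>. The spectral gap makes the tail
  \<open>l \<ge> L\<close> of this series at most the target accuracy. The rest is estimated from both ends.
  Starting with the residue \<open>r\<^sub>0 = y\<close>, level \<open>l\<close> splits \<open>r\<^sub>l = a\<^sub>l + b\<^sub>l\<close>, where \<open>a\<^sub>l\<close> consists of the entries exceeding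
  \<open>\<theta> / d\<^sub>w\<close>, pays \<open>t\<^sup>T a\<^sub>l\<close> into a reserve and continues with \<open>r\<^sub>l\<^sub>+\<^sub>1 = P a\<^sub>l\<close>; what the kept part
  \<open>R = \<Sum>\<^sub>l b\<^sub>l\<close> still contributes is the mean of \<open>\<parallel>t\<parallel>\<^sub>1 \<Sum>\<^sub>k\<^sub><\<^sub>L R(v\<^sub>k)\<close> over random walks \<open>v\<close> started
  from \<open>t / \<parallel>t\<parallel>\<^sub>1\<close>. Since \<open>R \<le> L \<theta> / d\<^sub>w\<close>, Chebyshev's inequality asks for about
  \<open>\<parallel>t\<parallel>\<^sub>1 L\<^sup>2 \<theta> / (\<epsilon>\<^sup>2 \<eta>)\<close> walks. Since \<open>d\<^sub>w r\<^sub>l(v) \<le> P\<^sup>l(v, w)\<close> and the rows of \<open>P\<^sup>l\<close> add up to at most 1,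
  pushing costs \<open>L nnz(M) / (n \<theta>)\<close> on average over \<open>w\<close>. The stated bound comes from the \<open>\<theta>\<close> that balances
  the two costs, which the program finds up to a factor 2 by halving because it has no square roots.
\<close>

section \<open>Norms and the truncation error\<close>

text \<open>The gap contracts only on a range, so the tail estimate needs \<open>e_w = M x\<close>:
  then \<open>y = x - D^-1 A^T x\<close>, and \<open>P\<close> preserves vectors of this form.
  Returning from the p-norm to single entries costs a factor that can be bounded independently of p.

  The kept parts of all levels are merged into one vector, so a walk cannot know how many steps its
  mass still has to make. It always makes \<open>L\<close>. This overcounts, but only by terms of
  index below \<open>2 L\<close> of a nonnegative series: the estimated quantity lies between the
  partial sums of lengths \<open>L\<close> and \<open>2 L\<close>, both within the target accuracy
  of the limit.

  Scaling the threshold by \<open>1 / d w\<close> makes the number of walks the same for every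
  source: the variance bound and the square of the permitted error both carry the factor
  \<open>1 / d w\<close>.

  The push phase is deterministic and the numbers of walks and steps are fixed before sampling, so
  time is bounded for every outcome. A run can therefore be coupled with a plain sum of independent
  samples, on which all probability estimates are made.\<close>

lemma ereal_exponent_cases:
  assumes "1 \<le> (p::ereal)"
  obtains "p = \<infinity>" | r where "p = ereal r" "1 \<le> r"
  using assms by (cases p) auto

lemma conjugate_exponents_real:
  assumes "1 \<le> p" "1 \<le> q" "1 / p + 1 / q = (1::ereal)"
  obtains a b where "real_of_ereal (1 / p) = a" "real_of_ereal (1 / q) = b"
    "0 \<le> a" "0 \<le> b" "a + b = 1"
proof -
  have inv: "\<exists>r\<ge>0. 1 / s = ereal r" if "1 \<le> s" for s :: ereal
    using that by (cases s rule: ereal_exponent_cases) (auto intro: exI[of _ 0] simp: one_ereal_def)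
  obtain a b where "1 / p = ereal a" "0 \<le> a" "1 / q = ereal b" "0 \<le> b"
    using inv assms(1,2) by metis
  with assms(3) that[of a b] show ?thesis by (simp add: one_ereal_def)
qed

lemma abs_nth_le_norm_p:
  assumes "1 \<le> p" "i < dim_vec x"
  shows "\<bar>x $ i\<bar> \<le> norm_p p x"
  using assms(1)
proof (cases rule: ereal_exponent_cases)
  case 1
  then show ?thesis using assms(2) by (auto simp: norm_p_def intro!: Max_ge)
next
  case (2 r)
  have "\<bar>x $ i\<bar> = (\<bar>x $ i\<bar> powr r) powr (1 / r)"
    using 2 by (simp add: powr_powr)
  also have "\<dots> \<le> (\<Sum>i<dim_vec x. \<bar>x $ i\<bar> powr r) powr (1 / r)"
    using 2 assms(2) by (intro powr_mono2 member_le_sum) auto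
  finally show ?thesis using 2 by (simp add: norm_p_def)
qed

lemma norm_p_nonneg: "1 \<le> p \<Longrightarrow> 0 \<le> norm_p p x"
  by (cases p rule: ereal_exponent_cases) (auto simp: norm_p_def intro!: Max_ge)

lemma norm_p_smult:
  assumes "1 \<le> p" "0 \<le> a"
  shows "norm_p p (a \<cdot>\<^sub>v x) = a * norm_p p x"
  using assms(1)
proof (cases rule: ereal_exponent_cases)
  case 1
  have "mono ((*) a)" using assms(2) by (auto intro!: monoI mult_left_mono)
  then have "a * Max (insert 0 ((\<lambda>i. \<bar>x $ i\<bar>) ` {..<dim_vec x})) =
      Max ((*) a ` insert 0 ((\<lambda>i. \<bar>x $ i\<bar>) ` {..<dim_vec x}))"
    by (rule mono_Max_commute) auto
  also have "(*) a ` insert 0 ((\<lambda>i. \<bar>x $ i\<bar>) ` {..<dim_vec x}) =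
      insert 0 ((\<lambda>i. \<bar>(a \<cdot>\<^sub>v x) $ i\<bar>) ` {..<dim_vec x})"
    using assms(2) by (simp add: image_image abs_mult)
  finally show ?thesis using 1 by (simp add: norm_p_def)
next
  case (2 r)
  have "(\<Sum>i<dim_vec x. \<bar>(a \<cdot>\<^sub>v x) $ i\<bar> powr r) = a powr r * (\<Sum>i<dim_vec x. \<bar>x $ i\<bar> powr r)"
    using assms(2) by (auto simp: sum_distrib_left abs_mult powr_mult intro!: sum.cong)
  then show ?thesis using 2 assms(2)
    by (simp add: norm_p_def powr_mult powr_powr)
qed

lemma norm_p_single:
  assumes "1 \<le> p" "w < n"
  shows "norm_p p (vec n (\<lambda>i. if i = w then a else 0)) = \<bar>a\<bar>" (is "norm_p p ?x = _")
  using assms(1)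
proof (cases rule: ereal_exponent_cases)
  case 1
  have "insert 0 ((\<lambda>i. \<bar>?x $ i\<bar>) ` {..<n}) = {0, \<bar>a\<bar>}"
    using assms(2) by (auto simp: image_iff)
  then show ?thesis using 1 by (simp add: norm_p_def)
next
  case (2 r)
  have "(\<Sum>i<n. \<bar>?x $ i\<bar> powr r) = (\<Sum>i<n. if i = w then \<bar>a\<bar> powr r else 0)"
    by (intro sum.cong) auto
  then show ?thesis using 2 assms(2)
    by (simp add: norm_p_def powr_powr)
qed

text \<open>A crude bound, meant only to show that the set under the supremum in
  \<open>restr_op_norm\<close> is bounded, for finite and infinite exponents alike.\<close>

lemma norm_p_bounded:
  assumes "1 \<le> p" "\<And>i. i < dim_vec x \<Longrightarrow> \<bar>x $ i\<bar> \<le> B" "0 \<le> B"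
  shows "norm_p p x \<le> max B ((dim_vec x * B powr real_of_ereal p) powr (1 / real_of_ereal p))"
  using assms(1)
proof (cases rule: ereal_exponent_cases)
  case 1
  then have "norm_p p x \<le> B" using assms by (auto simp: norm_p_def)
  then show ?thesis by simp
next
  case (2 r)
  have "(\<Sum>i<dim_vec x. \<bar>x $ i\<bar> powr r) \<le> (\<Sum>i<dim_vec x. B powr r)"
    using assms 2 by (intro sum_mono powr_mono2) auto
  then have "(\<Sum>i<dim_vec x. \<bar>x $ i\<bar> powr r) powr (1/r) \<le> (dim_vec x * B powr r) powr (1/r)"
    using 2 by (intro powr_mono2) (auto intro: sum_nonneg)
  then show ?thesis using 2 by (simp add: norm_p_def)
qed

text \<open>A real \<open>Sup\<close> has its meaning only for sets bounded above. Vectors of norm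
  at most 1 have entries of modulus at most 1, so the sum of the moduli of all entries of
  \<open>H\<close> bounds every entry of the image.\<close>

lemma bdd_above_restr_op_norm:
  assumes p: "1 \<le> p" and H: "H \<in> carrier_mat n n" and V: "V \<subseteq> carrier_vec n"
  shows "bdd_above {norm_p p (H *\<^sub>v x) | x. x \<in> V \<and> norm_p p x \<le> 1}"
proof -
  define B where "B = (\<Sum>i<n. \<Sum>j<n. \<bar>H $$ (i, j)\<bar>)"
  have B0: "0 \<le> B" by (auto simp: B_def intro!: sum_nonneg)
  have "norm_p p (H *\<^sub>v x) \<le> max B ((n * B powr real_of_ereal p) powr (1 / real_of_ereal p))"
    if x: "x \<in> V" "norm_p p x \<le> 1" for x
  proof -
    have dx: "dim_vec x = n" using x V by auto
    have "\<bar>(H *\<^sub>v x) $ i\<bar> \<le> B" if i: "i < n" for i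
    proof -
      have "(H *\<^sub>v x) $ i = (\<Sum>j<n. H $$ (i, j) * x $ j)"
        using H i dx by (auto simp: scalar_prod_def atLeast0LessThan)
      also have "\<bar>\<dots>\<bar> \<le> (\<Sum>j<n. \<bar>H $$ (i, j)\<bar>)"
      proof (rule order_trans[OF sum_abs sum_mono])
        fix j assume "j \<in> {..<n}"
        then have "\<bar>x $ j\<bar> \<le> 1" using abs_nth_le_norm_p[OF p, of j x] x dx by auto
        then show "\<bar>H $$ (i, j) * x $ j\<bar> \<le> \<bar>H $$ (i, j)\<bar>"
          by (simp add: abs_mult mult_left_le)
      qed
      also have "\<dots> \<le> B" unfolding B_def using i
        by (intro member_le_sum[of i "{..<n}" "\<lambda>i. \<Sum>j<n. \<bar>H $$ (i, j)\<bar>"]) (auto intro: sum_nonneg)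
      finally show ?thesis .
    qed
    then show ?thesis using norm_p_bounded[OF p, of "H *\<^sub>v x" B] B0 H by auto
  qed
  then show ?thesis by (intro bdd_aboveI) auto
qed

lemma norm_p_eq_0: 
  assumes "1 \<le> p" "norm_p p x = 0" "i < dim_vec x"
  shows "x $ i = 0"
  using abs_nth_le_norm_p[OF assms(1,3)] assms(2) by simp

text \<open>Normalise \<open>x\<close> inside \<open>V\<close> by homogeneity. A vector of norm 0
  cannot be normalised; it is its own zero multiple, and so is its image.\<close>

lemma restr_op_norm_bound:
  assumes p: "1 \<le> p" and H: "H \<in> carrier_mat n n" and V: "V \<subseteq> carrier_vec n"
    and sc: "\<And>a x. x \<in> V \<Longrightarrow> a \<cdot>\<^sub>v x \<in> V" and x: "x \<in> V"
  shows "norm_p p (H *\<^sub>v x) \<le> restr_op_norm p H V * norm_p p x"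
    and "0 \<le> restr_op_norm p H V"
proof -
  have up: "norm_p p (H *\<^sub>v u) \<le> restr_op_norm p H V" if "u \<in> V" "norm_p p u \<le> 1" for u
    unfolding restr_op_norm_def
    using that by (intro cSup_upper bdd_above_restr_op_norm[OF p H V]) auto
  have dx: "x \<in> carrier_vec n" using x V by auto
  have "norm_p p (0 \<cdot>\<^sub>v x) = 0" using norm_p_smult[OF p, of 0 x] by simp
  then have "norm_p p (H *\<^sub>v (0 \<cdot>\<^sub>v x)) \<le> restr_op_norm p H V"
    using sc[OF x, of 0] by (intro up) auto
  then show nn: "0 \<le> restr_op_norm p H V"
    using norm_p_nonneg[OF p] order_trans by blast
  show "norm_p p (H *\<^sub>v x) \<le> restr_op_norm p H V * norm_p p x"
  proof (cases "norm_p p x = 0")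
    case True
    then have x0: "0 \<cdot>\<^sub>v x = x" using norm_p_eq_0[OF p True] dx by (intro eq_vecI) auto
    have "norm_p p (H *\<^sub>v (0 \<cdot>\<^sub>v x)) = 0"
      using norm_p_smult[OF p, of 0 "H *\<^sub>v x"] by (simp add: mult_mat_vec[OF H dx])
    then show ?thesis using True by (simp add: x0)
  next
    case False
    define a where "a = norm_p p x"
    have a: "a > 0" using False norm_p_nonneg[OF p, of x] by (simp add: a_def)
    have "norm_p p ((1/a) \<cdot>\<^sub>v x) = 1" using a norm_p_smult[OF p, of "1/a" x] by (simp add: a_def)
    then have "norm_p p (H *\<^sub>v ((1/a) \<cdot>\<^sub>v x)) \<le> restr_op_norm p H V"
      using sc[OF x] by (intro up) auto
    also have "H *\<^sub>v ((1/a) \<cdot>\<^sub>v x) = (1/a) \<cdot>\<^sub>v (H *\<^sub>v x)" by (rule mult_mat_vec[OF H dx])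
    finally have "norm_p p (H *\<^sub>v x) / a \<le> restr_op_norm p H V"
      using a norm_p_smult[OF p, of "1/a" "H *\<^sub>v x"] by simp
    then show ?thesis using a by (simp add: field_simps a_def)
  qed
qed

section \<open>The lazy walk operator and its decay on the range of \<open>M\<close>\<close>

locale rddz_system =
  fixes n :: nat and M :: "real mat"
  assumes M: "M \<in> carrier_mat n n" and rddz: "rddz M"
begin

abbreviation d :: "nat \<Rightarrow> real" where "d i \<equiv> M $$ (i, i)"

lemma dims [simp]: "dim_row M = n" "dim_col M = n"
  using M by auto

lemma d_pos: "i < n \<Longrightarrow> d i > 0"
  using rddz by (auto simp: rddz_def)

lemma off_diag_nonpos: "i < n \<Longrightarrow> j < n \<Longrightarrow> j \<noteq> i \<Longrightarrow> M $$ (i, j) \<le> 0"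
  using rddz by (auto simp: rddz_def)

lemma adj_T_nth: "i < n \<Longrightarrow> j < n \<Longrightarrow> adj_T M $$ (i, j) = (if i = j then 0 else - M $$ (i, j))"
  by (auto simp: adj_T_def diag_part_def mat_diag_def)

lemma adj_T_dims [simp]: "dim_row (adj_T M) = n" "dim_col (adj_T M) = n"
  by (auto simp: adj_T_def)

lemma adj_T_nonneg: "i < n \<Longrightarrow> j < n \<Longrightarrow> 0 \<le> adj_T M $$ (i, j)"
  using off_diag_nonpos by (auto simp: adj_T_nth)

lemma walk_prob_nonneg: "i < n \<Longrightarrow> 0 \<le> walk_prob M i j"
  using d_pos[of i] by (auto simp: walk_prob_def)

text \<open>For \<open>i = j\<close> the formula yields the lazy half step, so the push loop can
  scan a column of \<open>M\<close> without treating the diagonal separately.\<close>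

lemma walk_prob_eq:
  "i < n \<Longrightarrow> j < n \<Longrightarrow> walk_prob M i j = \<bar>M $$ (i, j)\<bar> / (2 * d i)"
  using d_pos[of i] by (auto simp: walk_prob_def adj_T_nth)

text \<open>The missing mass is the probability of the terminated state \<open>n\<close> under
  \<open>walk_pmf M i\<close>, hence nonnegative.\<close>

lemma walk_prob_sum_le_1:
  assumes "i < n" shows "(\<Sum>j<n. walk_prob M i j) \<le> 1"
  using pmf_walk_pmf[OF rddz, of i n] pmf_nonneg[of "walk_pmf M i" n] assms by simp

text \<open>\<open>P\<close>, and below it \<open>D^-1 A^T\<close>, acting on functions: matrix
  powers become iterates without dimension conditions, and arguments are read only below
  \<open>n\<close>.\<close>

definition walk_op :: "(nat \<Rightarrow> real) \<Rightarrow> nat \<Rightarrow> real" where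
  "walk_op f i = (\<Sum>j<n. walk_prob M i j * f j)"

definition adj_op :: "(nat \<Rightarrow> real) \<Rightarrow> nat \<Rightarrow> real" where
  "adj_op f i = (\<Sum>j<n. adj_T M $$ (i, j) / d i * f j)"

lemma walk_op_adj_op: "i < n \<Longrightarrow> walk_op f i = 1/2 * (f i + adj_op f i)"
proof -
  assume i: "i < n"
  have "walk_op f i = (\<Sum>j<n. 1/2 * ((if j = i then f j else 0) + adj_T M $$ (i, j) / d i * f j))"
    unfolding walk_op_def walk_prob_def using i adj_T_nonneg[OF i]
    by (intro sum.cong) (auto simp: algebra_simps)
  also have "\<dots> = 1/2 * (f i + adj_op f i)"
    using i unfolding adj_op_def sum_distrib_left[symmetric] sum.distrib by simp
  finally show ?thesis .
qed

lemma walk_op_cong: "(\<And>i. i < n \<Longrightarrow> f i = g i) \<Longrightarrow> walk_op f = walk_op g"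
  by (auto simp: walk_op_def fun_eq_iff intro!: sum.cong)

lemma adj_op_cong: "(\<And>i. i < n \<Longrightarrow> f i = g i) \<Longrightarrow> adj_op f = adj_op g"
  by (auto simp: adj_op_def fun_eq_iff intro!: sum.cong)

lemma adj_op_linear: "adj_op (\<lambda>i. a * f i + b * g i) i = a * adj_op f i + b * adj_op g i"
  unfolding adj_op_def sum_distrib_left sum.distrib[symmetric]
  by (rule sum.cong) (simp_all add: algebra_simps add_divide_distrib)

lemma adj_T_carrier [simp]: "adj_T M \<in> carrier_mat n n"
  by (rule carrier_matI) simp_all

lemma lazy_mat_dims [simp]: "dim_row (lazy_mat M) = n" "dim_col (lazy_mat M) = n"
  by (simp_all add: lazy_mat_def diag_inv_def mat_diag_def)

lemma lazy_mat_carrier [simp]: "lazy_mat M \<in> carrier_mat n n"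
  by (rule carrier_matI) simp_all

lemma diag_mult_nth:
  "A \<in> carrier_mat n n \<Longrightarrow> i < n \<Longrightarrow> j < n \<Longrightarrow> (mat_diag n f * A) $$ (i, j) = f i * A $$ (i, j)"
  "A \<in> carrier_mat n n \<Longrightarrow> i < n \<Longrightarrow> j < n \<Longrightarrow> (A * mat_diag n f) $$ (i, j) = A $$ (i, j) * f j"
  by (simp_all add: mat_diag_mult_left[of A n n] mat_diag_mult_right[of A n n])

lemma lazy_mat_nth:
  assumes "i < n" "j < n"
  shows "lazy_mat M $$ (i, j) = walk_prob M i j"
proof -
  have "(diag_inv M * adj_T M) $$ (i, j) = inverse (d i) * adj_T M $$ (i, j)"
    using assms unfolding diag_inv_def dims by (rule diag_mult_nth(1)[OF adj_T_carrier])
  moreover have "dim_row (diag_inv M) = n" by (simp add: diag_inv_def mat_diag_def)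
  then have "lazy_mat M $$ (i, j) = 1/2 * ((if i = j then 1 else 0) + (diag_inv M * adj_T M) $$ (i, j))"
    using assms unfolding lazy_mat_def by simp
  ultimately show ?thesis
    using abs_of_nonneg[OF adj_T_nonneg[OF assms]] unfolding walk_prob_def by (auto simp: inverse_eq_divide)
qed

lemma lazy_mat_mult_vec:
  "lazy_mat M *\<^sub>v vec n f = vec n (walk_op f)"
  by (auto simp: scalar_prod_def atLeast0LessThan walk_op_def lazy_mat_nth[symmetric] intro!: sum.cong)

lemma lazy_mat_power_vec:
  "lazy_mat M ^\<^sub>m l *\<^sub>v vec n f = vec n ((walk_op ^^ l) f)"
proof (induction l arbitrary: f)
  case 0
  show ?case by (auto intro!: one_mult_mat_vec)
next
  case (Suc l)
  have "lazy_mat M ^\<^sub>m Suc l *\<^sub>v vec n f = lazy_mat M ^\<^sub>m l *\<^sub>v (lazy_mat M *\<^sub>v vec n f)"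
    by (simp add: assoc_mult_mat_vec[of _ n n _ n])
  then show ?case by (simp only: lazy_mat_mult_vec Suc.IH funpow_Suc_right o_apply)
qed

definition point :: "nat \<Rightarrow> nat \<Rightarrow> real" where
  "point w i = (if i = w then 1 / d w else 0)"

lemma diag_inv_mult_vec:
  assumes "v \<in> carrier_vec n"
  shows "diag_inv M *\<^sub>v v = vec n (\<lambda>i. v $ i / d i)"
proof (rule eq_vecI)
  fix i assume "i < dim_vec (vec n (\<lambda>i. v $ i / d i))"
  then have i: "i < n" by simp
  then have "(diag_inv M *\<^sub>v v) $ i = (\<Sum>j<n. (if i = j then inverse (d j) else 0) * v $ j)"
    using assms by (simp add: diag_inv_def mat_diag_def scalar_prod_def atLeast0LessThan)
  also have "\<dots> = (\<Sum>j<n. if i = j then v $ j / d j else 0)"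
    by (intro sum.cong) (auto simp: divide_inverse_commute)
  finally show "(diag_inv M *\<^sub>v v) $ i = vec n (\<lambda>i. v $ i / d i) $ i"
    using i by simp
qed (simp add: diag_inv_def mat_diag_def)

lemma diag_inv_unit: "w < n \<Longrightarrow> diag_inv M *\<^sub>v unit_vec n w = vec n (point w)"
  by (subst diag_inv_mult_vec) (auto simp: point_def)

lemma norm_diag_inv_unit: "w < n \<Longrightarrow> norm_p \<infinity> (diag_inv M *\<^sub>v unit_vec n w) = 1 / d w"
  using norm_p_single[of \<infinity> w n "1 / d w"] d_pos[of w] by (simp add: diag_inv_unit point_def[abs_def])

lemma xstar_unit_nth:
  assumes "w < n" "i < n"
  shows "xstar M (unit_vec n w) $ i = 1/2 * (\<Sum>l. (walk_op ^^ l) (point w) i)"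
  using assms by (simp add: xstar_def diag_inv_unit lazy_mat_power_vec)

lemma d_le_d_max: "i < n \<Longrightarrow> d i \<le> d_max M"
  by (auto simp: d_max_def intro!: Max_ge)

text \<open>\<open>P\<close> is a polynomial in \<open>D^-1 A^T\<close> and commutes with it. Hence
  the iterate of \<open>x - D^-1 A^T x\<close> has the same form, with the iterate of
  \<open>x\<close> as witness, and never leaves the range on which the gap acts.\<close>

lemma iterate_in_range:
  assumes w: "w < n" and x: "x \<in> carrier_vec n" "M *\<^sub>v x = unit_vec n w" and i: "i < n"
  shows "(walk_op ^^ l) (point w) i =
    (walk_op ^^ l) (($) x) i - adj_op ((walk_op ^^ l) (($) x)) i"
  using i
proof (induction l arbitrary: i)
  case 0
  have "unit_vec n w $ i = (\<Sum>j<n. M $$ (i, j) * x $ j)"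
    using x 0 by (auto simp flip: x(2) simp: scalar_prod_def atLeast0LessThan)
  also have "\<dots> = (\<Sum>j<n. (if j = i then d i * x $ i else 0) - adj_T M $$ (i, j) * x $ j)"
    using 0 by (intro sum.cong) (auto simp: adj_T_nth)
  also have "\<dots> = d i * x $ i - d i * adj_op (($) x) i"
    using 0 d_pos[OF 0] by (simp add: sum_subtractf adj_op_def sum_distrib_left)
  finally show ?case using 0 w d_pos[OF 0] by (simp add: point_def field_simps split: if_splits)
next
  case (Suc l)
  define f where "f = (walk_op ^^ l) (($) x)"
  have "walk_op ((walk_op ^^ l) (point w)) = walk_op (\<lambda>i. f i - adj_op f i)"
    using Suc.IH by (intro walk_op_cong) (simp add: f_def)
  moreover have "adj_op (\<lambda>i. f i - adj_op f i) i = adj_op f i - adj_op (adj_op f) i"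
    using adj_op_linear[of 1 f "-1" "adj_op f" i] by simp
  moreover have "adj_op (walk_op f) i = 1/2 * (adj_op f i + adj_op (adj_op f) i)"
    using adj_op_cong[of "walk_op f" "\<lambda>i. 1/2 * f i + 1/2 * adj_op f i"]
      adj_op_linear[of "1/2" f "1/2" "adj_op f" i] by (simp add: walk_op_adj_op)
  ultimately show ?case using Suc.prems by (simp add: f_def walk_op_adj_op field_simps)
qed

text \<open>Conjugation by the diagonal matrix of the \<open>d i powr a\<close>, where
  \<open>a\<close> is \<open>1 / p\<close>, turns \<open>P\<close> into the matrix of
  \<open>gamma_p\<close> and carries the range found in \<open>iterate_in_range\<close> to the
  subspace of the restriction. Each step then shrinks the norm by \<open>1 - g\<close>.\<close>

lemma iterate_bound_exponent:
  assumes w: "w < n" and range: "unit_vec n w \<in> mat_range M" and i: "i < n"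
    and pq: "1 \<le> p" "1 \<le> q" "1 / p + 1 / q = 1" and g: "g \<le> gamma_p M p q"
  shows "\<bar>(walk_op ^^ l) (point w) i\<bar> \<le> d_max M / (d i * d w) * (1 - g) ^ l" and "g \<le> 1"
proof -
  obtain a b where ab: "real_of_ereal (1 / p) = a" "real_of_ereal (1 / q) = b" "0 \<le> a" "0 \<le> b" "a + b = 1"
    using conjugate_exponents_real[OF pq] .
  obtain x where x: "x \<in> carrier_vec n" "M *\<^sub>v x = unit_vec n w"
    using range by (force simp: mat_range_def)
  define S where "S = scaled_adj_T M p q"
  define sv where "sv f = vec n (\<lambda>i. d i powr a * f i)" for f
  have S_nth: "S $$ (i, j) = d i powr (- b) * adj_T M $$ (i, j) * d j powr (- a)" if "i < n" "j < n" for i j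
  proof -
    have "(mat_diag n (\<lambda>i. d i powr - b) * adj_T M) \<in> carrier_mat n n" by (intro mult_carrier_mat[of _ n n]) (auto simp: mat_diag_def)
    then show ?thesis using that
      by (simp add: S_def scaled_adj_T_def ab diag_powr_def diag_mult_nth)
  qed
  have S: "S \<in> carrier_mat n n"
    unfolding S_def scaled_adj_T_def by (intro carrier_matI) (simp_all add: diag_powr_def mat_diag_def)
  \<comment> \<open>Conjugacy of the exponents leaves exactly one factor \<open>1 / d i\<close>, the
    one in \<open>D^-1 A^T\<close>.\<close>
  have dpow: "d i powr (- b) = d i powr a / d i" if "i < n" for i
  proof -
    have "- b = a - 1" using ab by simp
    then show ?thesis using d_pos[OF that] by (simp add: powr_diff)
  qed
  have S_sv: "S *\<^sub>v sv f = sv (adj_op f)" for f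
  proof (rule eq_vecI)
    fix i assume "i < dim_vec (sv (adj_op f))"
    then have i: "i < n" by (simp add: sv_def)
    then have "(S *\<^sub>v sv f) $ i = (\<Sum>j<n. S $$ (i, j) * (d j powr a * f j))"
      using S by (auto simp: sv_def scalar_prod_def atLeast0LessThan)
    also have "\<dots> = (\<Sum>j<n. d i powr a * (adj_T M $$ (i, j) / d i * f j))"
    proof (rule sum.cong)
      fix j assume "j \<in> {..<n}"
      then have "d j powr (- a) * d j powr a = 1" "j < n"
        using d_pos[of j] by (auto simp: powr_minus)
      then show "S $$ (i, j) * (d j powr a * f j) = d i powr a * (adj_T M $$ (i, j) / d i * f j)"
        using i by (simp add: S_nth dpow mult.assoc[symmetric])
    qed simp
    finally show "(S *\<^sub>v sv f) $ i = sv (adj_op f) $ i"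
      using i by (simp add: sv_def adj_op_def sum_distrib_left)
  qed (use S in \<open>simp add: sv_def\<close>)
  have sv_carrier [simp]: "sv f \<in> carrier_vec n" for f by (simp add: sv_def)
  define H where "H = (1/2) \<cdot>\<^sub>m (1\<^sub>m n + S)"
  define V where "V = mat_range (1\<^sub>m n - S)"
  have H: "H \<in> carrier_mat n n" using S by (simp add: H_def)
  have H_sv: "H *\<^sub>v sv f = sv (walk_op f)" for f
  proof -
    have "H *\<^sub>v sv f = (1/2) \<cdot>\<^sub>v ((1\<^sub>m n + S) *\<^sub>v sv f)"
      unfolding H_def using S by (auto simp: sv_def)
    also have "\<dots> = (1/2) \<cdot>\<^sub>v (sv f + S *\<^sub>v sv f)"
      using S sv_carrier[of f] by (simp add: add_mult_distrib_mat_vec[of _ n n])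
    also have "\<dots> = sv (walk_op f)"
      unfolding S_sv by (intro eq_vecI) (auto simp: sv_def walk_op_adj_op field_simps)
    finally show ?thesis .
  qed
  have V_eq: "V = {(1\<^sub>m n - S) *\<^sub>v z | z. z \<in> carrier_vec n}"
    using S by (simp add: V_def mat_range_def)
  have range_sv: "sv (\<lambda>i. f i - adj_op f i) \<in> V" for f
  proof -
    have "(1\<^sub>m n - S) *\<^sub>v sv f = sv f - S *\<^sub>v sv f"
      using S sv_carrier[of f] by (simp add: minus_mult_distrib_mat_vec[of _ n n])
    also have "\<dots> = sv (\<lambda>i. f i - adj_op f i)"
      unfolding S_sv by (intro eq_vecI) (auto simp: sv_def algebra_simps)
    finally show ?thesis using sv_carrier[of f] unfolding V_eq by (metis (mono_tags, lifting) mem_Collect_eq)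
  qed
  have Vc: "V \<subseteq> carrier_vec n" using mult_mat_vec_carrier[OF minus_carrier_mat[OF S]] by (auto simp: V_eq)
  have Vs: "c \<cdot>\<^sub>v u \<in> V" if "u \<in> V" for c u
  proof -
    obtain z where z: "z \<in> carrier_vec n" "u = (1\<^sub>m n - S) *\<^sub>v z"
      using \<open>u \<in> V\<close> S by (auto simp: V_def mat_range_def)
    then have "c \<cdot>\<^sub>v u = (1\<^sub>m n - S) *\<^sub>v (c \<cdot>\<^sub>v z)"
      using mult_mat_vec[OF minus_carrier_mat[OF S] z(1)] by simp
    then show ?thesis using z(1) unfolding V_eq by force
  qed
  define y where "y l = (walk_op ^^ l) (point w)" for l
  have yV: "sv (y l) \<in> V" for l
  proof -
    have "sv (y l) = sv (\<lambda>i. (walk_op ^^ l) (($) x) i - adj_op ((walk_op ^^ l) (($) x)) i)"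
      using iterate_in_range[OF w x] by (auto simp: sv_def y_def)
    then show ?thesis using range_sv by simp
  qed
  define N where "N = restr_op_norm p H V"
  have N: "0 \<le> N" "N \<le> 1 - g"
    using restr_op_norm_bound(2)[OF pq(1) H Vc Vs yV] g
    by (simp_all add: gamma_p_def N_def H_def V_def S_def)
  then show "g \<le> 1" by simp
  have step: "norm_p p (sv (y (Suc l))) \<le> N * norm_p p (sv (y l))" for l
    using restr_op_norm_bound(1)[OF pq(1) H Vc Vs yV, of l] by (simp add: H_sv y_def N_def)
  have norm: "norm_p p (sv (y l)) \<le> (1 - g) ^ l * (d w powr a / d w)" for l
  proof (induction l)
    case 0
    have "sv (y 0) = vec n (\<lambda>i. if i = w then d w powr a / d w else 0)"
      by (auto simp: sv_def y_def point_def)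
    then show ?case using norm_p_single[OF pq(1) w, of "d w powr a / d w"] d_pos[OF w] by simp
  next
    case (Suc l)
    have "norm_p p (sv (y (Suc l))) \<le> (1 - g) * norm_p p (sv (y l))"
      using step[of l] mult_right_mono[OF N(2) norm_p_nonneg[OF pq(1), of "sv (y l)"]] by simp
    also have "\<dots> \<le> (1 - g) * ((1 - g) ^ l * (d w powr a / d w))"
      using N by (intro mult_left_mono Suc.IH) simp
    finally show ?case by (simp add: mult.assoc)
  qed
  have pos: "d i > 0" "d w > 0" using d_pos i w by auto
  have "d i powr a * \<bar>y l i\<bar> \<le> (1 - g) ^ l * (d w powr a / d w)"
    using abs_nth_le_norm_p[OF pq(1), of i "sv (y l)"] norm[of l] i by (simp add: sv_def abs_mult)
  then have "\<bar>y l i\<bar> \<le> (1 - g) ^ l / d w * (d w powr a / d i powr a)"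
    using pos by (simp add: field_simps)
  also have "\<dots> \<le> (1 - g) ^ l / d w * (d_max M / d i)"
  proof (rule mult_left_mono)
    \<comment> \<open>Once \<open>d w\<close> is enlarged to \<open>d_max M\<close> the ratio is at
      least 1, so its exponent \<open>a\<close> may be raised to 1 and the bound no longer depends
      on \<open>p\<close>.\<close>
    have "d w powr a / d i powr a \<le> d_max M powr a / d i powr a"
      using d_le_d_max[OF w] pos ab by (intro divide_right_mono powr_mono2) auto
    also have "\<dots> = (d_max M / d i) powr a"
      using pos d_le_d_max[OF w] by (simp add: powr_divide)
    also have "\<dots> \<le> (d_max M / d i) powr 1"
      using d_le_d_max[OF i] pos ab by (intro powr_mono) auto
    also have "\<dots> = d_max M / d i"
      using d_le_d_max[OF i] pos by simp
    finally show "d w powr a / d i powr a \<le> d_max M / d i" .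
  qed (use N pos in auto)
  finally show "\<bar>(walk_op ^^ l) (point w) i\<bar> \<le> d_max M / (d i * d w) * (1 - g) ^ l"
    by (simp add: y_def field_simps)
qed

text \<open>The supremum defining \<^const>\<open>gamma_max\<close> need not be attained, hence the passage to the limit.\<close>
lemma iterate_bound:
  assumes w: "w < n" and range: "unit_vec n w \<in> mat_range M" and i: "i < n" and g: "\<gamma> \<le> gamma_max M"
  shows "\<bar>(walk_op ^^ l) (point w) i\<bar> \<le> d_max M / (d i * d w) * (1 - \<gamma>) ^ l" and "\<gamma> \<le> 1"
proof -
  let ?A = "{gamma_p M p q | p q. 1 \<le> p \<and> 1 \<le> q \<and> 1 / p + 1 / q = 1}"
  have "gamma_p M 1 \<infinity> \<in> ?A" by (intro CollectI exI[of _ 1] exI[of _ \<infinity>]) auto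
  then have ne: "?A \<noteq> {}" by blast
  have *: "\<bar>(walk_op ^^ l) (point w) i\<bar> \<le> d_max M / (d i * d w) * (1 - g) ^ l \<and> g \<le> 1" if "g < \<gamma>" for g
  proof -
    have "g < Sup ?A" using that g by (simp add: gamma_max_def)
    then obtain p q where "1 \<le> p" "1 \<le> q" "1 / p + 1 / q = 1" "g < gamma_p M p q"
      using less_cSupE[OF _ ne] by blast
    then show ?thesis using iterate_bound_exponent(1)[OF w range i, of p q g l] iterate_bound_exponent(2)[OF w range i, of p q g] by auto
  qed
  show "\<gamma> \<le> 1" using * by (intro dense_le[of \<gamma> 1]) simp
  have "((\<lambda>g. d_max M / (d i * d w) * (1 - g) ^ l) \<longlongrightarrow> d_max M / (d i * d w) * (1 - \<gamma>) ^ l) (at_left \<gamma>)"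
    by (intro tendsto_intros)
  moreover have "\<forall>\<^sub>F g in at_left \<gamma>. \<bar>(walk_op ^^ l) (point w) i\<bar> \<le> d_max M / (d i * d w) * (1 - g) ^ l"
    using * by (auto simp: eventually_at_filter)
  ultimately show "\<bar>(walk_op ^^ l) (point w) i\<bar> \<le> d_max M / (d i * d w) * (1 - \<gamma>) ^ l"
    by (intro tendsto_lowerbound[OF _ _ trivial_limit_at_left_real])
qed

lemma walk_op_nonneg: "(\<And>i. i < n \<Longrightarrow> 0 \<le> f i) \<Longrightarrow> i < n \<Longrightarrow> 0 \<le> walk_op f i"
  by (auto simp: walk_op_def walk_prob_nonneg intro!: sum_nonneg)

lemma walk_op_mono: "(\<And>i. i < n \<Longrightarrow> f i \<le> g i) \<Longrightarrow> i < n \<Longrightarrow> walk_op f i \<le> walk_op g i"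
  by (auto simp: walk_op_def walk_prob_nonneg intro!: sum_mono mult_left_mono)

lemma walk_op_pow_nonneg: "(\<And>i. i < n \<Longrightarrow> 0 \<le> f i) \<Longrightarrow> i < n \<Longrightarrow> 0 \<le> (walk_op ^^ l) f i"
  by (induction l arbitrary: i) (auto intro: walk_op_nonneg)

lemma walk_op_pow_le:
  assumes "\<And>i. i < n \<Longrightarrow> f i \<le> B" "0 \<le> B" "i < n"
  shows "(walk_op ^^ l) f i \<le> B"
  using assms(3)
proof (induction l arbitrary: i)
  case 0
  then show ?case using assms by simp
next
  case (Suc l)
  have "(walk_op ^^ Suc l) f i \<le> walk_op (\<lambda>_. B) i"
    using Suc by (auto intro!: walk_op_mono)
  also have "\<dots> = (\<Sum>j<n. walk_prob M i j) * B" by (simp add: walk_op_def sum_distrib_right)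
  also have "\<dots> \<le> 1 * B" using walk_prob_sum_le_1[OF Suc.prems] assms(2) by (rule mult_right_mono)
  finally show ?case by simp
qed

lemma walk_op_linear: "walk_op (\<lambda>i. f i + g i) = (\<lambda>i. walk_op f i + walk_op g i)"
  by (rule ext) (simp add: walk_op_def algebra_simps sum.distrib)

lemma walk_op_pow_add: "(walk_op ^^ l) (\<lambda>i. f i + g i) = (\<lambda>i. (walk_op ^^ l) f i + (walk_op ^^ l) g i)"
  by (induction l) (simp_all add: walk_op_linear)

lemma walk_op_pow_cong:
  assumes "\<And>i. i < n \<Longrightarrow> f i = g i" "i < n"
  shows "(walk_op ^^ l) f i = (walk_op ^^ l) g i"
  using assms(2) by (induction l arbitrary: i) (auto simp: assms(1) cong: walk_op_cong)

lemma point_nonneg: "w < n \<Longrightarrow> 0 \<le> point w i"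
  using d_pos[of w] by (simp add: point_def)

end

section \<open>The target vector, partial sums of the series and their tail\<close>

locale rddz_target = rddz_system +
  fixes t :: "real vec"
  assumes t: "t \<in> carrier_vec n" and t_nz: "t \<noteq> 0\<^sub>v n" and t_nonneg: "\<And>i. i < n \<Longrightarrow> 0 \<le> t $ i"
begin

definition t_dot :: "(nat \<Rightarrow> real) \<Rightarrow> real" where
  "t_dot f = (\<Sum>i<n. t $ i * f i)"

text \<open>What mass distributed as \<open>f\<close> contributes to the series within its next
  \<open>m\<close> terms. At \<open>point w\<close> these are the partial sums converging to
  \<open>2 * (t \<bullet> xstar M (unit_vec n w))\<close>.\<close>

definition potential :: "nat \<Rightarrow> (nat \<Rightarrow> real) \<Rightarrow> real" where
  "potential m f = (\<Sum>k<m. t_dot ((walk_op ^^ k) f))"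

lemma dim_t [simp]: "dim_vec t = n" using t by simp

lemma t_dot_nonneg: "(\<And>i. i < n \<Longrightarrow> 0 \<le> f i) \<Longrightarrow> 0 \<le> t_dot f"
  by (auto simp: t_dot_def t_nonneg intro!: sum_nonneg)

lemma norm_1_t: "norm_p 1 t = (\<Sum>i<n. t $ i)"
proof -
  have "(\<Sum>i<n. t $ i) \<ge> 0" using t_nonneg by (intro sum_nonneg) auto
  then show ?thesis using t_nonneg by (simp add: norm_p_def)
qed

lemma norm_1_t_pos: "norm_p 1 t > 0"
proof -
  obtain j where "j < n" "t $ j \<noteq> 0"
    using t t_nz by (metis carrier_vecD eq_vecI index_zero_vec(1,2))
  then show ?thesis unfolding norm_1_t
    using t_nonneg by (intro sum_pos2[of _ j]) (auto simp: less_le)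
qed

lemma t_xstar_sums:
  assumes w: "w < n" and range: "unit_vec n w \<in> mat_range M"
    and g: "0 < \<gamma>" "\<gamma> \<le> gamma_max M"
  shows "(\<lambda>l. t_dot ((walk_op ^^ l) (point w))) sums (2 * (t \<bullet> xstar M (unit_vec n w)))"
proof -
  have g1: "\<gamma> \<le> 1" using iterate_bound(2)[OF w range w g(2)] .
  have "(\<lambda>l. t $ i * (walk_op ^^ l) (point w) i) sums (t $ i * (2 * xstar M (unit_vec n w) $ i))"
    if i: "i < n" for i
  proof -
    have "summable (\<lambda>l. (walk_op ^^ l) (point w) i)"
    proof (rule summable_comparison_test)
      show "\<exists>N. \<forall>l\<ge>N. norm ((walk_op ^^ l) (point w) i) \<le> d_max M / (d i * d w) * (1 - \<gamma>) ^ l"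
        using iterate_bound(1)[OF w range i g(2)] by auto
      show "summable (\<lambda>l. d_max M / (d i * d w) * (1 - \<gamma>) ^ l)"
        using g g1 by (intro summable_mult summable_geometric) auto
    qed
    then show ?thesis
      by (intro sums_mult) (simp add: xstar_unit_nth[OF w i] summable_sums)
  qed
  then have "(\<lambda>l. \<Sum>i<n. t $ i * (walk_op ^^ l) (point w) i) sums
      (\<Sum>i<n. t $ i * (2 * xstar M (unit_vec n w) $ i))"
    by (intro sums_sum) auto
  also have "(\<Sum>i<n. t $ i * (2 * xstar M (unit_vec n w) $ i)) = 2 * (t \<bullet> xstar M (unit_vec n w))"
    by (simp add: scalar_prod_def xstar_def atLeast0LessThan sum_distrib_left mult_ac)
  finally show ?thesis by (simp add: t_dot_def)
qed

text \<open>Summing over the support of \<open>t\<close> only, with the entries of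
  \<open>D^-1 t\<close> split off, produces exactly the factors that occur inside the logarithm of
  \<open>log_length\<close>.\<close>

lemma t_dot_iterate_le:
  assumes w: "w < n" and range: "unit_vec n w \<in> mat_range M" and g: "\<gamma> \<le> gamma_max M"
  shows "t_dot ((walk_op ^^ l) (point w)) \<le>
    d_max M * norm_0 t * norm_p \<infinity> (diag_inv M *\<^sub>v t) / d w * (1 - \<gamma>) ^ l"
proof -
  define T where "T = {i. i < n \<and> t $ i \<noteq> 0}"
  have g1: "\<gamma> \<le> 1" using iterate_bound(2)[OF w range w g] .
  have D: "d_max M > 0" using d_le_d_max[OF w] d_pos[OF w] by simp
  have "t_dot ((walk_op ^^ l) (point w)) = (\<Sum>i\<in>T. t $ i * (walk_op ^^ l) (point w) i)"
    unfolding t_dot_def T_def by (rule sum.mono_neutral_right) auto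
  also have "\<dots> \<le> (\<Sum>i\<in>T. norm_p \<infinity> (diag_inv M *\<^sub>v t) * (d_max M / d w * (1 - \<gamma>) ^ l))"
  proof (rule sum_mono)
    fix i assume "i \<in> T"
    then have i: "i < n" by (simp add: T_def)
    have "t $ i * (walk_op ^^ l) (point w) i \<le> t $ i * (d_max M / (d i * d w) * (1 - \<gamma>) ^ l)"
      using iterate_bound(1)[OF w range i g, of l] t_nonneg[OF i] by (intro mult_left_mono) auto
    also have "\<dots> = t $ i / d i * (d_max M / d w * (1 - \<gamma>) ^ l)"
      by simp
    also have "\<dots> \<le> norm_p \<infinity> (diag_inv M *\<^sub>v t) * (d_max M / d w * (1 - \<gamma>) ^ l)"
    proof (rule mult_right_mono)
      show "t $ i / d i \<le> norm_p \<infinity> (diag_inv M *\<^sub>v t)"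
        using abs_nth_le_norm_p[of \<infinity> i "diag_inv M *\<^sub>v t"] diag_inv_mult_vec[OF t] i t_nonneg[OF i] d_pos[OF i] by simp
      show "0 \<le> d_max M / d w * (1 - \<gamma>) ^ l"
        using D d_pos[OF w] g1 by simp
    qed
    finally show "t $ i * (walk_op ^^ l) (point w) i \<le>
      norm_p \<infinity> (diag_inv M *\<^sub>v t) * (d_max M / d w * (1 - \<gamma>) ^ l)" .
  qed
  also have "\<dots> = d_max M * norm_0 t * norm_p \<infinity> (diag_inv M *\<^sub>v t) / d w * (1 - \<gamma>) ^ l"
    by (simp add: norm_0_def T_def)
  finally show ?thesis .
qed

text \<open>Partial sums of a nonnegative series stay below its value. The tail is dominated by a
  geometric series of value \<open>Q * (1 - \<gamma>) ^ L / \<gamma>\<close>; the logarithm in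
  \<open>log_length\<close> is that of \<open>Q / (\<gamma> * E)\<close>, and
  \<open>(1 - \<gamma>) ^ L\<close> is at most \<open>exp (- \<gamma> * L)\<close>.\<close>

lemma truncation:
  assumes w: "w < n" and range: "unit_vec n w \<in> mat_range M" and g: "0 < \<gamma>" "\<gamma> \<le> gamma_max M"
    and eps: "0 < \<epsilon>" and eta: "0 < \<eta>" "\<eta> \<le> t \<bullet> xstar M (unit_vec n w)"
    and L: "L_trunc M t \<epsilon> \<gamma> \<eta> \<le> real L"
  defines "X \<equiv> t \<bullet> xstar M (unit_vec n w)"
  shows "potential m (point w) \<le> 2 * X"
    and "2 * X \<le> potential L (point w) + \<epsilon> * sqrt (1 / d w) * X"
proof -
  define s where "s l = t_dot ((walk_op ^^ l) (point w))" for l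
  define E where "E = \<epsilon> * sqrt (1 / d w) * X"
  define Q where "Q = d_max M * norm_0 t * norm_p \<infinity> (diag_inv M *\<^sub>v t) / d w"
  have g1: "\<gamma> \<le> 1" using iterate_bound(2)[OF w range w g(2)] .
  have sums: "s sums (2 * X)" unfolding s_def[abs_def] X_def by (rule t_xstar_sums[OF w range g])
  have s0: "0 \<le> s l" for l
    unfolding s_def using point_nonneg[OF w] by (intro t_dot_nonneg walk_op_pow_nonneg) auto
  show "potential m (point w) \<le> 2 * X"
    using sum_le_suminf[OF sums_summable[OF sums], of "{..<m}"] s0 sums_unique[OF sums]
    by (simp add: potential_def s_def)
  have E: "E > 0" using eps eta d_pos[OF w] by (simp add: E_def X_def)
  have Q0: "Q \<ge> 0" using d_le_d_max[OF w] d_pos[OF w] norm_p_nonneg[of \<infinity>] by (auto simp: Q_def)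
  have "norm_0 (unit_vec n w :: real vec) = 1"
  proof -
    have "{i. i < n \<and> unit_vec n w $ i \<noteq> (0::real)} = {w}" using w by (auto split: if_splits)
    then show ?thesis by (simp add: norm_0_def)
  qed
  then have "log_length M (unit_vec n w) t \<gamma> (target_accuracy M (unit_vec n w) t \<epsilon>) = 1 / \<gamma> * ln (Q / (\<gamma> * E))"
    by (simp add: log_length_def target_accuracy_def norm_diag_inv_unit[OF w] E_def X_def Q_def mult_ac)
  moreover have "w \<in> admissible M t \<eta>" using w range eta by (simp add: admissible_def)
  moreover have "finite (admissible M t \<eta>)" by (simp add: admissible_def)
  ultimately have "1 / \<gamma> * ln (Q / (\<gamma> * E)) \<le> L_trunc M t \<epsilon> \<gamma> \<eta>"
    unfolding L_trunc_def Let_def dims by (intro Max_ge) force+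
  with L have "1 / \<gamma> * ln (Q / (\<gamma> * E)) \<le> real L" by (rule order_trans[rotated])
  then have ln: "ln (Q / (\<gamma> * E)) \<le> \<gamma> * L" using g by (simp add: field_simps)
  have tail: "Q * (1 - \<gamma>) ^ L / \<gamma> \<le> E"
  \<comment> \<open>The logarithm is informative only for positive \<open>Q\<close>; for
    \<open>Q = 0\<close> the tail bound itself is 0.\<close>
  proof (cases "Q = 0")
    case False
    then have Q: "Q > 0" using Q0 by simp
    then have "Q / (\<gamma> * E) > 0" using E g by simp
    then have "Q / (\<gamma> * E) \<le> exp (\<gamma> * L)" using ln by (metis exp_le_cancel_iff exp_ln)
    moreover have "(1 - \<gamma>) ^ L \<le> exp (- \<gamma>) ^ L"
      using g1 exp_ge_add_one_self[of "- \<gamma>"] by (intro power_mono) auto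
    then have "(1 - \<gamma>) ^ L \<le> 1 / exp (\<gamma> * L)"
      using exp_of_nat_mult[of L "- \<gamma>"] by (simp add: exp_minus mult.commute inverse_eq_divide)
    then have "exp (\<gamma> * L) * (1 - \<gamma>) ^ L \<le> 1" by (simp add: field_simps)
    ultimately have "Q / (\<gamma> * E) * (1 - \<gamma>) ^ L \<le> 1"
      using g1 by (meson diff_ge_0_iff_ge mult_right_mono order_trans zero_le_power)
    then show ?thesis using g E by (simp add: field_simps)
  qed (use E in auto)
  have "2 * X = (\<Sum>l. s (l + L)) + (\<Sum>l<L. s l)"
    using suminf_split_initial_segment[OF sums_summable[OF sums], of L] sums_unique[OF sums] by simp
  also have "(\<Sum>l. s (l + L)) \<le> (\<Sum>l. Q * (1 - \<gamma>) ^ L * (1 - \<gamma>) ^ l)"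
  proof (rule suminf_le)
    show "s (l + L) \<le> Q * (1 - \<gamma>) ^ L * (1 - \<gamma>) ^ l" for l
      using t_dot_iterate_le[OF w range g(2), of "l + L"] by (simp add: s_def Q_def power_add mult_ac)
    show "summable (\<lambda>l. s (l + L))" using sums_summable[OF sums] by (simp add: summable_iff_shift)
    show "summable (\<lambda>l. Q * (1 - \<gamma>) ^ L * (1 - \<gamma>) ^ l)"
      using g g1 by (intro summable_mult summable_geometric) auto
  qed
  also have "(\<Sum>l. Q * (1 - \<gamma>) ^ L * (1 - \<gamma>) ^ l) = Q * (1 - \<gamma>) ^ L / \<gamma>"
    using g g1 by (subst suminf_mult) (auto simp: suminf_geometric intro!: summable_geometric)
  also note tail
  finally show "2 * X \<le> potential L (point w) + \<epsilon> * sqrt (1 / d w) * X"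
    by (simp add: potential_def s_def E_def)
qed

end

section \<open>Concentration of sums of independent samples\<close>

text \<open>The first sample is split off because the sampling loop unfolds from the front; the
  coupling is then an induction on \<open>m\<close>.\<close>

primrec iid_sum :: "real pmf \<Rightarrow> nat \<Rightarrow> real pmf" where
  "iid_sum p 0 = return_pmf 0"
| "iid_sum p (Suc m) = bind_pmf p (\<lambda>x. map_pmf ((+) x) (iid_sum p m))"

lemma finite_iid_sum: "finite (set_pmf p) \<Longrightarrow> finite (set_pmf (iid_sum p m))"
  by (induction m) auto

lemma integrable_iid_sum [simp]:
  fixes f :: "real \<Rightarrow> real"
  shows "finite (set_pmf p) \<Longrightarrow> integrable (measure_pmf (iid_sum p m)) f"
  by (intro integrable_measure_pmf_finite finite_iid_sum)

lemma expectation_bind_finite: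
  fixes f :: "'b \<Rightarrow> real"
  assumes "finite (set_pmf p)" "\<And>x. x \<in> set_pmf p \<Longrightarrow> finite (set_pmf (q x))"
  shows "measure_pmf.expectation (bind_pmf p q) f =
    measure_pmf.expectation p (\<lambda>x. measure_pmf.expectation (q x) f)"
  using assms by (subst pmf_expectation_bind[of "set_pmf p"]) (auto simp: integral_measure_pmf[OF assms(1)])

lemma expectation_iid_sum:
  assumes "finite (set_pmf p)"
  shows "measure_pmf.expectation (iid_sum p m) (\<lambda>x. x) = m * measure_pmf.expectation p (\<lambda>x. x)"
proof (induction m)
  case (Suc m)
  have [simp]: "integrable (measure_pmf p) f" for f :: "real \<Rightarrow> real"
    by (rule integrable_measure_pmf_finite[OF assms])
  show ?case using assms Suc
    by (simp add: expectation_bind_finite finite_iid_sum ring_distribs)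
qed simp

text \<open>Split off the first sample: the cross term vanishes because the sum of the others is
  centred.\<close>

lemma variance_iid_sum:
  fixes p defines "\<mu> \<equiv> measure_pmf.expectation p (\<lambda>x. x)"
  assumes fin: "finite (set_pmf p)"
  shows "measure_pmf.expectation (iid_sum p m) (\<lambda>x. (x - m * \<mu>)\<^sup>2) =
    m * measure_pmf.expectation p (\<lambda>x. (x - \<mu>)\<^sup>2)"
proof (induction m)
  case (Suc m)
  have [simp]: "integrable (measure_pmf p) f" for f :: "real \<Rightarrow> real"
    by (rule integrable_measure_pmf_finite[OF fin])
  have mean: "measure_pmf.expectation (iid_sum p m) (\<lambda>x. x - m * \<mu>) = 0"
    using fin by (simp add: expectation_iid_sum \<mu>_def)
  have "measure_pmf.expectation (iid_sum p m) (\<lambda>y. (x + y - Suc m * \<mu>)\<^sup>2) =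
      measure_pmf.expectation (iid_sum p m) (\<lambda>y. (x - \<mu>)\<^sup>2 + (2 * (x - \<mu>)) * (y - m * \<mu>) + (y - m * \<mu>)\<^sup>2)" for x
    by (intro Bochner_Integration.integral_cong) (auto simp: power2_eq_square algebra_simps)
  also have "\<dots> x = (x - \<mu>)\<^sup>2 + 2 * (x - \<mu>) * 0 + m * measure_pmf.expectation p (\<lambda>x. (x - \<mu>)\<^sup>2)" for x
    using fin by (subst Bochner_Integration.integral_add) (auto simp: mean Suc)
  finally show ?case using fin
    by (simp add: expectation_bind_finite finite_iid_sum algebra_simps)
qed simp

text \<open>Values in \<open>[0, K]\<close> satisfy \<open>x * x <= K * x\<close>, so the variance
  is at most \<open>K * \<mu>\<close>. Keeping a factor \<open>\<mu>\<close> instead of a second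
  \<open>K\<close> is what makes a relative error affordable. The 4 is Chebyshev's inequality with
  failure probability \<open>1 / 4\<close>.\<close>

lemma iid_sum_concentration:
  assumes fin: "finite (set_pmf p)" and bounds: "\<And>x. x \<in> set_pmf p \<Longrightarrow> 0 \<le> x \<and> x \<le> K"
    and \<mu>: "measure_pmf.expectation p (\<lambda>x. x) = \<mu>" and N: "N > 0" and a: "a > 0"
    and le: "4 * (K * \<mu>) \<le> N * a\<^sup>2"
  shows "measure_pmf.prob (iid_sum p N) {S. \<bar>S / N - \<mu>\<bar> \<le> a} \<ge> 3 / 4"
proof -
  have [simp]: "integrable (measure_pmf p) f" for f :: "real \<Rightarrow> real"
    by (rule integrable_measure_pmf_finite[OF fin])
  have "measure_pmf.expectation p (\<lambda>x. (x - \<mu>)\<^sup>2) = measure_pmf.expectation p (\<lambda>x. x\<^sup>2) - \<mu>\<^sup>2"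
    using measure_pmf.variance_eq[of p "\<lambda>x. x"] \<mu> by simp
  also have "\<dots> \<le> measure_pmf.expectation p (\<lambda>x. K * x)"
  proof -
    have "measure_pmf.expectation p (\<lambda>x. x\<^sup>2) \<le> measure_pmf.expectation p (\<lambda>x. K * x)"
      using bounds by (intro integral_mono_AE AE_pmfI) (auto simp: power2_eq_square intro!: mult_right_mono)
    then show ?thesis by (smt (verit) zero_le_power2)
  qed
  also have "\<dots> = K * \<mu>" using \<mu> by simp
  finally have var: "measure_pmf.expectation p (\<lambda>x. (x - \<mu>)\<^sup>2) \<le> K * \<mu>" .
  have "measure_pmf.prob (iid_sum p N) {S. N * a \<le> \<bar>S - N * \<mu>\<bar>} \<le>
      measure_pmf.expectation (iid_sum p N) (\<lambda>x. (x - N * \<mu>)\<^sup>2) / (N * a)\<^sup>2"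
    using measure_pmf.Chebyshev_inequality[of "\<lambda>x. x" "iid_sum p N" "N * a"] fin N a
    by (simp add: expectation_iid_sum \<mu>)
  also have "\<dots> = N * measure_pmf.expectation p (\<lambda>x. (x - \<mu>)\<^sup>2) / (N * a)\<^sup>2"
    using variance_iid_sum[OF fin, of N] by (simp add: \<mu>)
  also have "\<dots> \<le> N * (K * \<mu>) / (N * a)\<^sup>2"
    using var by (intro divide_right_mono mult_left_mono) auto
  also have "\<dots> \<le> 1 / 4"
    using N a le by (simp add: power2_eq_square field_simps)
  finally have bad: "measure_pmf.prob (iid_sum p N) {S. N * a \<le> \<bar>S - N * \<mu>\<bar>} \<le> 1 / 4" .
  have "- {S. N * a \<le> \<bar>S - N * \<mu>\<bar>} \<subseteq> {S. \<bar>S / N - \<mu>\<bar> \<le> a}"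
  proof
    fix S assume "S \<in> - {S. N * a \<le> \<bar>S - N * \<mu>\<bar>}"
    then have "\<bar>S - N * \<mu>\<bar> < N * a" by simp
    moreover have "\<bar>S / N - \<mu>\<bar> = \<bar>S - N * \<mu>\<bar> / N"
    proof -
      have "S / N - \<mu> = (S - N * \<mu>) / N" using N by (simp add: field_simps)
      then show ?thesis by (simp add: abs_divide)
    qed
    ultimately show "S \<in> {S. \<bar>S / N - \<mu>\<bar> \<le> a}" using N by (simp add: field_simps)
  qed
  then have "measure_pmf.prob (iid_sum p N) (- {S. N * a \<le> \<bar>S - N * \<mu>\<bar>}) \<le>
      measure_pmf.prob (iid_sum p N) {S. \<bar>S / N - \<mu>\<bar> \<le> a}"
    by (intro measure_pmf.finite_measure_mono) auto
  moreover have "measure_pmf.prob (iid_sum p N) (- {S. N * a \<le> \<bar>S - N * \<mu>\<bar>}) =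
      1 - measure_pmf.prob (iid_sum p N) {S. N * a \<le> \<bar>S - N * \<mu>\<bar>}"
    using measure_pmf.prob_compl[of "{S. N * a \<le> \<bar>S - N * \<mu>\<bar>}" "iid_sum p N"]
    by (simp add: Compl_eq_Diff_UNIV)
  ultimately show ?thesis using bad by simp
qed

section \<open>Random walks and push operations\<close>

context rddz_system
begin

text \<open>Index \<open>n\<close> is absorbing, in agreement with the machine, where a step from an
  invalid index returns \<open>n\<close>.\<close>

definition walk_step :: "nat \<Rightarrow> nat pmf" where
  "walk_step v = (if v < n then walk_pmf M v else return_pmf n)"

lemma set_walk_step: "set_pmf (walk_step v) \<subseteq> {..n}"
  by (cases "v < n") (auto simp: walk_step_def set_pmf_eq[of "walk_pmf M v"] pmf_walk_pmf[OF rddz] split: if_splits)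

lemma finite_walk_step: "finite (set_pmf (walk_step v))"
  using set_walk_step finite_subset by blast

text \<open>The current vertex is counted before the step, so the powers
  \<open>0, ..., m - 1\<close> of \<open>P\<close> are met, as in
  \<open>potential m\<close>.\<close>

primrec walk_sum :: "(nat \<Rightarrow> real) \<Rightarrow> nat \<Rightarrow> nat \<Rightarrow> real pmf" where
  "walk_sum R 0 v = return_pmf 0"
| "walk_sum R (Suc m) v = bind_pmf (walk_step v) (\<lambda>u. map_pmf ((+) (R v)) (walk_sum R m u))"

lemma finite_walk_sum: "finite (set_pmf (walk_sum R m v))"
  by (induction m arbitrary: v) (auto simp: finite_walk_step)

lemma walk_sum_bounds:
  fixes B :: real
  assumes "\<And>v. v \<le> n \<Longrightarrow> 0 \<le> R v \<and> R v \<le> B" "v \<le> n" "x \<in> set_pmf (walk_sum R m v)"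
  shows "0 \<le> x \<and> x \<le> m * B"
  using assms(2,3)
proof (induction m arbitrary: v x)
  case (Suc m)
  then obtain u y where "u \<le> n" "y \<in> set_pmf (walk_sum R m u)" "x = R v + y"
    using set_walk_step[of v] by auto
  then show ?case using Suc.IH[of u y] assms(1)[OF Suc.prems(1)] by (auto simp: algebra_simps)
qed simp

lemma expectation_walk_sum_end:
  "R n = 0 \<Longrightarrow> measure_pmf.expectation (walk_sum R m n) (\<lambda>x. x) = 0"
  by (induction m) (auto simp: walk_step_def bind_return_pmf)

text \<open>Conditioning on the first step turns the mean over the rest of the walk into one more
  application of \<open>P\<close>; \<open>R n = 0\<close> makes terminated walks count
  nothing.\<close>

lemma expectation_walk_sum:
  assumes R: "R n = 0" and "v < n"
  shows "measure_pmf.expectation (walk_sum R m v) (\<lambda>x. x) = (\<Sum>k<m. (walk_op ^^ k) R v)"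
  using assms(2)
proof (induction m arbitrary: v)
  case (Suc m)
  have [simp]: "integrable (measure_pmf (walk_sum R m u)) f" for u and f :: "real \<Rightarrow> real"
    by (intro integrable_measure_pmf_finite finite_walk_sum)
  have "measure_pmf.expectation (walk_sum R (Suc m) v) (\<lambda>x. x) =
      measure_pmf.expectation (walk_step v) (\<lambda>u. R v + measure_pmf.expectation (walk_sum R m u) (\<lambda>x. x))"
    by (simp add: expectation_bind_finite finite_walk_step finite_walk_sum)
  also have "\<dots> = R v + measure_pmf.expectation (walk_step v) (\<lambda>u. measure_pmf.expectation (walk_sum R m u) (\<lambda>x. x))"
    by (subst Bochner_Integration.integral_add)
      (auto intro!: integrable_measure_pmf_finite finite_walk_step)
  also have "measure_pmf.expectation (walk_step v) (\<lambda>u. measure_pmf.expectation (walk_sum R m u) (\<lambda>x. x)) =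
      (\<Sum>u\<le>n. measure_pmf.expectation (walk_sum R m u) (\<lambda>x. x) * pmf (walk_step v) u)"
    using set_walk_step by (subst integral_measure_pmf[of "{..n}"]) (auto simp: mult_ac)
  also have "\<dots> = (\<Sum>u<n. (\<Sum>k<m. (walk_op ^^ k) R u) * walk_prob M v u)"
    using Suc.prems by (auto simp: lessThan_Suc_atMost[symmetric] expectation_walk_sum_end[of R, OF R]
      Suc.IH walk_step_def pmf_walk_pmf[OF rddz] intro!: sum.cong)
  also have "\<dots> = (\<Sum>k<m. (walk_op ^^ Suc k) R v)"
    unfolding sum_distrib_right by (subst sum.swap) (simp add: walk_op_def mult.commute)
  finally show ?case by (simp only: sum.lessThan_Suc_shift funpow_0)
qed simp

section \<open>Thresholded residues and the cost of pushing them\<close>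

definition col_nnz :: "nat \<Rightarrow> nat" where
  "col_nnz v = card {u. u < n \<and> M $$ (u, v) \<noteq> 0}"

lemma col_nnz_pos: "v < n \<Longrightarrow> 1 \<le> col_nnz v"
  using d_pos[of v] by (auto simp: col_nnz_def Suc_le_eq card_gt_0_iff)

lemma sum_col_nnz: "(\<Sum>v<n. col_nnz v) = nnz M"
proof -
  have "nnz M = card (prod.swap ` Sigma {..<n} (\<lambda>v. {u. u < n \<and> M $$ (u, v) \<noteq> 0}))"
    unfolding nnz_def by (rule arg_cong[of _ _ card]) (auto simp: image_iff)
  also have "\<dots> = (\<Sum>v<n. col_nnz v)"
    by (subst card_image) (auto simp: col_nnz_def inj_on_def)
  finally show ?thesis ..
qed

lemma n_le_nnz: "n \<le> nnz M"
  unfolding sum_col_nnz[symmetric]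
  using sum_mono[of "{..<n}" "\<lambda>_. 1" col_nnz] col_nnz_pos by simp

definition pushed :: "real \<Rightarrow> (nat \<Rightarrow> real) \<Rightarrow> nat \<Rightarrow> real" where
  "pushed h r v = (if h < r v then r v else 0)"

primrec residue :: "real \<Rightarrow> nat \<Rightarrow> nat \<Rightarrow> nat \<Rightarrow> real" where
  "residue h w 0 = point w"
| "residue h w (Suc l) = walk_op (pushed h (residue h w l))"

definition kept :: "real \<Rightarrow> nat \<Rightarrow> nat \<Rightarrow> nat \<Rightarrow> real" where
  "kept h w m v = (\<Sum>l<m. residue h w l v - pushed h (residue h w l) v)"

text \<open>Columns are counted because the next residue is \<open>P\<close> times the pushed part:
  mass at \<open>v\<close> reaches just those \<open>u\<close> with a nonzero entry in column
  \<open>v\<close>.\<close>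

definition level_cost :: "real \<Rightarrow> nat \<Rightarrow> nat \<Rightarrow> nat" where
  "level_cost h w l = (\<Sum>v | v < n \<and> h < residue h w l v. col_nnz v)"

lemma residue_nonneg: "w < n \<Longrightarrow> v < n \<Longrightarrow> 0 \<le> residue h w l v"
  by (induction l arbitrary: v) (auto simp: point_nonneg pushed_def intro!: walk_op_nonneg)

lemma pushed_le: "w < n \<Longrightarrow> v < n \<Longrightarrow> pushed h (residue h w l) v \<le> residue h w l v"
  using residue_nonneg by (simp add: pushed_def)

lemma pushed_nonneg: "w < n \<Longrightarrow> v < n \<Longrightarrow> 0 \<le> pushed h (residue h w l) v"
  using residue_nonneg by (simp add: pushed_def)

text \<open>Holding back part of a nonnegative residue only loses mass. The full iterates, unlike
  the thresholded ones, can be summed over all sources.\<close>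

lemma residue_le: "w < n \<Longrightarrow> v < n \<Longrightarrow> residue h w l v \<le> (walk_op ^^ l) (point w) v"
proof (induction l arbitrary: v)
  case (Suc l)
  have "walk_op (pushed h (residue h w l)) v \<le> walk_op ((walk_op ^^ l) (point w)) v"
    using Suc pushed_le[OF Suc.prems(1), of _ h l] by (intro walk_op_mono) (auto intro: order_trans)
  then show ?case by simp
qed simp

lemma kept_bounds:
  assumes "w < n" "v < n" "0 \<le> h"
  shows "0 \<le> kept h w m v" and "kept h w m v \<le> m * h"
proof -
  have *: "0 \<le> residue h w l v - pushed h (residue h w l) v \<and>
      residue h w l v - pushed h (residue h w l) v \<le> h" for l
    using residue_nonneg[OF assms(1,2), of h l] assms(3) by (auto simp: pushed_def)
  then show "0 \<le> kept h w m v" by (auto simp: kept_def intro: sum_nonneg)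
  have "kept h w m v \<le> (\<Sum>l<m. h)" unfolding kept_def using * by (intro sum_mono) blast
  then show "kept h w m v \<le> m * h" by simp
qed

definition supp :: "(nat \<Rightarrow> real) \<Rightarrow> nat set" where
  "supp f = {v. v < n \<and> 0 < f v}"

lemma finite_supp [simp]: "finite (supp f)"
  by (simp add: supp_def)

text \<open>A vertex obtains residue only through a pushed column. This lets the queue of the next
  level be charged to the columns scanned at the present one.\<close>

lemma card_supp_residue_Suc:
  assumes "0 \<le> h"
  shows "card (supp (residue h w (Suc l))) \<le> level_cost h w l"
proof -
  let ?V = "{v. v < n \<and> h < residue h w l v}" and ?U = "\<lambda>v. {u. u < n \<and> M $$ (u, v) \<noteq> 0}"
  have "supp (residue h w (Suc l)) \<subseteq> (\<Union>v\<in>?V. ?U v)"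
  proof
    fix u assume "u \<in> supp (residue h w (Suc l))"
    then have u: "u < n" "(\<Sum>v<n. walk_prob M u v * pushed h (residue h w l) v) \<noteq> 0"
      by (auto simp: supp_def walk_op_def)
    then obtain v where "v < n" "walk_prob M u v * pushed h (residue h w l) v \<noteq> 0"
      by (meson lessThan_iff sum.neutral)
    then show "u \<in> (\<Union>v\<in>?V. ?U v)" using u(1)
      by (auto simp: walk_prob_eq pushed_def split: if_splits)
  qed
  then have "card (supp (residue h w (Suc l))) \<le> card (\<Union>v\<in>?V. ?U v)"
    by (intro card_mono) auto
  also have "\<dots> \<le> level_cost h w l"
    unfolding level_cost_def col_nnz_def by (rule card_UN_le) simp
  finally show ?thesis .
qed

text \<open>The level loop may stop early with an empty queue. This lemma, \<open>kept_after\<close>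
  and \<open>reserve_after\<close> identify what it has computed by then with the values at level
  \<open>L\<close>.\<close>

lemma residue_eq_0_after:
  assumes "w < n" "0 \<le> h" "supp (residue h w l) = {}" "l \<le> m" "v < n"
  shows "residue h w m v = 0"
  using assms(4,5)
proof (induction m arbitrary: v rule: dec_induct)
  case base
  then show ?case using assms(3) residue_nonneg[OF assms(1) base, of h l] by (force simp: supp_def)
next
  case (step m)
  then show ?case using assms(2) by (auto simp: walk_op_def pushed_def intro!: sum.neutral)
qed

lemma kept_after:
  assumes "w < n" "0 \<le> h" "supp (residue h w l) = {}" "l \<le> m" "v < n"
  shows "kept h w m v = kept h w l v"
  unfolding kept_def using residue_eq_0_after[OF assms(1-3) _ assms(5)] assms(4)
  by (intro sum.mono_neutral_right) (auto simp: pushed_def)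

lemma walk_op_pow_scale: "(walk_op ^^ l) (\<lambda>i. c * f i) = (\<lambda>i. c * (walk_op ^^ l) f i)"
  by (induction l) (simp_all add: walk_op_def sum_distrib_left mult_ac)

text \<open>Hence at most \<open>1 / \<theta>\<close> of the sources \<open>w\<close> push at a given vertex and level.\<close>
lemma sum_sources_le_1:
  assumes "v < n"
  shows "(\<Sum>w<n. d w * (walk_op ^^ l) (point w) v) \<le> 1"
  using assms
proof (induction l arbitrary: v)
  case 0
  have "(\<Sum>w<n. d w * point w v) = (\<Sum>w<n. if w = v then 1 else 0)"
  proof (rule sum.cong)
    show "d w * point w v = (if w = v then 1 else 0)" if "w \<in> {..<n}" for w
      using d_pos[of w] that by (auto simp: point_def)
  qed simp
  then show ?case using 0 by simp
next
  case (Suc l)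
  have "(\<Sum>w<n. d w * (walk_op ^^ Suc l) (point w) v) =
      (\<Sum>w<n. \<Sum>j<n. walk_prob M v j * (d w * (walk_op ^^ l) (point w) j))"
    by (simp add: walk_op_def sum_distrib_left mult_ac)
  also have "\<dots> = (\<Sum>j<n. walk_prob M v j * (\<Sum>w<n. d w * (walk_op ^^ l) (point w) j))"
    by (subst sum.swap) (simp add: sum_distrib_left)
  also have "\<dots> \<le> (\<Sum>j<n. walk_prob M v j * 1)"
    using Suc by (intro sum_mono mult_left_mono walk_prob_nonneg) auto
  also have "\<dots> \<le> 1" using walk_prob_sum_le_1[OF Suc.prems] by simp
  finally show ?case .
qed

text \<open>Markov's inequality in the source: a push at \<open>v\<close> forces
  \<open>\<theta>\<close> to be below \<open>d w\<close> times the iterate at \<open>v\<close>, and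
  these products sum to at most 1 over \<open>w\<close>. Each vertex then enters with the length of
  its column.\<close>

lemma sum_level_cost:
  assumes "0 < \<theta>"
  shows "\<theta> * (\<Sum>w<n. real (level_cost (\<theta> / d w) w l)) \<le> nnz M"
proof -
  have ind: "\<theta> * (if \<theta> / d w < residue (\<theta> / d w) w l v then 1 else 0) \<le> d w * (walk_op ^^ l) (point w) v"
    if "w < n" "v < n" for w v
  proof (cases "\<theta> / d w < residue (\<theta> / d w) w l v")
    case True
    then have "\<theta> / d w < (walk_op ^^ l) (point w) v" using residue_le[OF that, of "\<theta> / d w" l] by simp
    then show ?thesis using True d_pos[OF that(1)] by (simp add: field_simps)
  next
    case False
    then show ?thesis using that d_pos[OF that(1)] point_nonneg[OF that(1)]
      by (auto intro!: mult_nonneg_nonneg walk_op_pow_nonneg)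
  qed
  have "\<theta> * (\<Sum>w<n. real (level_cost (\<theta> / d w) w l)) =
      (\<Sum>w<n. \<Sum>v<n. col_nnz v * (\<theta> * (if \<theta> / d w < residue (\<theta> / d w) w l v then 1 else 0)))"
    unfolding level_cost_def of_nat_sum sum_distrib_left
    by (intro sum.cong refl sum.mono_neutral_cong_left) auto
  also have "\<dots> \<le> (\<Sum>w<n. \<Sum>v<n. col_nnz v * (d w * (walk_op ^^ l) (point w) v))"
    using ind by (intro sum_mono mult_left_mono) auto
  also have "\<dots> = (\<Sum>v<n. col_nnz v * (\<Sum>w<n. d w * (walk_op ^^ l) (point w) v))"
    by (subst sum.swap) (simp add: sum_distrib_left)
  also have "\<dots> \<le> (\<Sum>v<n. real (col_nnz v) * 1)"
    using sum_sources_le_1 by (intro sum_mono mult_left_mono) auto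
  finally show ?thesis by (simp flip: sum_col_nnz)
qed

text \<open>No iterate of \<open>point w\<close> exceeds \<open>1 / d w\<close>, so at
  \<open>\<theta> = 1\<close> nothing is pushed. This settles the case without halvings, in which
  \<open>\<theta>\<close> need not be close to its balanced value.\<close>

lemma level_cost_eq_0: "w < n \<Longrightarrow> level_cost (1 / d w) w l = 0"
proof -
  assume w: "w < n"
  have "residue (1 / d w) w l v \<le> 1 / d w" if "v < n" for v
  proof (rule order_trans[OF residue_le[OF w that] walk_op_pow_le])
    show "point w i \<le> 1 / d w" for i using d_pos[OF w] by (simp add: point_def)
  qed (use d_pos[OF w] that in auto)
  then have "{v. v < n \<and> 1 / d w < residue (1 / d w) w l v} = {}" by (force simp: not_less)
  then show ?thesis by (simp only: level_cost_def sum.empty)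
qed

end

section \<open>The balance between reserve, kept part and residue, and its sampling\<close>

context rddz_target
begin

lemma potential_Suc: "potential (Suc m) f = t_dot f + potential m (walk_op f)"
  by (simp only: potential_def sum.lessThan_Suc_shift funpow_Suc_right funpow_0 o_apply)

lemma potential_add: "potential m (\<lambda>i. f i + g i) = potential m f + potential m g"
  by (simp add: potential_def walk_op_pow_add t_dot_def algebra_simps sum.distrib)

lemma potential_nonneg: "(\<And>i. i < n \<Longrightarrow> 0 \<le> f i) \<Longrightarrow> 0 \<le> potential m f"
  by (auto simp: potential_def intro!: sum_nonneg t_dot_nonneg walk_op_pow_nonneg)

lemma potential_mono: "(\<And>i. i < n \<Longrightarrow> 0 \<le> f i) \<Longrightarrow> m \<le> m' \<Longrightarrow> potential m f \<le> potential m' f"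
  unfolding potential_def
  by (intro sum_mono2) (auto intro!: t_dot_nonneg walk_op_pow_nonneg)

lemma potential_le:
  assumes "\<And>i. i < n \<Longrightarrow> f i \<le> B" "0 \<le> B"
  shows "potential m f \<le> m * (norm_p 1 t * B)"
proof -
  have "t_dot ((walk_op ^^ k) f) \<le> norm_p 1 t * B" for k
    unfolding t_dot_def norm_1_t sum_distrib_right
    using assms by (intro sum_mono mult_left_mono walk_op_pow_le t_nonneg) auto
  then have "potential m f \<le> (\<Sum>k<m. norm_p 1 t * B)" unfolding potential_def by (intro sum_mono)
  then show ?thesis by simp
qed

definition reserve :: "real \<Rightarrow> nat \<Rightarrow> nat \<Rightarrow> real" where
  "reserve h w m = (\<Sum>l<m. t_dot (pushed h (residue h w l)))"

lemma reserve_after: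
  assumes "w < n" "0 \<le> h" "supp (residue h w l) = {}" "l \<le> m"
  shows "reserve h w m = reserve h w l"
  unfolding reserve_def using residue_eq_0_after[OF assms(1-3)] assms(4)
  by (intro sum.mono_neutral_right) (auto simp: pushed_def t_dot_def intro!: sum.neutral)

lemma potential_residue_split:
  "potential m (residue h w l) = potential m (pushed h (residue h w l)) +
    potential m (\<lambda>v. residue h w l v - pushed h (residue h w l) v)"
  by (simp flip: potential_add)

lemma kept_Suc: "kept h w (Suc l) = (\<lambda>v. kept h w l v + (residue h w l v - pushed h (residue h w l) v))"
  by (simp add: kept_def fun_eq_iff)

text \<open>Mass kept at level \<open>l\<close> is entitled to \<open>L - l\<close> further terms
  but is credited with \<open>L\<close>, hence an inequality. The pushed mass is accounted for
  exactly, by \<open>potential_Suc\<close>.\<close>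

lemma push_lower:
  assumes "w < n" "l \<le> L"
  shows "potential L (point w) \<le> reserve h w l + potential L (kept h w l) + potential (L - l) (residue h w l)"
  using assms(2)
proof (induction l)
  case 0
  show ?case by (simp add: reserve_def potential_nonneg kept_def)
next
  case (Suc l)
  let ?a = "pushed h (residue h w l)"
  have "potential (L - l) ?a = t_dot ?a + potential (L - Suc l) (residue h w (Suc l))"
    using Suc.prems potential_Suc[of "L - Suc l" ?a] by (simp add: Suc_diff_Suc)
  moreover have "potential (L - l) (\<lambda>v. residue h w l v - ?a v) \<le> potential L (\<lambda>v. residue h w l v - ?a v)"
    using pushed_le[OF assms(1)] by (intro potential_mono) auto
  ultimately show ?case
    using Suc by (simp add: potential_residue_split[of "L - l"] kept_Suc potential_add reserve_def)
qed

text \<open>Undoing a push gives back the step it made, and by nonnegativity the kept mass may be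
  granted that step too. The budget thus grows by one per level, which is why \<open>m\<close> is
  generalised.\<close>

lemma push_upper:
  assumes "w < n"
  shows "reserve h w l + potential m (kept h w l) + potential m (residue h w l) \<le> potential (m + l) (point w)"
proof (induction l arbitrary: m)
  case 0
  have "potential m (kept h w 0) = 0"
    using walk_op_pow_scale[of _ 0 "\<lambda>_. 0"] by (simp add: kept_def[abs_def] potential_def t_dot_def)
  then show ?case by (simp add: reserve_def)
next
  case (Suc l)
  let ?a = "pushed h (residue h w l)" and ?b = "\<lambda>v. residue h w l v - pushed h (residue h w l) v"
  have b: "potential m ?b \<le> potential (Suc m) ?b"
    using pushed_le[OF assms] by (intro potential_mono) auto
  have k: "potential m (kept h w l) \<le> potential (Suc m) (kept h w l)"
    unfolding kept_def using pushed_le[OF assms] by (intro potential_mono sum_nonneg) auto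
  have "reserve h w (Suc l) + potential m (kept h w (Suc l)) + potential m (residue h w (Suc l)) =
      reserve h w l + potential m (kept h w l) + potential m ?b + potential (Suc m) ?a"
    by (simp add: reserve_def kept_Suc potential_add potential_Suc)
  also have "\<dots> \<le> reserve h w l + potential (Suc m) (kept h w l) + potential (Suc m) (residue h w l)"
    using b k by (simp add: potential_residue_split[of "Suc m"])
  also have "\<dots> \<le> potential (Suc m + l) (point w)" by (rule Suc.IH)
  finally show ?case by simp
qed

text \<open>At \<open>l = L\<close> the leftover residue has no terms to contribute in the lower
  bound and is dropped as nonnegative in the upper one.\<close>

lemma push_sandwich:
  assumes "w < n"
  shows "potential L (point w) \<le> reserve h w L + potential L (kept h w L)"
    and "reserve h w L + potential L (kept h w L) \<le> potential (L + L) (point w)"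
proof -
  show "potential L (point w) \<le> reserve h w L + potential L (kept h w L)"
    using push_lower[OF assms, of L L h] by (simp add: potential_def)
  have "0 \<le> potential L (residue h w L)" using residue_nonneg[OF assms] by (intro potential_nonneg)
  then show "reserve h w L + potential L (kept h w L) \<le> potential (L + L) (point w)"
    using push_upper[OF assms, of h L L] by simp
qed

definition walk_sample :: "(nat \<Rightarrow> real) \<Rightarrow> nat \<Rightarrow> real pmf" where
  "walk_sample R m = bind_pmf (t_pmf t) (walk_sum R m)"

lemma set_t_pmf: "set_pmf (t_pmf t) \<subseteq> {..<n}"
  by (auto simp: set_pmf_eq pmf_t_pmf[OF t t_nz t_nonneg] split: if_splits)

lemma finite_walk_sample: "finite (set_pmf (walk_sample R m))"
  using set_t_pmf finite_subset[OF set_t_pmf] by (auto simp: walk_sample_def finite_walk_sum)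

lemma walk_sample_bounds:
  fixes B :: real
  assumes "\<And>v. v \<le> n \<Longrightarrow> 0 \<le> R v \<and> R v \<le> B" "x \<in> set_pmf (walk_sample R m)"
  shows "0 \<le> x \<and> x \<le> m * B"
proof -
  obtain v where "v \<in> set_pmf (t_pmf t)" "x \<in> set_pmf (walk_sum R m v)"
    using assms(2) by (auto simp: walk_sample_def)
  then show ?thesis using set_t_pmf walk_sum_bounds[of R B v x m, OF assms(1)] by force
qed

lemma expectation_walk_sample:
  assumes R: "R n = 0"
  shows "measure_pmf.expectation (walk_sample R m) (\<lambda>x. x) = potential m R / norm_p 1 t"
proof -
  have "measure_pmf.expectation (walk_sample R m) (\<lambda>x. x) =
      measure_pmf.expectation (t_pmf t) (\<lambda>v. measure_pmf.expectation (walk_sum R m v) (\<lambda>x. x))"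
    unfolding walk_sample_def
    using finite_subset[OF set_t_pmf] by (intro expectation_bind_finite finite_walk_sum) auto
  also have "\<dots> = (\<Sum>v<n. measure_pmf.expectation (walk_sum R m v) (\<lambda>x. x) * pmf (t_pmf t) v)"
    using set_t_pmf by (subst integral_measure_pmf[of "{..<n}"]) (auto simp: mult_ac)
  also have "\<dots> = (\<Sum>v<n. (\<Sum>k<m. (walk_op ^^ k) R v) * (t $ v / norm_p 1 t))"
    by (intro sum.cong) (auto simp: expectation_walk_sum[of R, OF R] pmf_t_pmf[OF t t_nz t_nonneg])
  also have "\<dots> = (\<Sum>k<m. \<Sum>v<n. t $ v * (walk_op ^^ k) R v) / norm_p 1 t"
    unfolding sum_distrib_right by (subst sum.swap) (simp add: sum_divide_distrib mult_ac)
  finally show ?thesis by (simp add: potential_def t_dot_def)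
qed

end

section \<open>The push phase of the program\<close>

text \<open>Total correctness for the phases without random choices: losslessness expresses
  termination, so \<open>surely_while\<close> asks for a variant.\<close>

definition surely :: "'a spmf \<Rightarrow> ('a \<Rightarrow> bool) \<Rightarrow> bool" where
  "surely p Q \<longleftrightarrow> lossless_spmf p \<and> (\<forall>x\<in>set_spmf p. Q x)"

lemma surely_return [simp]: "surely (return_spmf x) Q \<longleftrightarrow> Q x"
  by (simp add: surely_def)

lemma surely_bind [simp]: "surely (bind_spmf p f) Q \<longleftrightarrow> surely p (\<lambda>x. surely (f x) Q)"
  by (auto simp: surely_def set_bind_spmf)

lemma surely_mono: "surely p Q \<Longrightarrow> (\<And>x. Q x \<Longrightarrow> R x) \<Longrightarrow> surely p R"
  by (auto simp: surely_def)

lemma surely_while: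
  fixes f :: "state \<Rightarrow> nat"
  assumes "Inv s"
    and "\<And>s. Inv s \<Longrightarrow> b s \<Longrightarrow> surely (c (tick 1 s)) (\<lambda>s'. Inv s' \<and> f s' < f s)"
    and "\<And>s. Inv s \<Longrightarrow> \<not> b s \<Longrightarrow> Q (tick 1 s)"
  shows "surely (while_loop b c s) Q"
  using assms(1)
proof (induction "f s" arbitrary: s rule: less_induct)
  case less
  show ?case
  proof (cases "b s")
    case True
    have "surely (c (tick 1 s)) (\<lambda>s'. surely (while_loop b c s') Q)"
      using assms(2)[OF less.prems True] by (rule surely_mono) (use less.hyps in auto)
    then show ?thesis using True by (subst while_loop.simps) simp
  next
    case False
    then show ?thesis using assms(3)[OF less.prems] by (subst while_loop.simps) simp
  qed
qed

fun block :: "com list \<Rightarrow> com" where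
  "block [] = Skip"
| "block [c] = c"
| "block (c # cs) = Seq c (block cs)"

text \<open>The numbers of the input registers are dictated by \<open>init_state\<close>. Real
  register 0 holds \<open>\<epsilon>\<close> and is overwritten by the result at the very
  end.\<close>

abbreviation (input) "n_dim \<equiv> 0 :: nat"
abbreviation (input) "n_src \<equiv> 1 :: nat"
abbreviation (input) "n_len \<equiv> 2 :: nat"
abbreviation (input) "n_nnz \<equiv> 3 :: nat"
abbreviation (input) "n_frow \<equiv> 4 :: nat"
abbreviation (input) "n_lvl \<equiv> 5 :: nat"
abbreviation (input) "n_head \<equiv> 6 :: nat"
abbreviation (input) "n_tail \<equiv> 7 :: nat"
abbreviation (input) "n_end \<equiv> 8 :: nat"
abbreviation (input) "n_base \<equiv> 9 :: nat"
abbreviation (input) "n_v \<equiv> 10 :: nat"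
abbreviation (input) "n_deg \<equiv> 11 :: nat"
abbreviation (input) "n_j \<equiv> 12 :: nat"
abbreviation (input) "n_u \<equiv> 13 :: nat"
abbreviation (input) "n_pos \<equiv> 14 :: nat"
abbreviation (input) "n_i \<equiv> 15 :: nat"
abbreviation (input) "n_walk \<equiv> 16 :: nat"
abbreviation (input) "n_k \<equiv> 17 :: nat"
abbreviation (input) "r_eps \<equiv> 0 :: nat"
abbreviation (input) "r_eta \<equiv> 2 :: nat"
abbreviation (input) "r_norm \<equiv> 3 :: nat"
abbreviation (input) "r_diag \<equiv> 4 :: nat"
abbreviation (input) "r_theta \<equiv> 5 :: nat"
abbreviation (input) "r_thr \<equiv> 6 :: nat"
abbreviation (input) "r_res \<equiv> 7 :: nat"
abbreviation (input) "r_x \<equiv> 8 :: nat"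
abbreviation (input) "r_du \<equiv> 9 :: nat"
abbreviation (input) "r_val \<equiv> 10 :: nat"
abbreviation (input) "r_t \<equiv> 11 :: nat"
abbreviation (input) "r_num \<equiv> 12 :: nat"
abbreviation (input) "r_sum \<equiv> 13 :: nat"
abbreviation (input) "r_bal \<equiv> 14 :: nat"
abbreviation (input) "a_queue \<equiv> 0 :: nat"
abbreviation (input) "a_idx \<equiv> 1 :: nat"
abbreviation (input) "b_res \<equiv> 0 :: nat"
abbreviation (input) "b_col \<equiv> 1 :: nat"
abbreviation (input) "b_kept \<equiv> 2 :: nat"
abbreviation (input) "RNum k \<equiv> OfNat (NConst k)"
abbreviation (input) "incr x \<equiv> SetN x (NAdd (NReg x) (NConst 1))"

text \<open>
  Array \<open>b_res\<close> holds the residue of vertex \<open>v\<close> at level \<open>l\<close> at position \<open>l * n + v\<close>, so it never has to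
  be cleared; the base \<open>l * n\<close> is kept in \<open>n_base\<close> for want of a multiplication of naturals. The vertices
  with nonzero residue at the current level occupy the positions \<open>n_head, \<dots>, n_end - 1\<close> of the queue,
  those of the next level the positions \<open>n_end, \<dots>, n_tail - 1\<close>.
\<close>

definition entry_code :: com where
  "entry_code = block [
     SetN n_u (NArr a_idx (NReg n_j)),
     GetDiag r_du (NReg n_u),
     SetN n_pos (NAdd (NAdd (NReg n_base) (NReg n_dim)) (NReg n_u)),
     Cond (RLess (RNum 0) (RArr b_res (NReg n_pos))) Skip
       (Seq (PutN a_queue (NReg n_tail) (NReg n_u)) (incr n_tail)),
     SetR r_val (RArr b_col (NReg n_j)),
     Cond (RLess (RReg r_val) (RNum 0)) (SetR r_val (RSub (RNum 0) (RReg r_val))) Skip,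
     PutR b_res (NReg n_pos) (RAdd (RArr b_res (NReg n_pos))
       (RDiv (RMul (RReg r_val) (RReg r_x)) (RMul (RNum 2) (RReg r_du)))),
     incr n_j]"

definition push_code :: com where
  "push_code = block [
     GetT r_t (NReg n_v),
     SetR r_res (RAdd (RReg r_res) (RMul (RReg r_t) (RReg r_x))),
     GetCol n_deg a_idx b_col (NReg n_v),
     SetN n_j (NConst 0),
     While (NLess (NReg n_j) (NReg n_deg)) entry_code]"

definition item_code :: com where
  "item_code = block [
     SetN n_v (NArr a_queue (NReg n_head)),
     SetR r_x (RArr b_res (NAdd (NReg n_base) (NReg n_v))),
     incr n_head,
     Cond (RLess (RReg r_thr) (RReg r_x)) push_code
       (PutR b_kept (NReg n_v) (RAdd (RArr b_kept (NReg n_v)) (RReg r_x)))]"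

definition level_code :: com where
  "level_code = block [
     SetN n_end (NReg n_tail),
     While (NLess (NReg n_head) (NReg n_end)) item_code,
     SetN n_base (NAdd (NReg n_base) (NReg n_dim)),
     incr n_lvl]"

definition levels_code :: com where
  "levels_code = While (BAnd (NLess (NReg n_head) (NReg n_tail)) (NLess (NReg n_lvl) (NReg n_len))) level_code"

lemmas state_ops = tick_def set_nreg_def set_rreg_def put_narr_def put_rarr_def load_entries_def

section \<open>Correctness and running time of the push loops\<close>

locale push_run = rddz_target +
  fixes rl cl :: "nat \<Rightarrow> nat list" and st :: "nat \<Rightarrow> nat" and w :: nat and h :: real
  assumes valid: "valid_access M rl cl st" and w: "w < n" and h: "0 \<le> h"
begin

abbreviation "I \<equiv> unit_problem M t rl cl st w"

lemma problem_simps [simp]: "Mat I = M" "Tvec I = t" "row_list I = rl" "col_list I = cl" "step_time I = st"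
  by (simp_all add: unit_problem_def)

lemma cl_props:
  assumes "v < n"
  shows "distinct (cl v)" "set (cl v) = {u. u < n \<and> M $$ (u, v) \<noteq> 0}" "length (cl v) = col_nnz v"
proof -
  show *: "distinct (cl v)" "set (cl v) = {u. u < n \<and> M $$ (u, v) \<noteq> 0}"
    using valid assms by (simp_all add: valid_access_def)
  show "length (cl v) = col_nnz v" using distinct_card[OF *(1)] *(2) by (simp add: col_nnz_def)
qed

text \<open>A conditional costs one tick besides its branch; 11 ticks are reached when the vertex is
  new and enters the queue.\<close>

lemma entry_effect:
  assumes "narr s a_idx (nreg s n_j) = u" "u < n" "nreg s n_dim = n" "nreg s n_base + n + u = p"
  shows "\<exists>s'. exec I entry_code s = return_spmf s' \<and>
    nreg s' = (nreg s)(n_u := u, n_pos := p, n_j := nreg s n_j + 1,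
      n_tail := (if 0 < rarr s b_res p then nreg s n_tail else nreg s n_tail + 1)) \<and>
    rarr s' = (rarr s)(b_res := (rarr s b_res)(p := rarr s b_res p +
      \<bar>rarr s b_col (nreg s n_j)\<bar> * rreg s r_x / (2 * d u))) \<and>
    narr s' = (if 0 < rarr s b_res p then narr s
      else (narr s)(a_queue := (narr s a_queue)(nreg s n_tail := u))) \<and>
    (\<forall>x. x \<noteq> r_du \<and> x \<noteq> r_val \<longrightarrow> rreg s' x = rreg s x) \<and> clock s' \<le> clock s + 11"
  using assms by (cases "0 < rarr s b_res p"; cases "rarr s b_col (nreg s n_j) < 0")
    (auto simp: entry_code_def Let_def state_ops fun_eq_iff)

text \<open>Positivity of the stored residue replaces a membership test for the queue:
  \<open>x\<close> and the transition probabilities along a column are positive, so a vertex has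
  residue 0 exactly until it is queued. Hence the queue stays a bijective listing of the
  support.\<close>

lemma entry_loop:
  assumes v: "nreg s0 n_v = v" "v < n" and dim: "nreg s0 n_dim = n" and B: "nreg s0 n_base = B"
    and x: "rreg s0 r_x = x" "0 < x" and deg: "nreg s0 n_deg = length (cl v)" and j: "nreg s0 n_j = 0"
    and ix: "\<And>j. j < length (cl v) \<Longrightarrow> narr s0 a_idx j = cl v ! j \<and> rarr s0 b_col j = M $$ (cl v ! j, v)"
    and g: "\<And>u. u < n \<Longrightarrow> rarr s0 b_res (B + n + u) = g u \<and> 0 \<le> g u"
    and q: "e \<le> nreg s0 n_tail" "bij_betw (narr s0 a_queue) {e..<nreg s0 n_tail} (supp g)"
  shows "surely (exec I (While (NLess (NReg n_j) (NReg n_deg)) entry_code) s0) (\<lambda>s.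
    (\<forall>x. x \<notin> {n_tail, n_u, n_pos, n_j} \<longrightarrow> nreg s x = nreg s0 x) \<and>
    (\<forall>x. x \<notin> {r_du, r_val} \<longrightarrow> rreg s x = rreg s0 x) \<and>
    rarr s b_kept = rarr s0 b_kept \<and>
    (\<forall>i<nreg s0 n_tail. narr s a_queue i = narr s0 a_queue i) \<and>
    nreg s0 n_tail \<le> nreg s n_tail \<and>
    (\<forall>i. i < B + n \<or> B + n + n \<le> i \<longrightarrow> rarr s b_res i = rarr s0 b_res i) \<and>
    (\<forall>u<n. rarr s b_res (B + n + u) = g u + walk_prob M u v * x) \<and>
    bij_betw (narr s a_queue) {e..<nreg s n_tail} (supp (\<lambda>u. g u + walk_prob M u v * x)) \<and>
    clock s \<le> clock s0 + 12 * col_nnz v + 1)"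
    (is "surely _ ?Q")
proof -
  define g' where "g' j u = g u + (if u \<in> set (take j (cl v)) then walk_prob M u v * x else 0)" for j u
  define Inv where "Inv s \<longleftrightarrow>
    (\<forall>x. x \<notin> {n_tail, n_u, n_pos, n_j} \<longrightarrow> nreg s x = nreg s0 x) \<and>
    (\<forall>x. x \<notin> {r_du, r_val} \<longrightarrow> rreg s x = rreg s0 x) \<and>
    rarr s b_kept = rarr s0 b_kept \<and> rarr s b_col = rarr s0 b_col \<and> narr s a_idx = narr s0 a_idx \<and>
    (\<forall>i<nreg s0 n_tail. narr s a_queue i = narr s0 a_queue i) \<and>
    nreg s0 n_tail \<le> nreg s n_tail \<and> nreg s n_j \<le> length (cl v) \<and>
    (\<forall>i. i < B + n \<or> B + n + n \<le> i \<longrightarrow> rarr s b_res i = rarr s0 b_res i) \<and>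
    (\<forall>u<n. rarr s b_res (B + n + u) = g' (nreg s n_j) u) \<and>
    bij_betw (narr s a_queue) {e..<nreg s n_tail} (supp (g' (nreg s n_j))) \<and>
    clock s \<le> clock s0 + 12 * nreg s n_j" for s :: state
  have g'0: "g' 0 = g" by (simp add: g'_def fun_eq_iff)
  have g'_len: "g' (length (cl v)) u = g u + walk_prob M u v * x" if "u < n" for u
    using that v(2) cl_props[OF v(2)] by (auto simp: g'_def walk_prob_eq)
  show ?thesis unfolding exec.simps
  proof (rule surely_while[where Inv = Inv and f = "\<lambda>s. length (cl v) - nreg s n_j"])
    show "Inv s0" using j g q by (simp add: Inv_def g'0)
  next
    fix s assume inv: "Inv s" and "bval s (NLess (NReg n_j) (NReg n_deg))"
    then have jl: "nreg s n_j < length (cl v)" using deg by (simp add: Inv_def)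
    define k where "k = nreg s n_j"
    define u where "u = cl v ! k"
    have u: "u < n" "u \<in> set (cl v)" "M $$ (u, v) \<noteq> 0" "u \<notin> set (take k (cl v))"
      using jl cl_props[OF v(2)] nth_mem[of k "cl v"] unfolding u_def k_def
      by (auto simp: in_set_conv_nth distinct_conv_nth)
    have P: "0 < walk_prob M u v" using u v(2) d_pos[of u] by (simp add: walk_prob_eq)
    have g'S: "g' (Suc k) = (g' k)(u := g u + walk_prob M u v * x)" "g' k u = g u"
      using jl u by (auto simp: g'_def fun_eq_iff take_Suc_conv_app_nth k_def u_def)
    have pos: "0 < g u + walk_prob M u v * x" using P x g[OF u(1)] by (simp add: add_nonneg_pos)
    have val: "\<bar>rarr (tick 1 s) b_col (nreg (tick 1 s) n_j)\<bar> * rreg (tick 1 s) r_x / (2 * d u) = walk_prob M u v * x"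
      using inv jl ix[of k] x u v(2) by (simp add: Inv_def tick_def k_def u_def walk_prob_eq)
    obtain s' where s': "exec I entry_code (tick 1 s) = return_spmf s'"
      "nreg s' = (nreg s)(n_u := u, n_pos := B + n + u, n_j := k + 1,
        n_tail := (if 0 < g u then nreg s n_tail else nreg s n_tail + 1))"
      "rarr s' = (rarr s)(b_res := (rarr s b_res)(B + n + u := g u + walk_prob M u v * x))"
      "narr s' = (if 0 < g u then narr s
        else (narr s)(a_queue := (narr s a_queue)(nreg s n_tail := u)))"
      "\<forall>x. x \<noteq> r_du \<and> x \<noteq> r_val \<longrightarrow> rreg s' x = rreg s x" "clock s' \<le> clock s + 12"
    proof -
      have "rarr (tick 1 s) b_res (B + n + u) = g u" using inv u g'S by (simp add: Inv_def tick_def k_def)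
      moreover have "narr (tick 1 s) a_idx (nreg (tick 1 s) n_j) = u" "nreg (tick 1 s) n_dim = n"
        "nreg (tick 1 s) n_base + n + u = B + n + u"
        using inv ix[of k] jl dim B by (simp_all add: Inv_def tick_def k_def u_def)
      note entry_effect[OF this(1) u(1) this(2,3)]
      ultimately show ?thesis using that unfolding val by (fastforce simp: tick_def k_def)
    qed
    have bij: "bij_betw (narr s' a_queue) {e..<nreg s' n_tail} (supp (g' (Suc k)))"
    proof (cases "0 < g u")
      case True
      then have "supp (g' (Suc k)) = supp (g' k)"
        using pos g'S u(1) by (auto simp: supp_def)
      then show ?thesis using True inv s'(2,4) by (simp add: Inv_def k_def)
    next
      case False
      then have "supp (g' (Suc k)) = insert u (supp (g' k))" "u \<notin> supp (g' k)"
        using pos g'S u(1) by (auto simp: supp_def)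
      moreover have "e \<le> nreg s n_tail" using inv q by (simp add: Inv_def)
      moreover have "bij_betw (narr s' a_queue) {e..<nreg s n_tail} (supp (g' k))"
        using inv False s'(4) bij_betw_cong[of "{e..<nreg s n_tail}" "narr s' a_queue" "narr s a_queue"]
        by (simp add: Inv_def k_def)
      moreover have "narr s' a_queue (nreg s n_tail) = u" using s'(4) False by simp
      ultimately show ?thesis using s'(2) False
        by (auto simp: atLeastLessThanSuc bij_betw_def)
    qed
    have "Inv s'" unfolding Inv_def
    proof (intro conjI)
      show "\<forall>u<n. rarr s' b_res (B + n + u) = g' (nreg s' n_j) u"
        using inv s'(2,3) g'S by (auto simp: Inv_def k_def)
      show "bij_betw (narr s' a_queue) {e..<nreg s' n_tail} (supp (g' (nreg s' n_j)))"
        using bij s'(2) by simp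
      show "\<forall>i<nreg s0 n_tail. narr s' a_queue i = narr s0 a_queue i"
        using inv s'(4) by (auto simp: Inv_def)
      show "clock s' \<le> clock s0 + 12 * nreg s' n_j"
        using inv s'(2,6) by (simp add: Inv_def k_def)
    qed (use inv s' jl u(1) in \<open>auto simp: Inv_def k_def\<close>)
    then show "surely (exec I entry_code (tick 1 s)) (\<lambda>s'. Inv s' \<and> length (cl v) - nreg s' n_j < length (cl v) - nreg s n_j)"
      using s'(1,2) jl by (simp add: k_def)
  next
    fix s assume inv: "Inv s" and "\<not> bval s (NLess (NReg n_j) (NReg n_deg))"
    then have jl: "nreg s n_j = length (cl v)" using deg by (simp add: Inv_def)
    have "supp (g' (length (cl v))) = supp (\<lambda>u. g u + walk_prob M u v * x)"
      using g'_len by (auto simp: supp_def)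
    then show "?Q (tick 1 s)" using inv jl g'_len cl_props(3)[OF v(2)]
      by (simp add: Inv_def tick_def)
  qed
qed

lemma push_effect:
  assumes v: "nreg s0 n_v = v" "v < n" and dim: "nreg s0 n_dim = n" and B: "nreg s0 n_base = B"
    and x: "rreg s0 r_x = x" "0 < x"
    and g: "\<And>u. u < n \<Longrightarrow> rarr s0 b_res (B + n + u) = g u \<and> 0 \<le> g u"
    and q: "e \<le> nreg s0 n_tail" "bij_betw (narr s0 a_queue) {e..<nreg s0 n_tail} (supp g)"
  shows "surely (exec I push_code s0) (\<lambda>s.
    (\<forall>x. x \<notin> {n_tail, n_deg, n_u, n_pos, n_j} \<longrightarrow> nreg s x = nreg s0 x) \<and>
    (\<forall>x. x \<notin> {r_du, r_val, r_t, r_res} \<longrightarrow> rreg s x = rreg s0 x) \<and>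
    rreg s r_res = rreg s0 r_res + t $ v * x \<and>
    rarr s b_kept = rarr s0 b_kept \<and>
    (\<forall>i<nreg s0 n_tail. narr s a_queue i = narr s0 a_queue i) \<and>
    nreg s0 n_tail \<le> nreg s n_tail \<and>
    (\<forall>i. i < B + n \<or> B + n + n \<le> i \<longrightarrow> rarr s b_res i = rarr s0 b_res i) \<and>
    (\<forall>u<n. rarr s b_res (B + n + u) = g u + walk_prob M u v * x) \<and>
    bij_betw (narr s a_queue) {e..<nreg s n_tail} (supp (\<lambda>u. g u + walk_prob M u v * x)) \<and>
    clock s \<le> clock s0 + 13 * col_nnz v + 5)"
proof -
  \<comment> \<open>The state on entering the loop. Its \<open>4 + length (cl v)\<close> ticks and
    the 12 per entry plus 1 of the loop make up \<open>13 * col_nnz v + 5\<close>.\<close>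
  define s1 where "s1 = s0\<lparr>
    nreg := (nreg s0)(n_deg := length (cl v), n_j := 0),
    rreg := (rreg s0)(r_t := t $ v, r_res := rreg s0 r_res + t $ v * x),
    narr := (narr s0)(a_idx := load_list (cl v) (narr s0 a_idx)),
    rarr := (rarr s0)(b_col := load_list (map (\<lambda>u. M $$ (u, v)) (cl v)) (rarr s0 b_col)),
    clock := clock s0 + (4 + length (cl v))\<rparr>"
  have "exec I push_code s0 = exec I (While (NLess (NReg n_j) (NReg n_deg)) entry_code) s1"
    using v x unfolding s1_def
    by (simp add: push_code_def Let_def state_ops del: exec.simps(8))
      (intro arg_cong[of _ _ "exec I _"] state.equality; simp add: fun_upd_twist)
  moreover have "surely (exec I (While (NLess (NReg n_j) (NReg n_deg)) entry_code) s1) (\<lambda>s.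
    (\<forall>x. x \<notin> {n_tail, n_u, n_pos, n_j} \<longrightarrow> nreg s x = nreg s1 x) \<and>
    (\<forall>x. x \<notin> {r_du, r_val} \<longrightarrow> rreg s x = rreg s1 x) \<and>
    rarr s b_kept = rarr s1 b_kept \<and>
    (\<forall>i<nreg s1 n_tail. narr s a_queue i = narr s1 a_queue i) \<and>
    nreg s1 n_tail \<le> nreg s n_tail \<and>
    (\<forall>i. i < B + n \<or> B + n + n \<le> i \<longrightarrow> rarr s b_res i = rarr s1 b_res i) \<and>
    (\<forall>u<n. rarr s b_res (B + n + u) = g u + walk_prob M u v * x) \<and>
    bij_betw (narr s a_queue) {e..<nreg s n_tail} (supp (\<lambda>u. g u + walk_prob M u v * x)) \<and>
    clock s \<le> clock s1 + 12 * col_nnz v + 1)"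
    by (rule entry_loop) (use v dim B x g q in \<open>simp_all add: s1_def load_list_def\<close>)
  ultimately show ?thesis
    by (elim ssubst surely_mono) (auto simp: s1_def cl_props(3)[OF v(2)])
qed

text \<open>The invariant describes partial sums over the set \<open>D\<close> of vertices already
  taken from the queue. As the queue lists the support without repetition, \<open>D\<close> ends as
  the whole support and the sums become \<open>P\<close> applied to the pushed part.\<close>

lemma item_loop:
  fixes l
  defines "r \<equiv> residue h w l"
  assumes dim: "nreg s0 n_dim = n" and B: "nreg s0 n_base = l * n" and thr: "rreg s0 r_thr = h"
    and b0: "nreg s0 n_head = b0" and e: "nreg s0 n_end = e" "nreg s0 n_tail = e" "b0 \<le> e"
    and q: "bij_betw (narr s0 a_queue) {b0..<e} (supp r)"
    and r: "\<And>v. v < n \<Longrightarrow> rarr s0 b_res (l * n + v) = r v"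
    and z: "\<And>i. l * n + n \<le> i \<Longrightarrow> rarr s0 b_res i = 0"
    and k: "\<And>v. v < n \<Longrightarrow> rarr s0 b_kept v = kept h w l v" "rarr s0 b_kept n = 0"
    and res: "rreg s0 r_res = reserve h w l"
  shows "surely (exec I (While (NLess (NReg n_head) (NReg n_end)) item_code) s0) (\<lambda>s.
    (\<forall>x. x \<notin> {n_head, n_tail, n_v, n_deg, n_j, n_u, n_pos} \<longrightarrow> nreg s x = nreg s0 x) \<and>
    (\<forall>x. x \<notin> {r_x, r_du, r_val, r_t, r_res} \<longrightarrow> rreg s x = rreg s0 x) \<and>
    nreg s n_head = e \<and> e \<le> nreg s n_tail \<and>
    bij_betw (narr s a_queue) {e..<nreg s n_tail} (supp (residue h w (Suc l))) \<and>
    (\<forall>v<n. rarr s b_res (l * n + n + v) = residue h w (Suc l) v) \<and>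
    (\<forall>i\<ge>l * n + n + n. rarr s b_res i = 0) \<and>
    (\<forall>v<n. rarr s b_kept v = kept h w (Suc l) v) \<and> rarr s b_kept n = 0 \<and>
    rreg s r_res = reserve h w (Suc l) \<and>
    clock s \<le> clock s0 + 10 * card (supp r) + 13 * level_cost h w l + 1)"
    (is "surely _ ?Q")
proof -
  define a where "a = pushed h r"
  define D where "D k = narr s0 a_queue ` {b0..<k}" for k
  define g where "g k u = (\<Sum>v\<in>D k. walk_prob M u v * a v)" for k u
  define cost where "cost k = (\<Sum>v\<in>D k. if h < r v then col_nnz v else 0)" for k
  have fin [simp]: "finite (D k)" for k by (simp add: D_def)
  have a0: "0 \<le> a v" if "v < n" for v unfolding a_def r_def by (rule pushed_nonneg[OF w that])
  have De: "D e = supp r" using q by (simp add: D_def bij_betw_def)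
  \<comment> \<open>Vertices that were never queued carry nothing, so sums over the queue equal sums
    over all vertices.\<close>
  have a_out: "a v = 0" "r v = 0" if "v < n" "v \<notin> supp r" for v
    using that residue_nonneg[OF w that(1), of h l] h
    by (auto simp: a_def pushed_def supp_def r_def)
  have sum_supp: "(\<Sum>v\<in>supp r. f v * a v) = (\<Sum>v<n. f v * a v)" for f :: "nat \<Rightarrow> real"
    using a_out by (intro sum.mono_neutral_left) (auto simp: supp_def)
  define Inv where "Inv s \<longleftrightarrow>
    (\<forall>x. x \<notin> {n_head, n_tail, n_v, n_deg, n_j, n_u, n_pos} \<longrightarrow> nreg s x = nreg s0 x) \<and>
    (\<forall>x. x \<notin> {r_x, r_du, r_val, r_t, r_res} \<longrightarrow> rreg s x = rreg s0 x) \<and>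
    b0 \<le> nreg s n_head \<and> nreg s n_head \<le> e \<and> e \<le> nreg s n_tail \<and>
    (\<forall>i<e. narr s a_queue i = narr s0 a_queue i) \<and>
    bij_betw (narr s a_queue) {e..<nreg s n_tail} (supp (g (nreg s n_head))) \<and>
    (\<forall>v<n. rarr s b_res (l * n + v) = r v) \<and>
    (\<forall>v<n. rarr s b_res (l * n + n + v) = g (nreg s n_head) v) \<and>
    (\<forall>i\<ge>l * n + n + n. rarr s b_res i = 0) \<and>
    (\<forall>v<n. rarr s b_kept v = kept h w l v + (if v \<in> D (nreg s n_head) then r v - a v else 0)) \<and>
    rarr s b_kept n = 0 \<and>
    rreg s r_res = reserve h w l + (\<Sum>v\<in>D (nreg s n_head). t $ v * a v) \<and>
    clock s \<le> clock s0 + 10 * (nreg s n_head - b0) + 13 * cost (nreg s n_head)" for s :: state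
  show ?thesis unfolding exec.simps
  proof (rule surely_while[where Inv = Inv and f = "\<lambda>s. e - nreg s n_head"])
    have "D b0 = {}" by (simp add: D_def)
    moreover have "supp (g b0) = {}" by (simp add: supp_def g_def \<open>D b0 = {}\<close>)
    ultimately show "Inv s0" using b0 e r z k res by (simp add: Inv_def g_def cost_def add.assoc bij_betw_def)
  next
    fix s assume inv: "Inv s" and "bval s (NLess (NReg n_head) (NReg n_end))"
    then have i_lt: "nreg s n_head < e" using e by (simp add: Inv_def)
    define i where "i = nreg s n_head"
    define v where "v = narr s0 a_queue i"
    have i: "b0 \<le> i" "i < e" using inv i_lt by (auto simp: Inv_def i_def)
    have vs: "v \<in> supp r" using q i by (auto simp: v_def bij_betw_def)
    then have v: "v < n" "0 < r v" by (auto simp: supp_def)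
    have vD: "v \<notin> D i"
      using q i unfolding v_def D_def bij_betw_def inj_on_def by fastforce
    have DS: "D (Suc i) = insert v (D i)"
      using i by (auto simp: D_def v_def atLeastLessThanSuc)
    have gS: "g (Suc i) u = g i u + walk_prob M u v * a v" for u
      using vD by (simp add: g_def DS)
    have D_sub: "D i \<subseteq> {..<n}" using De i by (auto simp: D_def supp_def)
    have g0: "0 \<le> g i u" if "u < n" for u
      unfolding g_def using D_sub a0 walk_prob_nonneg[OF that] by (intro sum_nonneg mult_nonneg_nonneg) auto
    have costS: "cost (Suc i) = cost i + (if h < r v then col_nnz v else 0)"
      using vD by (simp add: cost_def DS)
    \<comment> \<open>Five ticks: loop test, three assignments, branch. With the fixed 5 of a push
      this gives the 10 per item.\<close>
    define s1 where "s1 = s\<lparr>rreg := (rreg s)(r_x := r v), nreg := (nreg s)(n_v := v, n_head := Suc i),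
      clock := Suc (Suc (Suc (Suc (Suc (clock s)))))\<rparr>"
    have s_vals: "narr s a_queue i = v" "nreg s n_base = l * n" "rarr s b_res (l * n + v) = r v" "rreg s r_thr = h"
      using inv i v B thr by (auto simp: Inv_def v_def)
    have ex: "exec I item_code (tick 1 s) = (if h < r v then exec I push_code s1
        else exec I (PutR b_kept (NReg n_v) (RAdd (RArr b_kept (NReg n_v)) (RReg r_x))) s1)"
      using s_vals by (simp add: item_code_def state_ops s1_def i_def[symmetric])
    have "surely (exec I item_code (tick 1 s)) (\<lambda>s'. Inv s' \<and> nreg s' n_head = Suc i)"
    proof (cases "h < r v")
      case True
      then have av: "a v = r v" by (simp add: a_def pushed_def)
      have "surely (exec I push_code s1) (\<lambda>s'.
        (\<forall>x. x \<notin> {n_tail, n_deg, n_u, n_pos, n_j} \<longrightarrow> nreg s' x = nreg s1 x) \<and>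
        (\<forall>x. x \<notin> {r_du, r_val, r_t, r_res} \<longrightarrow> rreg s' x = rreg s1 x) \<and>
        rreg s' r_res = rreg s1 r_res + t $ v * r v \<and>
        rarr s' b_kept = rarr s1 b_kept \<and>
        (\<forall>i<nreg s1 n_tail. narr s' a_queue i = narr s1 a_queue i) \<and>
        nreg s1 n_tail \<le> nreg s' n_tail \<and>
        (\<forall>i. i < l * n + n \<or> l * n + n + n \<le> i \<longrightarrow> rarr s' b_res i = rarr s1 b_res i) \<and>
        (\<forall>u<n. rarr s' b_res (l * n + n + u) = g i u + walk_prob M u v * r v) \<and>
        bij_betw (narr s' a_queue) {e..<nreg s' n_tail} (supp (\<lambda>u. g i u + walk_prob M u v * r v)) \<and>
        clock s' \<le> clock s1 + 13 * col_nnz v + 5)"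
        by (rule push_effect)
          (use inv v dim B g0 in \<open>simp_all add: Inv_def s1_def i_def\<close>)
      moreover have "supp (\<lambda>u. g i u + walk_prob M u v * r v) = supp (g (Suc i))"
        by (simp add: supp_def gS av)
      ultimately have "surely (exec I push_code s1) (\<lambda>s'. Inv s' \<and> nreg s' n_head = Suc i)"
        using inv i vD by (elim surely_mono)
          (auto simp: Inv_def s1_def i_def[symmetric] gS[unfolded av] av DS costS True)
      then show ?thesis using True ex by simp
    next
      case False
      then have av: "a v = 0" by (simp add: a_def pushed_def)
      have "g (Suc i) = g i" by (simp add: gS av fun_eq_iff)
      then show ?thesis using False ex inv i vD v
        by (auto simp: Inv_def s1_def i_def[symmetric] state_ops DS costS av)
    qed
    then show "surely (exec I item_code (tick 1 s)) (\<lambda>s'. Inv s' \<and> e - nreg s' n_head < e - nreg s n_head)"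
      by (rule surely_mono) (use i in \<open>simp add: i_def[symmetric]\<close>)
  next
    fix s assume inv: "Inv s" and "\<not> bval s (NLess (NReg n_head) (NReg n_end))"
    then have he: "nreg s n_head = e" using e by (simp add: Inv_def)
    have "g e = walk_op a" by (simp add: g_def De sum_supp walk_op_def fun_eq_iff)
    then have "g e = residue h w (Suc l)" by (simp add: a_def r_def)
    moreover have "kept h w l v + (if v \<in> D e then r v - a v else 0) = kept h w (Suc l) v" if "v < n" for v
      using a_out[OF that] by (simp add: De kept_Suc a_def r_def)
    moreover have "(\<Sum>v\<in>D e. t $ v * a v) = t_dot a" by (simp add: De sum_supp t_dot_def)
    then have "reserve h w l + (\<Sum>v\<in>D e. t $ v * a v) = reserve h w (Suc l)"
      by (simp add: reserve_def a_def r_def)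
    moreover have "card (supp r) = e - b0" using bij_betw_same_card[OF q] by simp
    moreover have "cost e = level_cost h w l"
      unfolding cost_def De level_cost_def r_def using h
      by (intro sum.mono_neutral_cong_right) (auto simp: supp_def)
    ultimately show "?Q (tick 1 s)" using inv he by (simp add: Inv_def tick_def)
  qed
qed

text \<open>The zeros beyond the current row let the next level accumulate without clearing. The
  zero at position \<open>n\<close> of \<open>b_kept\<close> is what a terminated walk will
  read.\<close>

definition level_inv :: "nat \<Rightarrow> state \<Rightarrow> bool" where
  "level_inv l s \<longleftrightarrow> nreg s n_dim = n \<and> nreg s n_lvl = l \<and> nreg s n_base = l * n \<and> rreg s r_thr = h \<and>
    nreg s n_head \<le> nreg s n_tail \<and>
    bij_betw (narr s a_queue) {nreg s n_head..<nreg s n_tail} (supp (residue h w l)) \<and>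
    (\<forall>v<n. rarr s b_res (l * n + v) = residue h w l v) \<and> (\<forall>i\<ge>l * n + n. rarr s b_res i = 0) \<and>
    (\<forall>v<n. rarr s b_kept v = kept h w l v) \<and> rarr s b_kept n = 0 \<and> rreg s r_res = reserve h w l"

text \<open>Amortised count: 10 ticks per queued vertex and 4 of overhead are at most 14 per vertex,
  the queue being nonempty. Of the 28 per column entry, 13 are spent now and 15 are saved for a
  vertex queued next: 14 for its level and one towards the test of the outer loop.\<close>

lemma level_effect:
  assumes inv: "level_inv l s0" and ne: "nreg s0 n_head < nreg s0 n_tail"
  shows "surely (exec I level_code s0) (\<lambda>s. level_inv (Suc l) s \<and>
    (\<forall>x. x < n_lvl \<or> n_pos < x \<longrightarrow> nreg s x = nreg s0 x) \<and>
    (\<forall>x. x < r_res \<or> r_t < x \<longrightarrow> rreg s x = rreg s0 x) \<and>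
    clock s + 15 * card (supp (residue h w (Suc l))) \<le>
      clock s0 + 14 * card (supp (residue h w l)) + 28 * level_cost h w l)"
proof -
  define s1 where "s1 = tick 1 (set_nreg n_end (nreg s0 n_tail) s0)"
  have "card (supp (residue h w l)) = nreg s0 n_tail - nreg s0 n_head"
    using bij_betw_same_card[of _ _ "supp (residue h w l)"] inv by (fastforce simp: level_inv_def)
  then have card: "1 \<le> card (supp (residue h w l))" using ne by simp
  have "surely (exec I (While (NLess (NReg n_head) (NReg n_end)) item_code) s1) (\<lambda>s.
    (\<forall>x. x \<notin> {n_head, n_tail, n_v, n_deg, n_j, n_u, n_pos} \<longrightarrow> nreg s x = nreg s1 x) \<and>
    (\<forall>x. x \<notin> {r_x, r_du, r_val, r_t, r_res} \<longrightarrow> rreg s x = rreg s1 x) \<and>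
    nreg s n_head = nreg s0 n_tail \<and> nreg s0 n_tail \<le> nreg s n_tail \<and>
    bij_betw (narr s a_queue) {nreg s0 n_tail..<nreg s n_tail} (supp (residue h w (Suc l))) \<and>
    (\<forall>v<n. rarr s b_res (l * n + n + v) = residue h w (Suc l) v) \<and>
    (\<forall>i\<ge>l * n + n + n. rarr s b_res i = 0) \<and>
    (\<forall>v<n. rarr s b_kept v = kept h w (Suc l) v) \<and> rarr s b_kept n = 0 \<and>
    rreg s r_res = reserve h w (Suc l) \<and>
    clock s \<le> clock s1 + 10 * card (supp (residue h w l)) + 13 * level_cost h w l + 1)"
    by (rule item_loop) (use inv ne in \<open>auto simp: level_inv_def s1_def state_ops\<close>)
  then have "surely (exec I (While (NLess (NReg n_head) (NReg n_end)) item_code) s1) (\<lambda>s.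
      surely (exec I (block [SetN n_base (NAdd (NReg n_base) (NReg n_dim)), incr n_lvl]) s) (\<lambda>s.
        level_inv (Suc l) s \<and>
        (\<forall>x. x < n_lvl \<or> n_pos < x \<longrightarrow> nreg s x = nreg s0 x) \<and>
        (\<forall>x. x < r_res \<or> r_t < x \<longrightarrow> rreg s x = rreg s0 x) \<and>
        clock s + 15 * card (supp (residue h w (Suc l))) \<le>
          clock s0 + 14 * card (supp (residue h w l)) + 28 * level_cost h w l))"
    using inv card card_supp_residue_Suc[OF h, of w l]
    by (elim surely_mono) (auto simp: level_inv_def s1_def state_ops algebra_simps simp del: residue.simps)
  then show ?thesis
    by (simp add: level_code_def s1_def del: residue.simps exec.simps(8))
qed

text \<open>A level costs a constant per queued vertex and per entry of a pushed column, and the vertices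
  queued for the next level are paid for by the columns pushed at this one.\<close>
lemma levels_effect:
  assumes inv: "level_inv 0 s0" and len: "nreg s0 n_len = L"
  shows "surely (exec I levels_code s0) (\<lambda>s.
    (\<forall>x. x < n_lvl \<or> n_pos < x \<longrightarrow> nreg s x = nreg s0 x) \<and>
    (\<forall>x. x < r_res \<or> r_t < x \<longrightarrow> rreg s x = rreg s0 x) \<and>
    (\<forall>v<n. rarr s b_kept v = kept h w L v) \<and> rarr s b_kept n = 0 \<and> rreg s r_res = reserve h w L \<and>
    clock s \<le> clock s0 + 28 * (\<Sum>l<L. level_cost h w l) + 16)"
    (is "surely _ ?Q")
proof -
  define Inv where "Inv s \<longleftrightarrow> level_inv (nreg s n_lvl) s \<and> nreg s n_lvl \<le> L \<and>
    (\<forall>x. x < n_lvl \<or> n_pos < x \<longrightarrow> nreg s x = nreg s0 x) \<and>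
    (\<forall>x. x < r_res \<or> r_t < x \<longrightarrow> rreg s x = rreg s0 x) \<and>
    clock s + 15 * card (supp (residue h w (nreg s n_lvl))) \<le>
      clock s0 + 15 + 28 * (\<Sum>l<nreg s n_lvl. level_cost h w l)" for s :: state
  show ?thesis unfolding levels_code_def exec.simps
  proof (rule surely_while[where Inv = Inv and f = "\<lambda>s. L - nreg s n_lvl"])
    \<comment> \<open>Level 0 has at most one queued vertex; its credit is the 15 granted at the
      start.\<close>
    have "supp (point w) \<subseteq> {w}" by (auto simp: supp_def point_def)
    then have "card (supp (point w)) \<le> 1" using card_mono[of "{w}" "supp (point w)"] by simp
    moreover have "nreg s0 n_lvl = 0" using inv by (simp add: level_inv_def)
    ultimately show "Inv s0" using inv by (simp add: Inv_def)
  next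
    fix s assume i: "Inv s" and "bval s (BAnd (NLess (NReg n_head) (NReg n_tail)) (NLess (NReg n_lvl) (NReg n_len)))"
    then have b: "nreg s n_head < nreg s n_tail" "nreg s n_lvl < L" using len by (auto simp: Inv_def)
    have "level_inv (nreg s n_lvl) (tick 1 s)" using i by (simp add: Inv_def level_inv_def tick_def)
    from level_effect[OF this]
    have "surely (exec I level_code (tick 1 s)) (\<lambda>s'. level_inv (Suc (nreg s n_lvl)) s' \<and>
      (\<forall>x. x < n_lvl \<or> n_pos < x \<longrightarrow> nreg s' x = nreg (tick 1 s) x) \<and>
      (\<forall>x. x < r_res \<or> r_t < x \<longrightarrow> rreg s' x = rreg (tick 1 s) x) \<and>
      clock s' + 15 * card (supp (residue h w (Suc (nreg s n_lvl)))) \<le>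
      clock (tick 1 s) + 14 * card (supp (residue h w (nreg s n_lvl))) + 28 * level_cost h w (nreg s n_lvl))"
      using b by (simp add: tick_def)
    moreover have "card (supp (residue h w (nreg s n_lvl))) = nreg s n_tail - nreg s n_head"
      using bij_betw_same_card[of _ _ "supp (residue h w (nreg s n_lvl))"] i by (fastforce simp: Inv_def level_inv_def)
    ultimately show "surely (exec I level_code (tick 1 s)) (\<lambda>s'. Inv s' \<and> L - nreg s' n_lvl < L - nreg s n_lvl)"
      using i b by (elim surely_mono) (auto simp: Inv_def level_inv_def tick_def simp del: residue.simps)
  next
    fix s assume i: "Inv s"
      and "\<not> bval s (BAnd (NLess (NReg n_head) (NReg n_tail)) (NLess (NReg n_lvl) (NReg n_len)))"
    then have "nreg s n_tail \<le> nreg s n_head \<or> nreg s n_lvl = L" using len by (auto simp: Inv_def)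
    moreover have "nreg s n_lvl = L \<or> supp (residue h w (nreg s n_lvl)) = {}"
      if "nreg s n_tail \<le> nreg s n_head"
      using i that by (auto simp: Inv_def level_inv_def bij_betw_def)
    ultimately have stop: "nreg s n_lvl = L \<or> supp (residue h w (nreg s n_lvl)) = {}" by blast
    have le: "nreg s n_lvl \<le> L" using i by (simp add: Inv_def)
    have "reserve h w L = reserve h w (nreg s n_lvl)"
      using stop reserve_after[OF w h _ le] by auto
    moreover have "kept h w L v = kept h w (nreg s n_lvl) v" if "v < n" for v
      using stop kept_after[OF w h _ le that] by auto
    moreover have "(\<Sum>l<nreg s n_lvl. level_cost h w l) \<le> (\<Sum>l<L. level_cost h w l)"
      using le by (intro sum_mono2) auto
    ultimately show "?Q (tick 1 s)" using i by (auto simp: Inv_def level_inv_def tick_def)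
  qed
qed

end

section \<open>The sampling phase and the whole program\<close>

text \<open>\<open>r_bal\<close> is the square of the balanced threshold: it comes from equating
  \<open>L * nnz M / (n * \<theta>)\<close> with the sampling cost, which is of order \<open>norm_p
  1 t * L^3 * f_row * \<theta> / (\<epsilon>^2 * \<eta>)\<close>. Comparing squares replaces the
  root.\<close>

definition theta_code :: com where
  "theta_code = block [
     SetR r_bal (RDiv (RMul (RMul (RReg r_eta) (RMul (RReg r_eps) (RReg r_eps))) (OfNat (NReg n_nnz)))
       (RMul (RMul (OfNat (NReg n_dim)) (OfNat (NReg n_frow)))
         (RMul (RMul (OfNat (NReg n_len)) (OfNat (NReg n_len))) (RReg r_norm)))),
     SetR r_theta (RNum 1),
     While (RLess (RReg r_bal) (RMul (RReg r_theta) (RReg r_theta)))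
       (SetR r_theta (RDiv (RReg r_theta) (RNum 2)))]"

definition init_code :: com where
  "init_code = block [
     SetR r_thr (RDiv (RReg r_theta) (RReg r_diag)),
     PutN a_queue (NConst 0) (NReg n_src),
     SetN n_tail (NConst 1),
     PutR b_res (NReg n_src) (RDiv (RNum 1) (RReg r_diag))]"

definition walk_code :: com where
  "walk_code = While (NLess (NReg n_k) (NReg n_len)) (block [
     SetR r_sum (RAdd (RReg r_sum) (RArr b_kept (NReg n_walk))),
     WalkStep n_walk (NReg n_walk),
     incr n_k])"

definition sample_code :: com where
  "sample_code = block [SampleT n_walk, SetN n_k (NConst 0), walk_code, incr n_i]"

text \<open>If less than one sample is called for, none is drawn: the kept residue is then negligible, and
  the final quotient has the value \<open>0 / 0 = 0\<close>.\<close>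
definition estimate_code :: com where
  "estimate_code = block [
     SetR r_num (RDiv (RMul (RMul (RNum 8) (RReg r_norm))
         (RMul (RMul (OfNat (NReg n_len)) (OfNat (NReg n_len))) (RReg r_theta)))
       (RMul (RMul (RReg r_eps) (RReg r_eps)) (RReg r_eta))),
     Cond (RLess (RReg r_num) (RNum 1)) Skip
       (While (RLess (OfNat (NReg n_i)) (RReg r_num)) sample_code),
     SetR 0 (RDiv (RAdd (RReg r_res) (RDiv (RMul (RReg r_norm) (RReg r_sum)) (OfNat (NReg n_i)))) (RNum 2))]"

text \<open>If \<open>\<epsilon>\<^sup>2 \<ge> d\<^sub>w\<close>, the permitted error is at least the quantity to be estimated.\<close>
definition solver_code :: com where
  "solver_code = Seq (GetDiag r_diag (NReg n_src))
     (Cond (RLess (RMul (RReg r_eps) (RReg r_eps)) (RReg r_diag))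
       (block [theta_code, init_code, levels_code, estimate_code])
       (SetR 0 (RNum 0)))"

text \<open>Halving \<open>\<theta>\<close> quarters its square. The search starts at 1, where
  \<open>level_cost_eq_0\<close> already excludes any push.\<close>

definition halvings :: "real \<Rightarrow> nat" where
  "halvings bal = (LEAST j. (1 / 4) ^ j \<le> bal)"

lemma halvings_le: "0 < bal \<Longrightarrow> (1 / 4) ^ halvings bal \<le> bal"
proof -
  assume "0 < bal"
  then obtain j where "(1 / 4 :: real) ^ j < bal"
    using real_arch_pow_inv[of bal "1/4"] by auto
  then show ?thesis unfolding halvings_def by (rule LeastI[of "\<lambda>j. (1 / 4) ^ j \<le> bal", OF less_imp_le])
qed

lemma less_halvings: "i < halvings bal \<Longrightarrow> bal < (1 / 4) ^ i"
  unfolding halvings_def by (drule not_less_Least) simp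

lemma theta_effect:
  assumes bal: "bal = rreg s0 r_eta * (rreg s0 r_eps * rreg s0 r_eps) * real (nreg s0 n_nnz) /
      (real (nreg s0 n_dim) * real (nreg s0 n_frow) * (real (nreg s0 n_len) * real (nreg s0 n_len) * rreg s0 r_norm))"
    and pos: "0 < bal"
  shows "surely (exec I theta_code s0) (\<lambda>s. nreg s = nreg s0 \<and> narr s = narr s0 \<and> rarr s = rarr s0 \<and>
    (\<forall>x. x \<noteq> r_bal \<and> x \<noteq> r_theta \<longrightarrow> rreg s x = rreg s0 x) \<and>
    rreg s r_theta = (1 / 2) ^ halvings bal \<and> clock s = clock s0 + 2 * halvings bal + 3)"
    (is "surely _ ?Q")
proof -
  define s1 where "s1 = s0\<lparr>rreg := (rreg s0)(r_bal := bal, r_theta := 1), clock := Suc (Suc (clock s0))\<rparr>"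
  define Inv where "Inv s \<longleftrightarrow> nreg s = nreg s0 \<and> narr s = narr s0 \<and> rarr s = rarr s0 \<and>
    (\<forall>x. x \<noteq> r_bal \<and> x \<noteq> r_theta \<longrightarrow> rreg s x = rreg s0 x) \<and> rreg s r_bal = bal \<and>
    (\<exists>i\<le>halvings bal. rreg s r_theta = (1 / 2) ^ i \<and> clock s = clock s0 + 2 + 2 * i)" for s :: state
  have sq: "(1 / 2) ^ i * (1 / 2) ^ i = (1 / 4 :: real) ^ i" for i
    by (simp add: power_mult_distrib[symmetric])
  have "exec I theta_code s0 = exec I (While (RLess (RReg r_bal) (RMul (RReg r_theta) (RReg r_theta)))
       (SetR r_theta (RDiv (RReg r_theta) (RNum 2)))) s1"
    by (simp add: theta_code_def state_ops s1_def bal del: exec.simps(8))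
  moreover have "surely \<dots> ?Q"
    unfolding exec.simps(8)
  \<comment> \<open>No register counts the halvings, so the clock serves as the variant.\<close>
  proof (rule surely_while[where Inv = Inv and f = "\<lambda>s. clock s0 + 2 + 2 * halvings bal - clock s"])
    show "Inv s1" by (auto simp: Inv_def s1_def intro!: exI[of _ 0])
  next
    fix s assume inv: "Inv s" and b: "bval s (RLess (RReg r_bal) (RMul (RReg r_theta) (RReg r_theta)))"
    then obtain i where i: "i \<le> halvings bal" "rreg s r_theta = (1 / 2) ^ i" "clock s = clock s0 + 2 + 2 * i"
      by (auto simp: Inv_def)
    have "bal < (1 / 4) ^ i" using b inv i by (simp add: Inv_def sq)
    then have "i \<noteq> halvings bal" using halvings_le[OF pos] by auto
    then have "i < halvings bal" using i by simp
    then show "surely (exec I (SetR r_theta (RDiv (RReg r_theta) (RNum 2))) (tick 1 s)) (\<lambda>s'. Inv s' \<and>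
        clock s0 + 2 + 2 * halvings bal - clock s' < clock s0 + 2 + 2 * halvings bal - clock s)"
      using inv i by (auto simp: Inv_def state_ops intro!: exI[of _ "Suc i"])
  next
    fix s assume inv: "Inv s" and b: "\<not> bval s (RLess (RReg r_bal) (RMul (RReg r_theta) (RReg r_theta)))"
    then obtain i where i: "i \<le> halvings bal" "rreg s r_theta = (1 / 2) ^ i" "clock s = clock s0 + 2 + 2 * i"
      by (auto simp: Inv_def)
    have "(1 / 4) ^ i \<le> bal" using b inv i by (simp add: Inv_def sq)
    then have "i = halvings bal" using i(1) less_halvings[of i bal] by force
    then show "?Q (tick 1 s)" using inv i by (simp add: Inv_def tick_def)
  qed
  ultimately show ?thesis by simp
qed

section \<open>Couplings of the sampling loops with sums of independent walks\<close>

context push_run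
begin

lemma step_time_le: "v < n \<Longrightarrow> st v \<le> f_row M st"
  by (auto simp: f_row_def intro!: Max_ge)

lemma f_row_pos: "1 \<le> f_row M st"
  using valid w step_time_le[OF w] by (force simp: valid_access_def)

text \<open>From here on runs are random, and the judgement is a coupling: each final state is
  paired with the sampled value it represents, and the time bound holds in every pair.\<close>

lemma walk_step_effect:
  "rel_spmf (\<lambda>s' u. u \<le> n \<and> (\<exists>k\<le>f_row M st. s' = tick k (set_nreg n_walk u s)))
    (exec I (WalkStep n_walk (NReg n_walk)) s) (spmf_of_pmf (walk_step (nreg s n_walk)))"
proof (cases "nreg s n_walk < n")
  case True
  then show ?thesis
    using step_time_le[OF True] set_walk_step[of "nreg s n_walk"]
    by (auto simp: Let_def pmf.rel_map walk_step_def intro!: rel_pmf_reflI)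
next
  case False
  then show ?thesis using f_row_pos by (auto simp: walk_step_def)
qed

text \<open>Each round takes the step time, at most \<open>f_row M st\<close>, and 3 ticks for the
  loop test, the addition and the counter.\<close>

lemma walk_effect:
  assumes "nreg s n_k + m = nreg s n_len" "nreg s n_walk \<le> n" "\<And>v. v \<le> n \<Longrightarrow> rarr s b_kept v = R v"
  shows "rel_spmf (\<lambda>s' x. rreg s' r_sum = rreg s r_sum + x \<and>
      (\<forall>y. y \<noteq> r_sum \<longrightarrow> rreg s' y = rreg s y) \<and> (\<forall>y. y \<notin> {n_walk, n_k} \<longrightarrow> nreg s' y = nreg s y) \<and>
      rarr s' = rarr s \<and> clock s' \<le> clock s + m * (f_row M st + 3) + 1)
    (exec I walk_code s) (spmf_of_pmf (walk_sum R m (nreg s n_walk)))"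
  using assms
proof (induction m arbitrary: s)
  case 0
  then show ?case unfolding walk_code_def exec.simps(8)
    by (subst while_loop.simps) (simp add: tick_def)
next
  case (Suc m)
  let ?v = "nreg s n_walk"
  define s1 where "s1 = s\<lparr>rreg := (rreg s)(r_sum := rreg s r_sum + R ?v), clock := Suc (Suc (clock s))\<rparr>"
  have ex: "exec I walk_code s = bind_spmf (exec I (WalkStep n_walk (NReg n_walk)) s1)
      (\<lambda>s2. exec I walk_code (tick 1 (set_nreg n_k (Suc (nreg s2 n_k)) s2)))"
    using Suc.prems unfolding walk_code_def exec.simps(8)
    by (subst while_loop.simps) (simp add: s1_def state_ops del: exec.simps(16))
  have sp: "spmf_of_pmf (walk_sum R (Suc m) ?v) =
      bind_spmf (spmf_of_pmf (walk_step ?v)) (\<lambda>u. map_spmf ((+) (R ?v)) (spmf_of_pmf (walk_sum R m u)))"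
    by (simp add: spmf_of_pmf_bind)
  have "nreg s1 n_walk = ?v" by (simp add: s1_def)
  show ?case unfolding ex sp
  proof (rule rel_spmf_bindI[OF walk_step_effect[of s1, unfolded \<open>nreg s1 n_walk = ?v\<close>]])
    fix s2 u assume "u \<le> n \<and> (\<exists>k\<le>f_row M st. s2 = tick k (set_nreg n_walk u s1))"
    then obtain k where k: "u \<le> n" "k \<le> f_row M st" "s2 = tick k (set_nreg n_walk u s1)" by blast
    define s3 where "s3 = tick 1 (set_nreg n_k (Suc (nreg s2 n_k)) s2)"
    have s3: "nreg s3 n_walk = u" "nreg s3 n_k + m = nreg s3 n_len" "rreg s3 = rreg s1" "rarr s3 = rarr s"
      "\<forall>y. y \<notin> {n_walk, n_k} \<longrightarrow> nreg s3 y = nreg s y" "clock s3 \<le> clock s + f_row M st + 3"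
      using k Suc.prems by (simp_all add: s3_def s1_def state_ops)
    have "rel_spmf (\<lambda>s' x. rreg s' r_sum = rreg s3 r_sum + x \<and>
      (\<forall>y. y \<noteq> r_sum \<longrightarrow> rreg s' y = rreg s3 y) \<and> (\<forall>y. y \<notin> {n_walk, n_k} \<longrightarrow> nreg s' y = nreg s3 y) \<and>
      rarr s' = rarr s3 \<and> clock s' \<le> clock s3 + m * (f_row M st + 3) + 1)
      (exec I walk_code s3) (spmf_of_pmf (walk_sum R m u))"
      using Suc.IH[of s3] s3 k Suc.prems(3) by simp
    then show "rel_spmf (\<lambda>s' x. rreg s' r_sum = rreg s r_sum + x \<and>
        (\<forall>y. y \<noteq> r_sum \<longrightarrow> rreg s' y = rreg s y) \<and> (\<forall>y. y \<notin> {n_walk, n_k} \<longrightarrow> nreg s' y = nreg s y) \<and>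
        rarr s' = rarr s \<and> clock s' \<le> clock s + Suc m * (f_row M st + 3) + 1)
      (exec I walk_code (tick 1 (set_nreg n_k (Suc (nreg s2 n_k)) s2)))
      (map_spmf ((+) (R ?v)) (spmf_of_pmf (walk_sum R m u)))"
      unfolding s3_def[symmetric] spmf_rel_map(2)
      by (rule rel_spmf_mono) (use s3 in \<open>auto simp: s1_def\<close>)
  qed
qed

lemma sample_effect:
  assumes "\<And>v. v \<le> n \<Longrightarrow> rarr s b_kept v = R v"
  shows "rel_spmf (\<lambda>s' x. rreg s' r_sum = rreg s r_sum + x \<and> nreg s' n_i = Suc (nreg s n_i) \<and>
      (\<forall>y. y \<noteq> r_sum \<longrightarrow> rreg s' y = rreg s y) \<and> nreg s' n_len = nreg s n_len \<and>
      rarr s' = rarr s \<and> clock s' \<le> clock s + nreg s n_len * (f_row M st + 3) + 4)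
    (exec I sample_code s) (spmf_of_pmf (walk_sample R (nreg s n_len)))"
proof -
  let ?s = "\<lambda>v. tick 2 (set_nreg n_k 0 (set_nreg n_walk v s))"
  have ex: "exec I sample_code s = bind_spmf (spmf_of_pmf (t_pmf t)) (\<lambda>v. bind_spmf (exec I walk_code (?s v)) (exec I (incr n_i)))"
    unfolding sample_code_def block.simps exec.simps map_spmf_conv_bind_spmf bind_spmf_assoc
      return_bind_spmf o_def nval.simps problem_simps
    by (simp only: state_ops) (simp add: numeral_2_eq_2 fun_upd_twist del: bind_spmf_of_pmf)
  have sp: "spmf_of_pmf (walk_sample R (nreg s n_len)) =
      bind_spmf (spmf_of_pmf (t_pmf t)) (\<lambda>v. spmf_of_pmf (walk_sum R (nreg s n_len) v))"
    by (simp add: walk_sample_def spmf_of_pmf_bind)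
  have first: "rel_spmf (\<lambda>v v'. v = v' \<and> v < n) (spmf_of_pmf (t_pmf t)) (spmf_of_pmf (t_pmf t))"
    using set_t_pmf by (auto intro!: rel_pmf_reflI)
  show ?thesis unfolding ex sp
  proof (rule rel_spmf_bindI[OF first])
    fix v v' assume "v = v' \<and> v < n"
    then have v: "v = v'" "v < n" by auto
    have "rel_spmf (\<lambda>s' x. rreg s' r_sum = rreg (?s v) r_sum + x \<and>
      (\<forall>y. y \<noteq> r_sum \<longrightarrow> rreg s' y = rreg (?s v) y) \<and> (\<forall>y. y \<notin> {n_walk, n_k} \<longrightarrow> nreg s' y = nreg (?s v) y) \<and>
      rarr s' = rarr (?s v) \<and> clock s' \<le> clock (?s v) + nreg s n_len * (f_row M st + 3) + 1)
      (exec I walk_code (?s v)) (spmf_of_pmf (walk_sum R (nreg s n_len) (nreg (?s v) n_walk)))"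
      by (rule walk_effect) (use v assms in \<open>simp_all add: state_ops\<close>)
    then have "rel_spmf (\<lambda>s' x. rreg s' r_sum = rreg s r_sum + x \<and> nreg s' n_i = Suc (nreg s n_i) \<and>
      (\<forall>y. y \<noteq> r_sum \<longrightarrow> rreg s' y = rreg s y) \<and> nreg s' n_len = nreg s n_len \<and>
      rarr s' = rarr s \<and> clock s' \<le> clock s + nreg s n_len * (f_row M st + 3) + 4)
      (bind_spmf (exec I walk_code (?s v)) (exec I (incr n_i)))
      (bind_spmf (spmf_of_pmf (walk_sum R (nreg s n_len) (nreg (?s v) n_walk))) return_spmf)"
      by (rule rel_spmf_bindI) (simp add: state_ops)
    then show "rel_spmf (\<lambda>s' x. rreg s' r_sum = rreg s r_sum + x \<and> nreg s' n_i = Suc (nreg s n_i) \<and>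
      (\<forall>y. y \<noteq> r_sum \<longrightarrow> rreg s' y = rreg s y) \<and> nreg s' n_len = nreg s n_len \<and>
      rarr s' = rarr s \<and> clock s' \<le> clock s + nreg s n_len * (f_row M st + 3) + 4)
      (bind_spmf (exec I walk_code (?s v)) (exec I (incr n_i))) (spmf_of_pmf (walk_sum R (nreg s n_len) v'))"
      using v by (simp add: state_ops del: bind_spmf_of_pmf)
  qed
qed

lemma samples_effect:
  assumes "\<And>v. v \<le> n \<Longrightarrow> rarr s b_kept v = R v" "nreg s n_len = L"
    and "nreg s n_i + m = nat \<lceil>rreg s r_num\<rceil>"
  shows "rel_spmf (\<lambda>s' x. rreg s' r_sum = rreg s r_sum + x \<and> nreg s' n_i = nreg s n_i + m \<and>
      (\<forall>y. y \<noteq> r_sum \<longrightarrow> rreg s' y = rreg s y) \<and>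
      clock s' \<le> clock s + m * (L * (f_row M st + 3) + 5) + 1)
    (exec I (While (RLess (OfNat (NReg n_i)) (RReg r_num)) sample_code) s)
    (spmf_of_pmf (iid_sum (walk_sample R L) m))"
  using assms
proof (induction m arbitrary: s)
  case 0
  \<comment> \<open>A natural number is below \<open>r_num\<close> exactly when it is below its
    ceiling, so the loop realises the rounding that the machine cannot compute directly.\<close>
  then have "\<not> real (nreg s n_i) < rreg s r_num" by linarith
  then show ?case by (simp, subst while_loop.simps) (simp add: tick_def)
next
  case (Suc m)
  let ?W = "While (RLess (OfNat (NReg n_i)) (RReg r_num)) sample_code"
  have "real (nreg s n_i) < rreg s r_num" using Suc.prems(3) by linarith
  moreover have W: "exec I ?W = while_loop (\<lambda>s. real (nreg s n_i) < rreg s r_num) (exec I sample_code)"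
    by (rule ext) simp
  ultimately have ex: "exec I ?W s = bind_spmf (exec I sample_code (tick 1 s)) (exec I ?W)"
    unfolding W by (subst while_loop.simps) simp
  have sp: "spmf_of_pmf (iid_sum (walk_sample R L) (Suc m)) =
      bind_spmf (spmf_of_pmf (walk_sample R L)) (\<lambda>x. map_spmf ((+) x) (spmf_of_pmf (iid_sum (walk_sample R L) m)))"
    by (simp add: spmf_of_pmf_bind)
  have "rel_spmf (\<lambda>s' x. rreg s' r_sum = rreg (tick 1 s) r_sum + x \<and> nreg s' n_i = Suc (nreg (tick 1 s) n_i) \<and>
      (\<forall>y. y \<noteq> r_sum \<longrightarrow> rreg s' y = rreg (tick 1 s) y) \<and> nreg s' n_len = nreg (tick 1 s) n_len \<and>
      rarr s' = rarr (tick 1 s) \<and> clock s' \<le> clock (tick 1 s) + nreg (tick 1 s) n_len * (f_row M st + 3) + 4)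
    (exec I sample_code (tick 1 s)) (spmf_of_pmf (walk_sample R (nreg (tick 1 s) n_len)))"
    by (rule sample_effect) (use Suc.prems in \<open>simp add: tick_def\<close>)
  then have first: "rel_spmf (\<lambda>s' x. rreg s' r_sum = rreg s r_sum + x \<and> nreg s' n_i = Suc (nreg s n_i) \<and>
      (\<forall>y. y \<noteq> r_sum \<longrightarrow> rreg s' y = rreg s y) \<and> nreg s' n_len = L \<and>
      rarr s' = rarr s \<and> clock s' \<le> clock s + L * (f_row M st + 3) + 5)
    (exec I sample_code (tick 1 s)) (spmf_of_pmf (walk_sample R L))"
    using Suc.prems(2) by (simp add: tick_def add_ac)
  show ?case unfolding ex sp
  proof (rule rel_spmf_bindI[OF first])
    fix s2 :: state and x assume s2: "rreg s2 r_sum = rreg s r_sum + x \<and> nreg s2 n_i = Suc (nreg s n_i) \<and>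
      (\<forall>y. y \<noteq> r_sum \<longrightarrow> rreg s2 y = rreg s y) \<and> nreg s2 n_len = L \<and>
      rarr s2 = rarr s \<and> clock s2 \<le> clock s + L * (f_row M st + 3) + 5"
    show "rel_spmf (\<lambda>s' x. rreg s' r_sum = rreg s r_sum + x \<and> nreg s' n_i = nreg s n_i + Suc m \<and>
      (\<forall>y. y \<noteq> r_sum \<longrightarrow> rreg s' y = rreg s y) \<and>
      clock s' \<le> clock s + Suc m * (L * (f_row M st + 3) + 5) + 1) (exec I ?W s2)
      (map_spmf ((+) x) (spmf_of_pmf (iid_sum (walk_sample R L) m)))"
      unfolding spmf_rel_map(2)
      by (rule rel_spmf_mono[OF Suc.IH[of s2]]) (use s2 Suc.prems in auto)
  qed
qed

lemma estimate_effect: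
  fixes \<theta> \<epsilon> \<eta> :: real and L :: nat
  assumes R: "\<And>v. v \<le> n \<Longrightarrow> rarr s b_kept v = R v" and len: "nreg s n_len = L" and i: "nreg s n_i = 0"
    and regs: "rreg s r_norm = norm_p 1 t" "rreg s r_theta = \<theta>" "rreg s r_eps = \<epsilon>" "rreg s r_eta = \<eta>"
      "rreg s r_sum = 0" "rreg s r_res = q"
    and num: "num = 8 * norm_p 1 t * (real L * real L * \<theta>) / (\<epsilon> * \<epsilon> * \<eta>)"
    and N: "N = (if num < 1 then 0 else nat \<lceil>num\<rceil>)"
  shows "rel_spmf (\<lambda>s' x. result s' = (q + norm_p 1 t * x / real N) / 2 \<and>
      clock s' \<le> clock s + N * (L * (f_row M st + 3) + 5) + 4)
    (exec I estimate_code s) (spmf_of_pmf (iid_sum (walk_sample R L) N))"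
proof -
  define s1 where "s1 = s\<lparr>rreg := (rreg s)(r_num := num), clock := Suc (Suc (clock s))\<rparr>"
  let ?W = "While (RLess (OfNat (NReg n_i)) (RReg r_num)) sample_code"
  let ?fin = "SetR 0 (RDiv (RAdd (RReg r_res) (RDiv (RMul (RReg r_norm) (RReg r_sum)) (OfNat (NReg n_i)))) (RNum 2))"
  have ex: "exec I estimate_code s = bind_spmf (exec I (if num < 1 then Skip else ?W) s1) (exec I ?fin)"
    using regs len by (simp add: estimate_code_def state_ops s1_def num del: exec.simps(8))
  have "rel_spmf (\<lambda>s' x. rreg s' r_sum = rreg s1 r_sum + x \<and> nreg s' n_i = N \<and>
      (\<forall>y. y \<noteq> r_sum \<longrightarrow> rreg s' y = rreg s1 y) \<and>
      clock s' \<le> clock s1 + N * (L * (f_row M st + 3) + 5) + 1)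
    (exec I (if num < 1 then Skip else ?W) s1) (spmf_of_pmf (iid_sum (walk_sample R L) N))"
  proof (cases "num < 1")
    case True
    then show ?thesis using N i by (simp add: state_ops s1_def)
  next
    case False
    have "rel_spmf (\<lambda>s' x. rreg s' r_sum = rreg s1 r_sum + x \<and> nreg s' n_i = nreg s1 n_i + N \<and>
        (\<forall>y. y \<noteq> r_sum \<longrightarrow> rreg s' y = rreg s1 y) \<and>
        clock s' \<le> clock s1 + N * (L * (f_row M st + 3) + 5) + 1)
      (exec I ?W s1) (spmf_of_pmf (iid_sum (walk_sample R L) N))"
      by (rule samples_effect) (use R len i N False in \<open>simp_all add: s1_def\<close>)
    then show ?thesis using False i by (simp add: s1_def del: exec.simps)
  qed
  then have "rel_spmf (\<lambda>s' x. result s' = (q + norm_p 1 t * x / real N) / 2 \<and>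
      clock s' \<le> clock s + N * (L * (f_row M st + 3) + 5) + 4)
    (exec I estimate_code s) (bind_spmf (spmf_of_pmf (iid_sum (walk_sample R L) N)) return_spmf)"
    unfolding ex by (rule rel_spmf_bindI) (use regs in \<open>auto simp: s1_def state_ops result_def\<close>)
  then show ?thesis by (simp del: bind_spmf_of_pmf)
qed

end

section \<open>The whole run: distribution, time and accuracy of the result\<close>

lemma exec_Seq_fun: "exec I (Seq a b) = (\<lambda>s. bind_spmf (exec I a s) (exec I b))"
  by (rule ext) simp

lemma rel_surely_bind:
  "surely p Q \<Longrightarrow> (\<And>s. Q s \<Longrightarrow> rel_spmf R (f s) q) \<Longrightarrow> rel_spmf R (bind_spmf p f) q"
  by (auto simp: surely_def intro: rel_spmf_bindI1)

context push_run
begin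

text \<open>A terminated walk sits at \<open>n\<close> and must collect 0, whereas
  \<open>kept h w L n\<close> would refer to entries outside the matrix.\<close>

definition kept_ext :: "nat \<Rightarrow> nat \<Rightarrow> real" where
  "kept_ext L v = (if v < n then kept h w L v else 0)"

text \<open>All phases before sampling are handled by \<open>surely\<close> and then prefixed to one
  coupling. The 29 consists of 2 ticks for reading the diagonal and branching,
  \<open>3 + 4 + 16\<close> for the three push phases and 4 for the estimate.\<close>

lemma solver_effect:
  fixes \<theta> \<epsilon> \<eta> \<gamma> :: real and L :: nat
  assumes pos: "1 \<le> L" "0 < \<epsilon>" "0 < \<eta>"
    and bal: "bal = \<eta> * (\<epsilon> * \<epsilon>) * real (nnz M) / (real n * real (f_row M st) * (real L * real L * norm_p 1 t))"
    and \<theta>: "\<theta> = (1 / 2) ^ halvings bal" and h_eq: "h = \<theta> / d w"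
    and num: "num = 8 * norm_p 1 t * (real L * real L * \<theta>) / (\<epsilon> * \<epsilon> * \<eta>)"
    and N: "N = (if num < 1 then 0 else nat \<lceil>num\<rceil>)"
  shows "rel_spmf (\<lambda>s x.
      result s = (if \<epsilon> * \<epsilon> < d w then (reserve h w L + norm_p 1 t * x / real N) / 2 else 0) \<and>
      clock s \<le> 29 + 2 * halvings bal + 28 * (\<Sum>l<L. level_cost h w l) + N * (L * (f_row M st + 3) + 5))
    (exec I solver_code (init_state I w L \<epsilon> \<gamma> \<eta>)) (spmf_of_pmf (iid_sum (walk_sample (kept_ext L) L) N))"
    (is "rel_spmf ?P _ ?q")
proof (cases "\<epsilon> * \<epsilon> < d w")
  case False
  then show ?thesis using w
    by (auto simp: solver_code_def init_state_def Let_def state_ops rel_spmf_return_spmf1 result_def)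
next
  case True
  define s0 where "s0 = init_state I w L \<epsilon> \<gamma> \<eta>"
  define s1 where "s1 = s0\<lparr>rreg := (rreg s0)(r_diag := d w), clock := 2\<rparr>"
  define pre where "pre = Seq theta_code (Seq init_code levels_code)"
  have n_pos: "0 < n" using w by simp
  have bal_pos: "0 < bal" unfolding bal
    using pos n_pos n_le_nnz norm_1_t_pos f_row_pos by (intro divide_pos_pos mult_pos_pos) auto
  have ex: "exec I solver_code s0 = bind_spmf (exec I pre s1) (exec I estimate_code)"
    using True w by (simp add: solver_code_def pre_def s0_def s1_def init_state_def Let_def state_ops numeral_2_eq_2
      exec_Seq_fun)
  have s1: "nreg s1 n_dim = n" "nreg s1 n_src = w" "nreg s1 n_len = L" "nreg s1 n_nnz = nnz M"
    "nreg s1 n_frow = f_row M st" "rreg s1 r_eps = \<epsilon>" "rreg s1 r_eta = \<eta>" "rreg s1 r_norm = norm_p 1 t"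
    "rreg s1 r_diag = d w" "narr s1 = (\<lambda>_ _. 0)" "rarr s1 = (\<lambda>_ _. 0)" "clock s1 = 2"
    "\<And>x. n_lvl \<le> x \<Longrightarrow> nreg s1 x = 0" "\<And>x. r_theta \<le> x \<Longrightarrow> rreg s1 x = 0"
    by (simp_all add: s1_def s0_def init_state_def)
  have "surely (exec I pre s1) (\<lambda>s. (\<forall>v\<le>n. rarr s b_kept v = kept_ext L v) \<and> nreg s n_len = L \<and>
    nreg s n_i = 0 \<and> rreg s r_norm = norm_p 1 t \<and> rreg s r_theta = \<theta> \<and> rreg s r_eps = \<epsilon> \<and> rreg s r_eta = \<eta> \<and>
    rreg s r_sum = 0 \<and> rreg s r_res = reserve h w L \<and>
    clock s \<le> 25 + 2 * halvings bal + 28 * (\<Sum>l<L. level_cost h w l))" (is "surely _ ?G")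
  proof -
    have "surely (exec I theta_code s1) (\<lambda>s. nreg s = nreg s1 \<and> narr s = narr s1 \<and> rarr s = rarr s1 \<and>
      (\<forall>x. x \<noteq> r_bal \<and> x \<noteq> r_theta \<longrightarrow> rreg s x = rreg s1 x) \<and>
      rreg s r_theta = (1 / 2) ^ halvings bal \<and> clock s = clock s1 + 2 * halvings bal + 3)"
      by (rule theta_effect) (use bal_pos s1 in \<open>simp_all add: bal\<close>)
    then have "surely (exec I theta_code s1) (\<lambda>s. surely (exec I init_code s) (\<lambda>s. surely (exec I levels_code s) ?G))"
    proof (rule surely_mono)
      fix s :: state assume s: "nreg s = nreg s1 \<and> narr s = narr s1 \<and> rarr s = rarr s1 \<and>
        (\<forall>x. x \<noteq> r_bal \<and> x \<noteq> r_theta \<longrightarrow> rreg s x = rreg s1 x) \<and>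
        rreg s r_theta = (1 / 2) ^ halvings bal \<and> clock s = clock s1 + 2 * halvings bal + 3"
      define s2 where "s2 = s\<lparr>rreg := (rreg s)(r_thr := h),
        narr := (narr s)(a_queue := (narr s a_queue)(0 := w)), nreg := (nreg s)(n_tail := 1),
        rarr := (rarr s)(b_res := (rarr s b_res)(w := 1 / d w)), clock := clock s + 4\<rparr>"
      have "exec I init_code s = return_spmf s2"
        using s s1 \<theta> h_eq by (simp add: init_code_def s2_def state_ops numeral_eq_Suc)
      moreover have "surely (exec I levels_code s2) (\<lambda>s.
        (\<forall>x. x < n_lvl \<or> n_pos < x \<longrightarrow> nreg s x = nreg s2 x) \<and>
        (\<forall>x. x < r_res \<or> r_t < x \<longrightarrow> rreg s x = rreg s2 x) \<and>
        (\<forall>v<n. rarr s b_kept v = kept h w L v) \<and> rarr s b_kept n = 0 \<and> rreg s r_res = reserve h w L \<and>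
        clock s \<le> clock s2 + 28 * (\<Sum>l<L. level_cost h w l) + 16)"
      proof (rule levels_effect)
        have "supp (point w) = {w}" using w d_pos[OF w] by (auto simp: supp_def point_def)
        then show "level_inv 0 s2" using s s1 w
          by (auto simp: level_inv_def s2_def point_def kept_def reserve_def bij_betw_def)
        show "nreg s2 n_len = L" using s s1 by (simp add: s2_def)
      qed
      then have "surely (exec I levels_code s2) ?G"
        by (rule surely_mono) (use s s1 \<theta> in \<open>auto simp: s2_def kept_ext_def le_less\<close>)
      ultimately show "surely (exec I init_code s) (\<lambda>s. surely (exec I levels_code s) ?G)" by simp
    qed
    then show ?thesis by (simp add: pre_def)
  qed
  then have "rel_spmf ?P (bind_spmf (exec I pre s1) (exec I estimate_code)) ?q"
  proof (rule rel_surely_bind)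
    fix s assume s: "?G s"
    have "rel_spmf (\<lambda>s' x. result s' = (reserve h w L + norm_p 1 t * x / real N) / 2 \<and>
        clock s' \<le> clock s + N * (L * (f_row M st + 3) + 5) + 4)
      (exec I estimate_code s) ?q"
      by (rule estimate_effect[OF _ _ _ _ _ _ _ _ _ num N]) (use s in auto)
    then show "rel_spmf ?P (exec I estimate_code s) ?q"
      by (rule rel_spmf_mono) (use s True in auto)
  qed
  then show ?thesis using ex by (simp add: s0_def)
qed

text \<open>A sample is at most \<open>L * (L * h)\<close> and has mean at most
  \<open>2 * X / norm_p 1 t\<close>. The factor \<open>1 / d w\<close> in \<open>h\<close> cancels
  against the one in the squared error, and one \<open>X\<close> against the lower bound
  \<open>\<eta>\<close>. The 8 in \<open>num\<close> is the 4 of Chebyshev's inequality times the 2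
  in the mean.\<close>

lemma estimator_concentration:
  fixes \<theta> \<epsilon> \<eta> \<gamma> :: real and L :: nat
  assumes range: "unit_vec n w \<in> mat_range M" and g: "0 < \<gamma>" "\<gamma> \<le> gamma_max M"
    and eps: "0 < \<epsilon>" and eta: "0 < \<eta>" "\<eta> \<le> t \<bullet> xstar M (unit_vec n w)"
    and L: "L_trunc M t \<epsilon> \<gamma> \<eta> \<le> real L" and \<theta>: "0 < \<theta>" and h_eq: "h = \<theta> / d w"
    and num: "num = 8 * norm_p 1 t * (real L * real L * \<theta>) / (\<epsilon> * \<epsilon> * \<eta>)"
    and N: "N = (if num < 1 then 0 else nat \<lceil>num\<rceil>)"
  defines "X \<equiv> t \<bullet> xstar M (unit_vec n w)"
  shows "3 / 4 \<le> measure_pmf.prob (iid_sum (walk_sample (kept_ext L) L) N)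
    {x. \<bar>(if \<epsilon> * \<epsilon> < d w then (reserve h w L + norm_p 1 t * x / real N) / 2 else 0) - X\<bar>
      \<le> \<epsilon> * sqrt (1 / d w) * X}" (is "_ \<le> measure_pmf.prob ?p ?S")
proof -
  define E where "E = \<epsilon> * sqrt (1 / d w) * X"
  define T where "T = norm_p 1 t"
  define \<Phi> where "\<Phi> = potential L (kept_ext L)"
  define q where "q = reserve h w L"
  have dw: "0 < d w" by (rule d_pos[OF w])
  have X: "0 < X" "\<eta> \<le> X" using eta by (auto simp: X_def)
  have T: "0 < T" unfolding T_def by (rule norm_1_t_pos)
  have E: "0 < E" using eps X dw by (simp add: E_def)
  have E2: "E\<^sup>2 = \<epsilon>\<^sup>2 * X\<^sup>2 / d w"
    using dw by (simp add: E_def power_mult_distrib real_sqrt_divide power_divide)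
  have \<Phi>_eq: "\<Phi> = potential L (kept h w L)"
    unfolding \<Phi>_def potential_def t_dot_def
    using walk_op_pow_cong[of "kept_ext L" "kept h w L"]
    by (intro sum.cong refl) (simp add: kept_ext_def)
  have \<Phi>0: "0 \<le> \<Phi>" unfolding \<Phi>_eq using kept_bounds[OF w _ h] by (intro potential_nonneg)
  have q0: "0 \<le> q" unfolding q_def reserve_def
    using pushed_nonneg[OF w] by (intro sum_nonneg t_dot_nonneg)
  have hi: "q + \<Phi> \<le> 2 * X" and lo: "2 * X \<le> q + \<Phi> + E"
    using push_sandwich[OF w, where L = L and h = h] truncation[OF w range g eps eta L, folded X_def]
    unfolding E_def \<Phi>_eq q_def by (auto intro: order_trans)
  show ?thesis
  proof (cases "\<epsilon> * \<epsilon> < d w")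
    case False
    then have "d w \<le> \<epsilon>\<^sup>2" by (simp add: power2_eq_square)
    then have "sqrt (d w) \<le> \<epsilon>" using eps by (simp add: real_le_lsqrt)
    then have "1 \<le> \<epsilon> * sqrt (1 / d w)" using dw by (simp add: real_sqrt_divide field_simps)
    then have "1 * X \<le> \<epsilon> * sqrt (1 / d w) * X" using X by (intro mult_right_mono) auto
    then have "?S = UNIV" using False X by auto
    then show ?thesis by simp
  next
    case small: True
    show ?thesis
    proof (cases "num < 1")
      case True
      have "\<Phi> \<le> real L * (T * (real L * h))"
        unfolding \<Phi>_eq T_def using kept_bounds[OF w _ h] h by (intro potential_le) auto
      also have "\<dots> = num * (\<epsilon>\<^sup>2 * \<eta> / (8 * d w))"
        using eps eta dw by (simp add: num h_eq T_def power2_eq_square field_simps)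
      also have "\<dots> \<le> 1 * (\<epsilon>\<^sup>2 * \<eta> / (8 * d w))"
        using True eps eta dw by (intro mult_right_mono) auto
      \<comment> \<open>Here the guard enters: for \<open>\<epsilon> * \<epsilon> < d w\<close>, the
        quotient \<open>\<epsilon> * \<epsilon> / d w\<close> is at most
        \<open>\<epsilon> * sqrt (1 / d w)\<close>.\<close>
      also have "\<dots> \<le> E"
      proof -
        have "\<epsilon>\<^sup>2 < (sqrt (d w))\<^sup>2" using small dw by (simp add: power2_eq_square)
        then have "\<epsilon> \<le> sqrt (d w)" using dw by (meson less_imp_le power2_less_imp_less real_sqrt_ge_zero)
        then have "\<epsilon> * \<epsilon> * \<eta> \<le> \<epsilon> * sqrt (d w) * X"
          using eps X eta dw by (intro mult_mono) auto
        then have "\<epsilon> * \<epsilon> * \<eta> / d w \<le> \<epsilon> * sqrt (d w) * X / d w"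
          using dw by (intro divide_right_mono) auto
        also have "\<epsilon> * sqrt (d w) * X / d w = E"
          using dw by (simp add: E_def real_sqrt_divide field_simps)
        finally have "\<epsilon> * \<epsilon> * \<eta> / d w \<le> E" .
        moreover have "y / 8 \<le> E" if "y \<le> E" for y using that E by linarith
        moreover have "\<epsilon>\<^sup>2 * \<eta> / (8 * d w) = (\<epsilon> * \<epsilon> * \<eta> / d w) / 8" by (simp add: power2_eq_square)
        ultimately show ?thesis by (metis mult_1)
      qed
      finally have "\<Phi> \<le> E" .
      then have "\<bar>q / 2 - X\<bar> \<le> E" using hi lo \<Phi>0 by linarith
      then have "?S = UNIV" using small N True by (simp add: E_def q_def)
      then show ?thesis by simp
    next
      case False
      then have N1: "N = nat \<lceil>num\<rceil>" "1 \<le> num" using N by auto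
      then have N0: "0 < N" and N_ge: "num \<le> real N" by linarith+
      define K where "K = real L * (real L * h)"
      have bounds: "0 \<le> x \<and> x \<le> K" if "x \<in> set_pmf (walk_sample (kept_ext L) L)" for x
        unfolding K_def using kept_bounds[OF w _ h] h
        by (intro walk_sample_bounds[OF _ that]) (simp add: kept_ext_def)
      have mean: "measure_pmf.expectation (walk_sample (kept_ext L) L) (\<lambda>x. x) = \<Phi> / T"
        unfolding \<Phi>_def T_def by (rule expectation_walk_sample) (simp add: kept_ext_def)
      have "4 * (K * (\<Phi> / T)) \<le> real N * (E / T)\<^sup>2"
      proof -
        have "4 * K * \<Phi> * T \<le> 4 * K * (2 * X) * T"
          using hi q0 h T by (intro mult_right_mono mult_left_mono) (auto simp: K_def)
        also have "\<dots> = num * (\<epsilon>\<^sup>2 * \<eta> * X / d w)"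
          using eps eta dw by (simp add: num K_def h_eq T_def power2_eq_square field_simps)
        also have "\<dots> \<le> real N * (\<epsilon>\<^sup>2 * X * X / d w)"
          using N_ge N1 eps eta X dw by (intro mult_mono divide_right_mono mult_right_mono mult_left_mono) auto
        also have "\<dots> = real N * E\<^sup>2" unfolding E2 by (simp add: power2_eq_square)
        finally have "4 * K * \<Phi> * T \<le> real N * E\<^sup>2" .
        then have "4 * K * \<Phi> * T / T\<^sup>2 \<le> real N * E\<^sup>2 / T\<^sup>2" by (intro divide_right_mono) auto
        then show ?thesis using T by (simp add: power_divide power2_eq_square)
      qed
      then have "3 / 4 \<le> measure_pmf.prob ?p {S. \<bar>S / real N - \<Phi> / T\<bar> \<le> E / T}"
        using bounds mean N0 E T by (intro iid_sum_concentration[OF finite_walk_sample]) auto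
      also have "\<dots> \<le> measure_pmf.prob ?p ?S"
      proof (rule measure_pmf.finite_measure_mono)
        show "{S. \<bar>S / real N - \<Phi> / T\<bar> \<le> E / T} \<subseteq> ?S"
        proof
          fix S assume "S \<in> {S. \<bar>S / real N - \<Phi> / T\<bar> \<le> E / T}"
          then have "T * \<bar>S / real N - \<Phi> / T\<bar> \<le> E" using T by (simp add: field_simps)
          moreover have "T * \<bar>S / real N - \<Phi> / T\<bar> = \<bar>T * S / real N - \<Phi>\<bar>"
            using T abs_mult_pos[of T "S / real N - \<Phi> / T"] by (simp add: algebra_simps)
          \<comment> \<open>Truncation and sampling may each be off by \<open>E\<close>; the final
            division by 2 makes their sum admissible.\<close>
          moreover have "\<bar>(q + z) / 2 - X\<bar> \<le> E" if "\<bar>z - \<Phi>\<bar> \<le> E" for z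
            using that hi lo E unfolding abs_le_iff by (simp add: field_simps)
          ultimately have "\<bar>(q + T * S / real N) / 2 - X\<bar> \<le> E" by metis
          then show "S \<in> ?S" using small by (simp add: E_def q_def T_def)
        qed
      qed simp
      finally show ?thesis .
    qed
  qed
qed

end

section \<open>Balancing the costs on average over the sources\<close>

context rddz_target
begin

text \<open>At the ideal threshold \<open>\<theta>0\<close>, the push bound and the sampling bound
  both equal \<open>B\<close> up to constants. Sampling costs grow with \<open>\<theta>\<close>, so
  \<open>\<theta> <= \<theta>0\<close> is enough for them; push costs need
  \<open>\<theta>0 < 2 * \<theta>\<close>, which holds as soon as one halving has taken
  place.\<close>

lemma average_time:
  fixes \<theta> \<epsilon> \<eta> :: real and L F :: nat
  assumes pos: "1 \<le> L" "0 < \<epsilon>" "0 < \<eta>" "1 \<le> F" "0 < n"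
    and bal: "bal = \<eta> * (\<epsilon> * \<epsilon>) * real (nnz M) / (real n * real F * (real L * real L * norm_p 1 t))"
    and \<theta>: "\<theta> = (1 / 2) ^ halvings bal"
    and num: "num = 8 * norm_p 1 t * (real L * real L * \<theta>) / (\<epsilon> * \<epsilon> * \<eta>)"
    and N: "N = (if num < 1 then 0 else nat \<lceil>num\<rceil>)"
  shows "(\<Sum>w<n. real (29 + 2 * halvings bal + 28 * (\<Sum>l<L. level_cost (\<theta> / d w) w l) + N * (L * (F + 3) + 5))) / n
    \<le> 29 + 204 * (sqrt F * sqrt (real (nnz M) / n) * sqrt (norm_p 1 t) * (real L)\<^sup>2 / (\<epsilon> * sqrt \<eta>))"
proof -
  define T where "T = norm_p 1 t"
  define \<theta>0 where "\<theta>0 = sqrt bal"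
  define B where "B = sqrt F * sqrt (real (nnz M) / n) * sqrt T * (real L)\<^sup>2 / (\<epsilon> * sqrt \<eta>)"
  define W where "W = (\<Sum>w<n. \<Sum>l<L. real (level_cost (\<theta> / d w) w l))"
  have T: "0 < T" unfolding T_def by (rule norm_1_t_pos)
  note nnz = n_le_nnz
  have bal_pos: "0 < bal" unfolding bal T_def[symmetric]
    using pos nnz T by (intro divide_pos_pos mult_pos_pos) auto
  have \<theta>0: "0 < \<theta>0" using bal_pos by (simp add: \<theta>0_def)
  have \<theta>_pos: "0 < \<theta>" by (simp add: \<theta>)
  have \<theta>0_eq: "\<theta>0 = sqrt \<eta> * \<epsilon> * sqrt (real (nnz M) / n) / (sqrt F * L * sqrt T)"
    unfolding \<theta>0_def bal T_def[symmetric] using pos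
    by (simp add: real_sqrt_mult real_sqrt_divide)
  have B\<theta>0: "B * \<theta>0 = L * (real (nnz M) / n)"
  proof -
    define r where "r = sqrt (real (nnz M) / n)"
    have "B * \<theta>0 = L * (r * r)"
      unfolding B_def \<theta>0_eq r_def[symmetric] using pos T by (simp add: power2_eq_square mult_ac)
    then show ?thesis by (simp add: r_def)
  qed
  have B_eq: "T * real L ^ 3 * F * \<theta>0 / (\<epsilon> * \<epsilon> * \<eta>) = B"
  proof -
    have sq: "T = sqrt T * sqrt T" "real F = sqrt F * sqrt F" "\<eta> = sqrt \<eta> * sqrt \<eta>"
      using T pos by simp_all
    show ?thesis unfolding B_def \<theta>0_eq using pos T
      by (subst (1) sq(1), subst (1) sq(2), subst (2) sq(3))
        (simp add: power2_eq_square power3_eq_cube field_simps)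
  qed
  have ratio: "1 \<le> L * (real (nnz M) / n)"
    using mult_mono[of 1 "real L" 1 "real (nnz M) / n"] pos nnz by (simp add: field_simps)
  have B0: "0 \<le> B" using pos T by (simp add: B_def)
  have four: "(1 / 4) ^ k = ((1 / 2 :: real) ^ k)\<^sup>2" for k :: nat
    by (simp add: power2_eq_square power_mult_distrib[symmetric])
  have \<theta>_le: "\<theta> \<le> \<theta>0"
    using halvings_le[OF bal_pos] \<theta>_pos unfolding \<theta>0_def four \<theta>[symmetric] by (intro real_le_rsqrt)
  have inv_\<theta>: "L * (real (nnz M) / n) / \<theta> \<le> 2 * B" if J: "halvings bal \<noteq> 0"
  proof -
    obtain k where k: "halvings bal = Suc k" using J by (cases "halvings bal") auto
    then have "bal < (2 * \<theta>)\<^sup>2" using less_halvings[of k bal] by (simp add: four \<theta>)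
    then have "\<theta>0 < 2 * \<theta>" unfolding \<theta>0_def using \<theta>_pos by (intro real_less_lsqrt) auto
    then have "B * \<theta>0 \<le> B * (2 * \<theta>)" using B0 by (intro mult_left_mono) auto
    then have "L * (real (nnz M) / n) \<le> 2 * B * \<theta>" using B\<theta>0 by (simp add: mult_ac)
    then show ?thesis by (simp only: pos_divide_le_eq[OF \<theta>_pos])
  qed
  \<comment> \<open>The search time is absorbed because the number of halvings is at most
    \<open>1 / \<theta>\<close>, and \<open>L * nnz M / n\<close> is at least 1.\<close>
  have J: "2 * real (halvings bal) \<le> 4 * B"
  proof (cases "halvings bal = 0")
    case False
    have "real (halvings bal) \<le> 2 ^ halvings bal" by (rule of_nat_less_two_power[THEN less_imp_le])
    also have "\<dots> = 1 / \<theta>" by (simp add: \<theta> power_divide)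
    also have "\<dots> \<le> L * (real (nnz M) / n) / \<theta>" using ratio \<theta>_pos by (intro divide_right_mono) auto
    also have "\<dots> \<le> 2 * B" by (rule inv_\<theta>[OF False])
    finally show ?thesis by simp
  qed (use B0 in simp)
  have W: "W / n \<le> 2 * B"
  proof (cases "halvings bal = 0")
    case True
    then have "W = 0" by (simp add: W_def \<theta> level_cost_eq_0)
    then show ?thesis using B0 by simp
  next
    case False
    have "\<theta> * W = (\<Sum>l<L. \<theta> * (\<Sum>w<n. real (level_cost (\<theta> / d w) w l)))"
      unfolding W_def by (subst sum.swap) (simp add: sum_distrib_left)
    also have "\<dots> \<le> (\<Sum>l<L. real (nnz M))" using sum_level_cost[OF \<theta>_pos] by (intro sum_mono)
    finally have "W \<le> L * real (nnz M) / \<theta>" using \<theta>_pos by (simp add: field_simps)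
    then have "W / n \<le> L * real (nnz M) / \<theta> / n" using pos by (intro divide_right_mono) auto
    also have "\<dots> = L * (real (nnz M) / n) / \<theta>" by simp
    also have "\<dots> \<le> 2 * B" by (rule inv_\<theta>[OF False])
    finally show ?thesis .
  qed
  have MC: "real N * (real L * (real F + 3) + 5) \<le> 144 * B"
  proof (cases "num < 1")
    case False
    \<comment> \<open>Rounding up is harmless only for \<open>num >= 1\<close>; this is why no
      sample is drawn below 1. The 144 is this 2 times 9 for the loop overhead times the 8 in
      \<open>num\<close>.\<close>
    have "real N \<le> 2 * num" using N False by (simp) linarith
    moreover have "real L * (real F + 3) + 5 \<le> 9 * (real L * real F)"
    proof -
      have "1 \<le> real L * real F" "real L \<le> real L * real F"
        using mult_mono[of 1 "real L" 1 "real F"] mult_left_mono[of 1 "real F" "real L"] pos by simp_all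
      then show ?thesis unfolding distrib_left by linarith
    qed
    ultimately have "real N * (real L * (real F + 3) + 5) \<le> 2 * num * (9 * (real L * real F))"
      using False by (intro mult_mono) auto
    also have "\<dots> = 144 * (T * real L ^ 3 * F * \<theta> / (\<epsilon> * \<epsilon> * \<eta>))"
      by (simp add: num T_def power3_eq_cube)
    also have "\<dots> \<le> 144 * (T * real L ^ 3 * F * \<theta>0 / (\<epsilon> * \<epsilon> * \<eta>))"
      using \<theta>_le T pos by (intro mult_left_mono divide_right_mono) auto
    finally show ?thesis unfolding B_eq .
  qed (use N B0 in simp)
  have "(\<Sum>w<n. real (29 + 2 * halvings bal + 28 * (\<Sum>l<L. level_cost (\<theta> / d w) w l) + N * (L * (F + 3) + 5))) / n
      = 29 + 2 * real (halvings bal) + 28 * (W / n) + real N * (real L * (real F + 3) + 5)"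
    using pos by (simp add: sum.distrib W_def sum_distrib_left[symmetric] field_simps)
  \<comment> \<open>\<open>204 = 4 + 28 * 2 + 144\<close>.\<close>
  also have "\<dots> \<le> 29 + 204 * B" using J W MC by linarith
  finally show ?thesis by (simp add: B_def T_def)
qed

end

theorem theorem7p5:
  fixes c :: nat and \<kappa> :: real
  assumes "c \<ge> 1" and "\<kappa> \<ge> 1"
  shows "\<exists>(P :: com) (C :: real). \<forall>(n :: nat) (M :: real mat) (t :: real vec)
      (rl :: nat \<Rightarrow> nat list) (cl :: nat \<Rightarrow> nat list) (st :: nat \<Rightarrow> nat)
      (\<epsilon> :: real) (\<gamma> :: real) (\<eta> :: real) (L' :: nat).
    M \<in> carrier_mat n n \<and> t \<in> carrier_vec n \<and> t \<noteq> 0\<^sub>v n \<and>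
    rddz M \<and> (\<forall>i<n. 0 \<le> t $ i) \<and>
    (\<forall>w<n. poly_entries c M (unit_vec n w) t) \<and>
    valid_access M rl cl st \<and>
    0 < \<epsilon> \<and> 0 < \<gamma> \<and> \<gamma> \<le> gamma_max M \<and> 0 < \<eta> \<and>
    L_trunc M t \<epsilon> \<gamma> \<eta> \<le> real L' \<and> real L' \<le> \<kappa> * L_trunc M t \<epsilon> \<gamma> \<eta> \<longrightarrow>
    (let run = (\<lambda>w. let I = unit_problem M t rl cl st w in exec I P (init_state I w L' \<epsilon> \<gamma> \<eta>)) in
      (\<forall>w<n. let b = unit_vec n w in
         b \<in> mat_range M \<and> \<eta> \<le> t \<bullet> xstar M b \<longrightarrow>
         measure (measure_spmf (run w))
           {s. \<bar>result s - t \<bullet> xstar M b\<bar>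
                 \<le> \<epsilon> * sqrt (norm_p \<infinity> (diag_inv M *\<^sub>v b)) * (t \<bullet> xstar M b)} \<ge> 3 / 4) \<and>
      (\<exists>T :: nat \<Rightarrow> nat.
         (\<forall>w<n. halts_within (T w) (run w)) \<and>
         (\<Sum>w<n. real (T w)) / real n
           \<le> C * max 1 (sqrt (real (f_row M st)) * sqrt (real (nnz M) / real n) * sqrt (norm_p 1 t) *
                         (L_trunc M t \<epsilon> \<gamma> \<eta>)\<^sup>2 / (\<epsilon> * sqrt \<eta>))))"
proof (intro exI allI impI, elim conjE)
  fix n :: nat and M :: "real mat" and t :: "real vec" and rl cl :: "nat \<Rightarrow> nat list" and st :: "nat \<Rightarrow> nat"
    and \<epsilon> \<gamma> \<eta> :: real and L' :: nat
  assume M: "M \<in> carrier_mat n n" and t: "t \<in> carrier_vec n" "t \<noteq> 0\<^sub>v n" and "rddz M"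
    and t_nonneg: "\<forall>i<n. 0 \<le> t $ i" and valid: "valid_access M rl cl st"
    and eps: "0 < \<epsilon>" and g: "0 < \<gamma>" "\<gamma> \<le> gamma_max M" and eta: "0 < \<eta>"
    and L: "L_trunc M t \<epsilon> \<gamma> \<eta> \<le> real L'" "real L' \<le> \<kappa> * L_trunc M t \<epsilon> \<gamma> \<eta>"
  interpret rddz_target n M t
    using M t \<open>rddz M\<close> t_nonneg by unfold_locales auto
  define run where "run w = exec (unit_problem M t rl cl st w) solver_code
    (init_state (unit_problem M t rl cl st w) w L' \<epsilon> \<gamma> \<eta>)" for w
  define bal where "bal = \<eta> * (\<epsilon> * \<epsilon>) * real (nnz M) /
    (real n * real (f_row M st) * (real L' * real L' * norm_p 1 t))"
  define \<theta> :: real where "\<theta> = (1 / 2) ^ halvings bal"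
  define num where "num = 8 * norm_p 1 t * (real L' * real L' * \<theta>) / (\<epsilon> * \<epsilon> * \<eta>)"
  define N where "N = (if num < 1 then 0 else nat \<lceil>num\<rceil>)"
  define T where "T w = 29 + 2 * halvings bal + 28 * (\<Sum>l<L'. level_cost (\<theta> / d w) w l) +
    N * (L' * (f_row M st + 3) + 5)" for w
  have \<theta>_pos: "0 < \<theta>" by (simp add: \<theta>_def)
  have L1: "1 \<le> L_trunc M t \<epsilon> \<gamma> \<eta>"
    unfolding L_trunc_def by (intro Max_ge) (auto simp: admissible_def)
  then have L'1: "1 \<le> L'" using L by linarith
  \<comment> \<open>The average divides by \<open>n\<close>; a nonzero \<open>t\<close> excludes
    dimension 0.\<close>
  have "t = 0\<^sub>v n" if "n = 0" using t that by (intro eq_vecI) auto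
  then have n_pos: "0 < n" using t_nz by blast
  have sub: "push_run n M t rl cl st w (\<theta> / d w)" if "w < n" for w
    using valid that d_pos[OF that] \<theta>_pos by unfold_locales auto
  define est where "est w x = (if \<epsilon> * \<epsilon> < d w then (reserve (\<theta> / d w) w L' + norm_p 1 t * x / real N) / 2 else 0)" for w x
  \<comment> \<open>The coupling covers every \<open>w < n\<close>, admissible or not, as the
    average of the running times requires.\<close>
  have coupling: "rel_spmf (\<lambda>s x.
      result s = est w x \<and>
      clock s \<le> T w) (run w)
      (spmf_of_pmf (iid_sum (walk_sample (push_run.kept_ext n M w (\<theta> / d w) L') L') N))" if "w < n" for w
    unfolding run_def T_def est_def
    by (rule push_run.solver_effect[OF sub[OF that] L'1 eps eta bal_def \<theta>_def refl num_def N_def])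
  have correct: "3 / 4 \<le> measure (measure_spmf (run w)) {s. \<bar>result s - t \<bullet> xstar M (unit_vec n w)\<bar>
      \<le> \<epsilon> * sqrt (norm_p \<infinity> (diag_inv M *\<^sub>v unit_vec n w)) * (t \<bullet> xstar M (unit_vec n w))}" (is "_ \<le> measure _ ?G")
    if w: "w < n" and b: "unit_vec n w \<in> mat_range M" "\<eta> \<le> t \<bullet> xstar M (unit_vec n w)" for w
  proof -
    let ?X = "t \<bullet> xstar M (unit_vec n w)"
    let ?p = "iid_sum (walk_sample (push_run.kept_ext n M w (\<theta> / d w) L') L') N"
    let ?S = "{x. \<bar>est w x - ?X\<bar>
      \<le> \<epsilon> * sqrt (1 / d w) * ?X}"
    have "3 / 4 \<le> measure_pmf.prob ?p ?S"
      unfolding est_def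
      by (rule push_run.estimator_concentration[OF sub[OF w] b(1) g eps eta b(2) L(1) \<theta>_pos refl num_def N_def])
    also have "\<dots> = measure (measure_spmf (spmf_of_pmf ?p)) ?S" by (simp add: measure_spmf_spmf_of_pmf)
    also have "\<dots> \<le> measure (measure_spmf (run w)) {s. \<exists>x\<in>?S.
      (\<lambda>s x. result s = est w x \<and>
      clock s \<le> T w)\<inverse>\<inverse> x s}"
      \<comment> \<open>The converse coupling carries probability from the good samples to the
        states paired with them.\<close>
      by (rule rel_spmf_measureD) (subst spmf_rel_conversep, rule conversepI, rule coupling[OF w])
    also have "\<dots> \<le> measure (measure_spmf (run w)) ?G"
      by (rule measure_spmf.finite_measure_mono) (auto simp: norm_diag_inv_unit[OF w])
    finally show ?thesis .
  qed
  have halts: "halts_within (T w) (run w)" if "w < n" for w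
  proof -
    \<comment> \<open>Forgetting the sample couples the run with a point mass, which amounts to
      losslessness together with the time bound on the support.\<close>
    have "rel_spmf (\<lambda>s _. clock s \<le> T w) (bind_spmf (run w) return_spmf)
        (bind_spmf (spmf_of_pmf (iid_sum (walk_sample (push_run.kept_ext n M w (\<theta> / d w) L') L') N)) (\<lambda>_. return_spmf ()))"
      by (rule rel_spmf_bindI[OF coupling[OF that]]) simp
    then have "rel_spmf (\<lambda>s _. clock s \<le> T w) (run w) (return_spmf ())"
      by (simp add: bind_pmf_const)
    then show ?thesis by (simp add: rel_spmf_return_spmf2 halts_within_def)
  qed
  have frow: "1 \<le> f_row M st" by (rule push_run.f_row_pos[OF sub[OF n_pos]])
  define A where "A = sqrt (real (f_row M st)) * sqrt (real (nnz M) / real n) * sqrt (norm_p 1 t) / (\<epsilon> * sqrt \<eta>)"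
  have A: "0 \<le> A" using eps eta norm_1_t_pos by (simp add: A_def)
  have "(\<Sum>w<n. real (T w)) / real n \<le> 29 + 204 * (A * (real L')\<^sup>2)"
    using average_time[OF L'1 eps eta frow n_pos bal_def \<theta>_def num_def N_def]
    by (simp add: T_def A_def mult_ac)
  also have "(real L')\<^sup>2 \<le> (\<kappa> * L_trunc M t \<epsilon> \<gamma> \<eta>)\<^sup>2"
    using L by (intro power_mono) auto
  then have "29 + 204 * (A * (real L')\<^sup>2) \<le> 29 + 204 * (A * (\<kappa> * L_trunc M t \<epsilon> \<gamma> \<eta>)\<^sup>2)"
    using A by (intro add_left_mono mult_left_mono) auto
  also have "\<dots> = 29 * 1 + 204 * \<kappa>\<^sup>2 * (A * (L_trunc M t \<epsilon> \<gamma> \<eta>)\<^sup>2)"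
    by (simp add: power_mult_distrib)
  also have "\<dots> \<le> 29 * \<kappa>\<^sup>2 * max 1 (A * (L_trunc M t \<epsilon> \<gamma> \<eta>)\<^sup>2) +
      204 * \<kappa>\<^sup>2 * max 1 (A * (L_trunc M t \<epsilon> \<gamma> \<eta>)\<^sup>2)"
  proof (intro add_mono mult_left_mono)
    \<comment> \<open>The constant overhead 29 is absorbed by the maximum with 1, giving
      \<open>233 = 29 + 204\<close>; \<open>\<kappa>\<close> enters squared because the known
      parameter may exceed \<open>L_trunc\<close> by that factor.\<close>
    have "1 * 1 \<le> \<kappa>\<^sup>2 * max 1 (A * (L_trunc M t \<epsilon> \<gamma> \<eta>)\<^sup>2)"
      using assms(2) by (intro mult_mono) (auto simp: one_le_power)
    then show "29 * 1 \<le> 29 * \<kappa>\<^sup>2 * max 1 (A * (L_trunc M t \<epsilon> \<gamma> \<eta>)\<^sup>2)" by simp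
  qed auto
  also have "\<dots> = 233 * \<kappa>\<^sup>2 * max 1 (A * (L_trunc M t \<epsilon> \<gamma> \<eta>)\<^sup>2)" by simp
  finally have time: "(\<Sum>w<n. real (T w)) / real n \<le> 233 * \<kappa>\<^sup>2 * max 1
      (sqrt (real (f_row M st)) * sqrt (real (nnz M) / real n) * sqrt (norm_p 1 t) *
        (L_trunc M t \<epsilon> \<gamma> \<eta>)\<^sup>2 / (\<epsilon> * sqrt \<eta>))"
    by (simp add: A_def)
  show "let run = (\<lambda>w. let I = unit_problem M t rl cl st w in exec I solver_code (init_state I w L' \<epsilon> \<gamma> \<eta>)) in
      (\<forall>w<n. let b = unit_vec n w in
         b \<in> mat_range M \<and> \<eta> \<le> t \<bullet> xstar M b \<longrightarrow>
         measure (measure_spmf (run w))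
           {s. \<bar>result s - t \<bullet> xstar M b\<bar>
                 \<le> \<epsilon> * sqrt (norm_p \<infinity> (diag_inv M *\<^sub>v b)) * (t \<bullet> xstar M b)} \<ge> 3 / 4) \<and>
      (\<exists>T :: nat \<Rightarrow> nat.
         (\<forall>w<n. halts_within (T w) (run w)) \<and>
         (\<Sum>w<n. real (T w)) / real n
           \<le> 233 * \<kappa>\<^sup>2 * max 1 (sqrt (real (f_row M st)) * sqrt (real (nnz M) / real n) * sqrt (norm_p 1 t) *
                         (L_trunc M t \<epsilon> \<gamma> \<eta>)\<^sup>2 / (\<epsilon> * sqrt \<eta>)))"
    unfolding Let_def run_def[symmetric]
    using correct halts time by blast
qed


end
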